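(* Let $(V,E,\Psi)$ be a strongly connected planar box-like self-affine GIFS satisfying the rectangular open set condition (ROSC), let $\mathcal P$ be an associated positive vector, and let $\{\mu_v\}_{v\in V}$ be the associated graph-directed box-like self-affine measure family. Then for all $q\ge 0$ and $v\in V$, the $L^q$-spectrum $\tau_{\mu_v}(q)$ exists and equals $\gamma(q)$, where $\gamma(q)$ is the unique real number with $P(\gamma(q),q)=1$ and $P$ is the pressure function of $(V,E,\Psi)$ and $\mathcal P$.
   Context: Graph: $(V,E)$ is a finite directed graph (loops and multiple edges allowed) in which every vertex is the initial vertex of at least one edge; $i(e),t(e)$ are the initial and terminal vertices of $e\in E$. $E^k$ ($k\ge1$) is the set of words $w=w_1\cdots w_k$ of edges with $t(w_{j-1})=i(w_j)$ for $1<j\le k$; $E^*=\bigcup_{k\ge1}E^k$; $i(w)=i(w_1)$, $t(w)=t(w_k)$, $|w|=k$; $v\xrightarrow{w}v'$ means $i(w)=v,t(w)=v'$. Strongly connected: for all $v,v'\in V$ there is $w\in E^*$ with $v\xrightarrow{w}v'$. A planar box-like self-affine GIFS $(V,E,\Psi)$ consists of such a graph and maps $\Psi=\{\psi_e\}_{e\in E}$, $\psi_e(\xi)=T_e\xi+t_e$ on $\mathbb R^2$ with $t_e\in\mathbb R^2$, where each $T_e$ is either diagonal, $T_e=\begin{pmatrix}\pm a_e&0\\0&\pm b_e\end{pmatrix}$, or anti-diagonal, $T_e=\begin{pmatrix}0&\pm a_e\\ \pm b_e&0\end{pmatrix}$, with $0<a_e,b_e<1$. ROSC: for every $v\in V$,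 the sets $\psi_e((0,1)^2)$ with $i(e)=v$ are pairwise disjoint subsets of $(0,1)^2$. There is a unique family $\{X_v\}_{v\in V}$ of non-empty compact sets with $X_v=\bigcup_{e:\,i(e)=v}\psi_e(X_{t(e)})$. An associated positive vector is $\mathcal P=(p_e)_{e\in E}$ with $p_e>0$ and $\sum_{e:\,i(e)=v}p_e=1$ for all $v$. The associated family $\{\mu_v\}_{v\in V}$ is the unique family of Borel probability measures, $\mu_v$ supported on $X_v$, with $\mu_v=\sum_{e:\,i(e)=v}p_e\,\mu_{t(e)}\circ\psi_e^{-1}$. Let $\pi_x(\xi_1,\xi_2)=\xi_1$, $\pi_y(\xi_1,\xi_2)=\xi_2$ and, for a measure $\mu$ on $\mathbb R^2$, $\pi_x(\mu)=\mu\circ\pi_x^{-1}$, $\pi_y(\mu)=\mu\circ\pi_y^{-1}$. $L^q$-spectrum: for a compactly supported Borel probability measure $\nu$ on $\mathbb R^n$ and $q\ge0$, let $\mathcal D^q_\delta(\nu)=\sum_Q\nu(Q)^q$ over closed cubes $Q$ of the $\delta$-mesh (for $q=0$, the number of cubes with $\nu(Q)>0$), and $\tau_\nu(q)=\lim_{\delta\to0+}\frac{\log\mathcal D^q_\delta(\nu)}{-\log\delta}$ when the limit exists. It exists for all measures $\pi_x(\mu_v),\pi_y(\mu_v)$, $v\in V$, $q\ge0$. Pressure function: for $w=w_1\cdots w_k\in E^*$ let $p_w=p_{w_1}\cdots p_{w_k}$, $T_w=T_{w_1}\cdots T_{w_k}$, $\psi_w=\psi_{w_1}\circ\cdots\circ\psi_{w_k}$;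 let $c_w,d_w$ be the width and height of the rectangle $\psi_w([0,1]^2)$ and $\alpha_1(w)\ge\alpha_2(w)$ the singular values of $T_w$ (so $\alpha_1(w)=\max\{c_w,d_w\}$, $\alpha_2(w)=\min\{c_w,d_w\}$). Put $\pi_w=\pi_x$ if ($c_w\ge d_w$ and $T_w$ diagonal) or ($c_w<d_w$ and $T_w$ anti-diagonal), and $\pi_w=\pi_y$ otherwise; $\tau_w(q)=\tau_{\pi_w(\mu_{t(w)})}(q)$. For $s\in\mathbb R$, $q\ge0$ let $\varphi^{s,q}(w)=p_w^q\,\alpha_1(w)^{\tau_w(q)}\alpha_2(w)^{s-\tau_w(q)}$, let $A_k^{s,q}$ be the $\#V\times\#V$ matrix with entries $A_k^{s,q}(v,v')=\sum_{w\in E^k:\,v\xrightarrow{w}v'}\varphi^{s,q}(w)$, and $P(s,q)=\lim_{k\to\infty}\|A_k^{s,q}\|^{1/k}$, where $\|\cdot\|$ is the sum of absolute values of entries. The limit exists, and for each $q\ge0$ there is a unique $s\in\mathbb R$ with $P(s,q)=1$. *)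

theory Defs
  imports "HOL-Probability.Probability" "Graph_Theory.Arc_Walk"
begin

section \<open>Words in a directed graph\<close>

text \<open>The words \<open>w\<close> of length \<open>k\<close> with \<open>v \<rightarrow> v'\<close>. Loops and multiple edges are allowed in
  \<^locale>\<open>fin_digraph\<close>. The empty word occurs only for \<open>k = 0\<close>, which is not used below.\<close>

definition words :: "('v, 'e) pre_digraph \<Rightarrow> nat \<Rightarrow> 'v \<Rightarrow> 'v \<Rightarrow> 'e list set" where
  "words G k v v' = {w. length w = k \<and> pre_digraph.awalk G v w v'}"

text \<open>The connecting word must be non-empty also when \<open>v = v'\<close>, in contrast to the
  reflexive reachability relation of the library.\<close>

definition strongly_connected_graph :: "('v, 'e) pre_digraph \<Rightarrow> bool" where
  "strongly_connected_graph G \<longleftrightarrow>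
     (\<forall>v\<in>verts G. \<forall>v'\<in>verts G. \<exists>k\<ge>1. words G k v v' \<noteq> {})"


section \<open>Planar box-like self-affine GIFS\<close>

definition is_diagonal :: "real^2^2 \<Rightarrow> bool" where
  "is_diagonal M \<longleftrightarrow> M $ 1 $ 2 = 0 \<and> M $ 2 $ 1 = 0"

definition is_antidiagonal :: "real^2^2 \<Rightarrow> bool" where
  "is_antidiagonal M \<longleftrightarrow> M $ 1 $ 1 = 0 \<and> M $ 2 $ 2 = 0"

definition box_like :: "real^2^2 \<Rightarrow> bool" where
  "box_like M \<longleftrightarrow>
     (is_diagonal M \<and> 0 < \<bar>M $ 1 $ 1\<bar> \<and> \<bar>M $ 1 $ 1\<bar> < 1 \<and> 0 < \<bar>M $ 2 $ 2\<bar> \<and> \<bar>M $ 2 $ 2\<bar> < 1) \<or>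
     (is_antidiagonal M \<and> 0 < \<bar>M $ 1 $ 2\<bar> \<and> \<bar>M $ 1 $ 2\<bar> < 1 \<and> 0 < \<bar>M $ 2 $ 1\<bar> \<and> \<bar>M $ 2 $ 1\<bar> < 1)"

text \<open>Throughout, \<open>T e\<close> is the linear part and \<open>t e\<close> the translation part of the map of the
  edge \<open>e\<close>; the translations are unrestricted.\<close>

definition edge_map :: "('e \<Rightarrow> real^2^2) \<Rightarrow> ('e \<Rightarrow> real^2) \<Rightarrow> 'e \<Rightarrow> real^2 \<Rightarrow> real^2" where
  "edge_map T t e \<xi> = T e *v \<xi> + t e"

definition box_like_GIFS :: "('v, 'e) pre_digraph \<Rightarrow> ('e \<Rightarrow> real^2^2) \<Rightarrow> bool" where
  "box_like_GIFS G T \<longleftrightarrow>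
     fin_digraph G \<and> (\<forall>v\<in>verts G. out_arcs G v \<noteq> {}) \<and> (\<forall>e\<in>arcs G. box_like (T e))"

definition ROSC :: "('v, 'e) pre_digraph \<Rightarrow> ('e \<Rightarrow> real^2^2) \<Rightarrow> ('e \<Rightarrow> real^2) \<Rightarrow> bool" where
  "ROSC G T t \<longleftrightarrow>
     (\<forall>v\<in>verts G.
        (\<forall>e\<in>out_arcs G v. edge_map T t e ` box 0 1 \<subseteq> box 0 1) \<and>
        disjoint_family_on (\<lambda>e. edge_map T t e ` box 0 1) (out_arcs G v))"

definition attractor_family ::
  "('v, 'e) pre_digraph \<Rightarrow> ('e \<Rightarrow> real^2^2) \<Rightarrow> ('e \<Rightarrow> real^2) \<Rightarrow> ('v \<Rightarrow> (real^2) set) \<Rightarrow> bool" where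
  "attractor_family G T t X \<longleftrightarrow>
     (\<forall>v\<in>verts G. X v \<noteq> {} \<and> compact (X v) \<and>
        X v = (\<Union>e\<in>out_arcs G v. edge_map T t e ` X (head G e)))"

definition associated_positive_vector :: "('v, 'e) pre_digraph \<Rightarrow> ('e \<Rightarrow> real) \<Rightarrow> bool" where
  "associated_positive_vector G p \<longleftrightarrow>
     (\<forall>e\<in>arcs G. p e > 0) \<and> (\<forall>v\<in>verts G. (\<Sum>e\<in>out_arcs G v. p e) = 1)"

definition associated_measure_family ::
  "('v, 'e) pre_digraph \<Rightarrow> ('e \<Rightarrow> real^2^2) \<Rightarrow> ('e \<Rightarrow> real^2) \<Rightarrow> ('e \<Rightarrow> real)
   \<Rightarrow> ('v \<Rightarrow> (real^2) set) \<Rightarrow> ('v \<Rightarrow> (real^2) measure) \<Rightarrow> bool" where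
  "associated_measure_family G T t p X \<mu> \<longleftrightarrow>
     (\<forall>v\<in>verts G.
        prob_space (\<mu> v) \<and> sets (\<mu> v) = sets borel \<and> measure (\<mu> v) (X v) = 1 \<and>
        (\<forall>A\<in>sets borel.
           measure (\<mu> v) A =
             (\<Sum>e\<in>out_arcs G v. p e * measure (distr (\<mu> (head G e)) borel (edge_map T t e)) A)))"

definition proj_x :: "(real^2) measure \<Rightarrow> real measure" where
  "proj_x \<nu> = distr \<nu> borel (\<lambda>\<xi>. \<xi> $ 1)"

definition proj_y :: "(real^2) measure \<Rightarrow> real measure" where
  "proj_y \<nu> = distr \<nu> borel (\<lambda>\<xi>. \<xi> $ 2)"


section \<open>The $L^q$-spectrum\<close>

text \<open>\<open>mesh_cube \<delta> z\<close>, for \<open>z\<close> an integer point, runs through the closed cubes of the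
  \<open>\<delta>\<close>-mesh.\<close>

definition integer_points :: "'a::euclidean_space set" where
  "integer_points = {z. \<forall>b\<in>Basis. z \<bullet> b \<in> \<int>}"

definition mesh_cube :: "real \<Rightarrow> 'a::euclidean_space \<Rightarrow> 'a set" where
  "mesh_cube \<delta> z = cbox (\<delta> *\<^sub>R z) (\<delta> *\<^sub>R (z + One))"

text \<open>For compactly supported \<open>\<nu>\<close> and \<open>\<delta> > 0\<close> only finitely many summands are non-zero.
  Since \<open>0 powr 0 = 0\<close> and \<open>x powr 0 = 1\<close> for \<open>x > 0\<close>, the case \<open>q = 0\<close> counts the cubes of
  positive measure.\<close>

definition moment_sum :: "'a::euclidean_space measure \<Rightarrow> real \<Rightarrow> real \<Rightarrow> real" where
  "moment_sum \<nu> q \<delta> = (\<Sum>\<^sub>\<infinity>z\<in>integer_points. measure \<nu> (mesh_cube \<delta> z) powr q)"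

definition Lq_quotient :: "'a::euclidean_space measure \<Rightarrow> real \<Rightarrow> real \<Rightarrow> real" where
  "Lq_quotient \<nu> q \<delta> = ln (moment_sum \<nu> q \<delta>) / (- ln \<delta>)"

definition Lq_spectrum_exists :: "'a::euclidean_space measure \<Rightarrow> real \<Rightarrow> bool" where
  "Lq_spectrum_exists \<nu> q \<longleftrightarrow> (\<exists>l. (Lq_quotient \<nu> q \<longlongrightarrow> l) (at_right 0))"

definition Lq_spectrum :: "'a::euclidean_space measure \<Rightarrow> real \<Rightarrow> real" where
  "Lq_spectrum \<nu> q = Lim (at_right 0) (Lq_quotient \<nu> q)"


section \<open>The pressure function\<close>

definition word_prob :: "('e \<Rightarrow> real) \<Rightarrow> 'e list \<Rightarrow> real" where
  "word_prob p w = prod_list (map p w)"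

definition word_mat :: "('e \<Rightarrow> real^2^2) \<Rightarrow> 'e list \<Rightarrow> real^2^2" where
  "word_mat T w = foldr (\<lambda>e M. T e ** M) w (mat 1)"

definition word_map :: "('e \<Rightarrow> real^2^2) \<Rightarrow> ('e \<Rightarrow> real^2) \<Rightarrow> 'e list \<Rightarrow> real^2 \<Rightarrow> real^2" where
  "word_map T t w = foldr (\<lambda>e f. edge_map T t e \<circ> f) w id"

definition rect_width :: "('e \<Rightarrow> real^2^2) \<Rightarrow> ('e \<Rightarrow> real^2) \<Rightarrow> 'e list \<Rightarrow> real" where
  "rect_width T t w = diameter ((\<lambda>\<xi>. \<xi> $ 1) ` word_map T t w ` cbox 0 1)"

definition rect_height :: "('e \<Rightarrow> real^2^2) \<Rightarrow> ('e \<Rightarrow> real^2) \<Rightarrow> 'e list \<Rightarrow> real" where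
  "rect_height T t w = diameter ((\<lambda>\<xi>. \<xi> $ 2) ` word_map T t w ` cbox 0 1)"

text \<open>The singular values of \<open>M\<close> are the non-negative square roots of the eigenvalues of
  \<open>transpose M ** M\<close>; as a set they are one or two numbers for a \<open>2 \<times> 2\<close> matrix.\<close>

definition singular_values :: "real^2^2 \<Rightarrow> real set" where
  "singular_values M =
     {\<sigma>. \<sigma> \<ge> 0 \<and> (\<exists>x. x \<noteq> 0 \<and> (transpose M ** M) *v x = \<sigma>\<^sup>2 *\<^sub>R x)}"

definition alpha1 :: "('e \<Rightarrow> real^2^2) \<Rightarrow> 'e list \<Rightarrow> real" where
  "alpha1 T w = Max (singular_values (word_mat T w))"

definition alpha2 :: "('e \<Rightarrow> real^2^2) \<Rightarrow> 'e list \<Rightarrow> real" where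
  "alpha2 T w = Min (singular_values (word_mat T w))"

definition word_proj ::
  "('e \<Rightarrow> real^2^2) \<Rightarrow> ('e \<Rightarrow> real^2) \<Rightarrow> 'e list \<Rightarrow> (real^2) measure \<Rightarrow> real measure" where
  "word_proj T t w =
     (if (rect_width T t w \<ge> rect_height T t w \<and> is_diagonal (word_mat T w)) \<or>
         (rect_width T t w < rect_height T t w \<and> is_antidiagonal (word_mat T w))
      then proj_x else proj_y)"

definition word_tau ::
  "('v, 'e) pre_digraph \<Rightarrow> ('e \<Rightarrow> real^2^2) \<Rightarrow> ('e \<Rightarrow> real^2) \<Rightarrow> ('v \<Rightarrow> (real^2) measure)
   \<Rightarrow> real \<Rightarrow> 'e list \<Rightarrow> real" where
  "word_tau G T t \<mu> q w = Lq_spectrum (word_proj T t w (\<mu> (head G (last w)))) q"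

definition phi ::
  "('v, 'e) pre_digraph \<Rightarrow> ('e \<Rightarrow> real^2^2) \<Rightarrow> ('e \<Rightarrow> real^2) \<Rightarrow> ('e \<Rightarrow> real)
   \<Rightarrow> ('v \<Rightarrow> (real^2) measure) \<Rightarrow> real \<Rightarrow> real \<Rightarrow> 'e list \<Rightarrow> real" where
  "phi G T t p \<mu> s q w =
     word_prob p w powr q * alpha1 T w powr word_tau G T t \<mu> q w
       * alpha2 T w powr (s - word_tau G T t \<mu> q w)"

definition pressure_matrix ::
  "('v, 'e) pre_digraph \<Rightarrow> ('e \<Rightarrow> real^2^2) \<Rightarrow> ('e \<Rightarrow> real^2) \<Rightarrow> ('e \<Rightarrow> real)
   \<Rightarrow> ('v \<Rightarrow> (real^2) measure) \<Rightarrow> real \<Rightarrow> real \<Rightarrow> nat \<Rightarrow> 'v \<Rightarrow> 'v \<Rightarrow> real" where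
  "pressure_matrix G T t p \<mu> s q k v v' = (\<Sum>w\<in>words G k v v'. phi G T t p \<mu> s q w)"

definition matrix_norm :: "'v set \<Rightarrow> ('v \<Rightarrow> 'v \<Rightarrow> real) \<Rightarrow> real" where
  "matrix_norm V A = (\<Sum>v\<in>V. \<Sum>v'\<in>V. \<bar>A v v'\<bar>)"

definition pressure ::
  "('v, 'e) pre_digraph \<Rightarrow> ('e \<Rightarrow> real^2^2) \<Rightarrow> ('e \<Rightarrow> real^2) \<Rightarrow> ('e \<Rightarrow> real)
   \<Rightarrow> ('v \<Rightarrow> (real^2) measure) \<Rightarrow> real \<Rightarrow> real \<Rightarrow> real" where
  "pressure G T t p \<mu> s q =
     lim (\<lambda>k. root k (matrix_norm (verts G) (pressure_matrix G T t p \<mu> s q k)))"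

definition gamma ::
  "('v, 'e) pre_digraph \<Rightarrow> ('e \<Rightarrow> real^2^2) \<Rightarrow> ('e \<Rightarrow> real^2) \<Rightarrow> ('e \<Rightarrow> real)
   \<Rightarrow> ('v \<Rightarrow> (real^2) measure) \<Rightarrow> real \<Rightarrow> real" where
  "gamma G T t p \<mu> q = (THE s. pressure G T t p \<mu> s q = 1)"

end

theory Submission
  imports Defs
begin

text \<open>
  The \<open>L\<^sup>q\<close>-spectrum of \<open>\<mu> v\<close> is computed by cutting the measure into pieces
  \<open>p\<^sub>w \<mu> \<circ> \<psi>\<^sub>w\<close> carried by rectangles whose shorter side is about the mesh size \<open>\<delta>\<close>. Seen at this scale
  such a rectangle is a segment, so its contribution to the moment sum is that of a projected
  measure at the scale \<open>\<delta> / \<alpha>\<^sub>1\<close>; summing up gives \<open>\<delta> powr (- s)\<close> times the sum of \<open>\<Phi> s\<close> over the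
  words of the cut, and the pressure decides for which \<open>s\<close> this last sum stays away from \<open>0\<close> and
  from infinity.

  \<^item> All moment sums are sums \<open>\<Sum>z. \<nu> (f = z) powr q\<close> over the values of a labelling \<open>f\<close> of the
  unit square (\<open>moment\<close>). If every class of one labelling meets a bounded number of classes of
  another and conversely, the two moments are comparable. This counting argument
  (\<open>sum_powr_le_by_relation\<close>) replaces closed cubes by half-open ones, changes scales, transports
  labellings through word maps and splits a moment along a cut (\<open>moment_parts\<close>).

  \<^item> In the projections of \<open>\<mu> v\<close> to the axes the pieces overlap. Cut at words whose
  ratio in the projected direction is about \<open>\<delta>\<close> and group the words by their position at scale
  \<open>\<delta>\<close>. Jensen's inequality within each group shows that the moment is submultiplicative
  in the scale for \<open>q \<ge> 1\<close> and supermultiplicative for \<open>q \<le> 1\<close>, up to constants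
  (\<open>proj_moment_quasi_multiplicative\<close>), so that Fekete's lemma provides the exponent \<open>\<tau> v b\<close>.
  A word moves a pair of vertex and axis to another one; in a strongly connected graph every such
  move can be undone (\<open>return_walk\<close>), so \<open>\<tau>\<close> is constant along walks and the sum \<open>\<theta>\<close> of the two
  exponents at a vertex does not depend on the vertex.

  \<^item> Following one axis along a word gives a weight that is multiplicative (\<open>axis_weight_append\<close>). The
  weight \<open>\<Phi> s\<close> is the larger of the weights of the two axes if \<open>s \<le> \<theta>\<close> and the smaller one if
  \<open>s \<ge> \<theta>\<close>. Hence it is submultiplicative in the first case and supermultiplicative in the second,
  the pressure is a limit, and it is strictly decreasing and continuous in \<open>s\<close> with a unique
  solution \<open>\<gamma>\<close> of \<open>P = 1\<close>.

  \<^item> By the rectangular open set condition a \<open>\<delta>\<close>-square meets a bounded number of the rectangles of the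
  cut (\<open>bounded_overlap\<close>). Above \<open>\<gamma>\<close> the sum of \<open>\<Phi> s\<close> over any cut is bounded by a convergent series
  (\<open>cut_sum_bounded\<close>); below \<open>\<gamma>\<close> each scale has a cut at some vertex over which the sum is
  at least \<open>1\<close> (\<open>cut_sum_large\<close>), and moments at different vertices are comparable
  (\<open>planar_moment_ge_other\<close>).
\<close>

section \<open>Power sums, subadditive sequences and exponents\<close>

text \<open>
  If \<open>A x\<close> is at most a sum of at most \<open>M\<close> terms \<open>B y\<close>, it is at most \<open>M\<close> times the largest of
  them, and this survives taking \<open>q\<close>-th powers for every \<open>q \<ge> 0\<close>. For \<open>q = 0\<close> the powers are
  indicators, since \<open>0 powr 0 = 0\<close>.
\<close>

lemma sum_powr_le_by_relation:
  fixes A :: "'a \<Rightarrow> real" and B :: "'b \<Rightarrow> real" and M N :: nat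
  assumes fin: "finite S" "finite R" and q: "q \<ge> 0"
    and B0: "\<And>y. y \<in> R \<Longrightarrow> B y \<ge> 0"
    and A0: "\<And>x. x \<in> S \<Longrightarrow> A x \<ge> 0"
    and sub: "\<And>x. x \<in> S \<Longrightarrow> Rel x \<subseteq> R"
    and M: "\<And>x. x \<in> S \<Longrightarrow> card (Rel x) \<le> M"
    and N: "\<And>y. y \<in> R \<Longrightarrow> card {x \<in> S. y \<in> Rel x} \<le> N"
    and le: "\<And>x. x \<in> S \<Longrightarrow> A x \<le> (\<Sum>y\<in>Rel x. B y)"
  shows "(\<Sum>x\<in>S. A x powr q) \<le> real M powr q * real N * (\<Sum>y\<in>R. B y powr q)"
proof -
  have one: "A x powr q \<le> real M powr q * (\<Sum>y\<in>Rel x. B y powr q)" if x: "x \<in> S" for x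
  proof (cases "Rel x = {}")
    case True
    then show ?thesis using le[OF x] A0[OF x] by simp
  next
    case False
    have finr: "finite (Rel x)" using sub[OF x] fin(2) finite_subset by blast
    define m where "m = Max (B ` Rel x)"
    have "m \<in> B ` Rel x" unfolding m_def using finr False by simp
    then obtain y where y: "y \<in> Rel x" "m = B y" by auto
    have m0: "m \<ge> 0" using y sub[OF x] B0 by auto
    have "A x \<le> (\<Sum>y\<in>Rel x. m)"
      using le[OF x] sum_mono[of "Rel x" B "\<lambda>_. m"] finr unfolding m_def by (smt (verit) Max_ge finite_imageI imageI)
    also have "\<dots> \<le> real M * m" using M[OF x] m0 by (simp add: mult_right_mono)
    finally have "A x powr q \<le> (real M * m) powr q" using q A0[OF x] by (intro powr_mono2) auto
    also have "\<dots> = real M powr q * B y powr q" by (simp add: powr_mult y)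
    also have "\<dots> \<le> real M powr q * (\<Sum>y\<in>Rel x. B y powr q)"
      using y finr by (intro mult_left_mono member_le_sum) auto
    finally show ?thesis .
  qed
  have "(\<Sum>x\<in>S. A x powr q) \<le> (\<Sum>x\<in>S. real M powr q * (\<Sum>y\<in>Rel x. B y powr q))"
    by (intro sum_mono one)
  also have "\<dots> = real M powr q * (\<Sum>x\<in>S. \<Sum>y | y \<in> R \<and> y \<in> Rel x. B y powr q)"
  proof -
    have "{y. y \<in> R \<and> y \<in> Rel x} = Rel x" if "x \<in> S" for x using sub[OF that] by auto
    then show ?thesis by (simp add: sum_distrib_left)
  qed
  also have "(\<Sum>x\<in>S. \<Sum>y | y \<in> R \<and> y \<in> Rel x. B y powr q) = (\<Sum>y\<in>R. \<Sum>x | x \<in> S \<and> y \<in> Rel x. B y powr q)"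
    by (rule sum.swap_restrict[OF fin])
  also have "\<dots> \<le> (\<Sum>y\<in>R. real N * B y powr q)"
    using N by (intro sum_mono) (auto intro!: mult_right_mono)
  finally show ?thesis by (simp add: mult.assoc mult_left_mono flip: sum_distrib_left)
qed

text \<open>
  For \<open>q \<le> 1\<close> the power function lies below its tangent at \<open>1\<close>; this is the weighted
  arithmetic-geometric mean inequality. It includes \<open>q = 0\<close>, where Jensen's inequality is
  needed for the indicator of the positive numbers.
\<close>

lemma powr_le_tangent:
  fixes x q :: real
  assumes "0 \<le> q" "q \<le> 1" "x \<ge> 0"
  shows "x powr q \<le> 1 + q * (x - 1)"
proof (cases "x = 0")
  case False
  then show ?thesis using Youngs_inequality_0[of q "1 - q" x 1] assms by (simp add: algebra_simps)
qed (use assms in auto)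

lemma powr_ge_tangent:
  fixes x q :: real
  assumes "q \<ge> 1" "x \<ge> 0"
  shows "x powr q \<ge> 1 + q * (x - 1)"
proof (cases "x = 0")
  case False
  have "(x powr q) powr (1/q) \<le> 1 + 1/q * (x powr q - 1)"
    using assms by (intro powr_le_tangent) auto
  then show ?thesis using assms by (simp add: powr_powr field_simps)
qed (use assms in auto)

text \<open>
  Jensen's inequality in homogeneous form: apply the tangent bound to \<open>x w\<close> divided by the weighted
  mean. Weights with arbitrary total are allowed because it is used for groups of words.
\<close>

lemma weighted_powr_ge:
  fixes c x :: "'a \<Rightarrow> real"
  assumes fin: "finite C" and c: "\<And>w. w \<in> C \<Longrightarrow> c w \<ge> 0" and x: "\<And>w. w \<in> C \<Longrightarrow> x w \<ge> 0"
    and P: "(\<Sum>w\<in>C. c w) > 0" and q: "0 \<le> q" "q \<le> 1"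
  shows "(\<Sum>w\<in>C. c w) powr (q - 1) * (\<Sum>w\<in>C. c w * x w powr q) \<le> (\<Sum>w\<in>C. c w * x w) powr q"
proof -
  define P where "P = (\<Sum>w\<in>C. c w)"
  define m where "m = (\<Sum>w\<in>C. c w * x w) / P"
  have P0: "P > 0" using assms(4) P_def by simp
  have Pm: "(\<Sum>w\<in>C. c w * x w) = P * m" using P0 by (simp add: m_def)
  have m0: "m \<ge> 0" unfolding m_def using c x P0 by (intro divide_nonneg_pos sum_nonneg) auto
  show ?thesis
  proof (cases "m = 0")
    case True
    then have "\<forall>w\<in>C. c w * x w = 0" using Pm fin c x by (simp add: sum_nonneg_eq_0_iff)
    then have "(\<Sum>w\<in>C. c w * x w powr q) = 0" by (intro sum.neutral) auto
    then show ?thesis by simp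
  next
    case False
    then have mp: "m > 0" using m0 by simp
    have "(\<Sum>w\<in>C. c w * x w powr q) = m powr q * (\<Sum>w\<in>C. c w * (x w / m) powr q)"
      using mp by (simp add: powr_divide sum_distrib_left)
    also have "(\<Sum>w\<in>C. c w * (x w / m) powr q) \<le> (\<Sum>w\<in>C. c w * (1 + q * (x w / m - 1)))"
      using c x q mp by (intro sum_mono mult_left_mono powr_le_tangent) auto
    also have "\<dots> = P + q * ((\<Sum>w\<in>C. c w * x w) / m - P)"
      by (simp add: P_def algebra_simps sum.distrib sum_subtractf sum_distrib_left sum_divide_distrib)
    also have "\<dots> = P" using mp Pm by simp
    finally have "(\<Sum>w\<in>C. c w * x w powr q) \<le> m powr q * P" using m0 by (simp add: mult_left_mono)
    then have "P powr (q - 1) * (\<Sum>w\<in>C. c w * x w powr q) \<le> P powr (q - 1) * (m powr q * P)"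
      by (intro mult_left_mono) auto
    also have "\<dots> = (P * m) powr q" using P0 by (simp add: powr_mult powr_diff)
    finally show ?thesis by (simp add: Pm flip: P_def)
  qed
qed

lemma weighted_powr_le:
  fixes c x :: "'a \<Rightarrow> real"
  assumes fin: "finite C" and c: "\<And>w. w \<in> C \<Longrightarrow> c w \<ge> 0" and x: "\<And>w. w \<in> C \<Longrightarrow> x w \<ge> 0"
    and P: "(\<Sum>w\<in>C. c w) > 0" and q: "q \<ge> 1"
  shows "(\<Sum>w\<in>C. c w * x w) powr q \<le> (\<Sum>w\<in>C. c w) powr (q - 1) * (\<Sum>w\<in>C. c w * x w powr q)"
proof -
  define P where "P = (\<Sum>w\<in>C. c w)"
  define m where "m = (\<Sum>w\<in>C. c w * x w) / P"
  have P0: "P > 0" using assms(4) P_def by simp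
  have Pm: "(\<Sum>w\<in>C. c w * x w) = P * m" using P0 by (simp add: m_def)
  have m0: "m \<ge> 0" unfolding m_def using c x P0 by (intro divide_nonneg_pos sum_nonneg) auto
  show ?thesis
  proof (cases "m = 0")
    case True
    then show ?thesis using Pm c by (auto intro!: mult_nonneg_nonneg sum_nonneg)
  next
    case False
    then have mp: "m > 0" using m0 by simp
    have "P = P + q * ((\<Sum>w\<in>C. c w * x w) / m - P)" using mp Pm by simp
    also have "\<dots> = (\<Sum>w\<in>C. c w * (1 + q * (x w / m - 1)))"
      by (simp add: P_def algebra_simps sum.distrib sum_subtractf sum_distrib_left sum_divide_distrib)
    also have "\<dots> \<le> (\<Sum>w\<in>C. c w * (x w / m) powr q)"
      using c x q mp by (intro sum_mono mult_left_mono powr_ge_tangent) auto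
    finally have "m powr q * P \<le> m powr q * (\<Sum>w\<in>C. c w * (x w / m) powr q)"
      by (intro mult_left_mono) auto
    also have "\<dots> = (\<Sum>w\<in>C. c w * x w powr q)"
      using mp by (simp add: powr_divide sum_distrib_left)
    finally have "P powr (q - 1) * (m powr q * P) \<le> P powr (q - 1) * (\<Sum>w\<in>C. c w * x w powr q)"
      by (intro mult_left_mono) auto
    moreover have "P powr (q - 1) * (m powr q * P) = (P * m) powr q" using P0 by (simp add: powr_mult powr_diff)
    ultimately show ?thesis by (simp add: Pm flip: P_def)
  qed
qed

text \<open>
  Fekete's lemma. The limit \<open>l\<close> is the infimum of the quotients: for \<open>N\<close> with a nearly minimal
  quotient, \<open>a n\<close> is at most \<open>n div N\<close> times \<open>a N\<close> plus a bounded remainder.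
\<close>

lemma subadditive_limit:
  fixes a :: "nat \<Rightarrow> real"
  assumes sub: "\<And>m n. a (m + n) \<le> a m + a n" and lb: "\<And>n. - B * real n \<le> a n"
  shows "\<exists>l. (\<lambda>n. a n / real n) \<longlonglongrightarrow> l"
proof -
  define l where "l = (INF n\<in>{1..}. a n / real n)"
  have bdd: "bdd_below ((\<lambda>n. a n / real n) ` {1..})"
    using lb by (intro bdd_belowI2[of _ "-B"]) (auto simp: field_simps)
  have l_le: "l \<le> a n / real n" if "n \<ge> 1" for n
    unfolding l_def using that bdd by (intro cINF_lower) auto
  have mult: "a (k * n + j) \<le> real k * a n + a j" for k n j
  proof (induction k)
    case (Suc k)
    then show ?case using sub[of n "k * n + j"] by (simp add: algebra_simps)
  qed simp
  have "(\<lambda>n. a n / real n) \<longlonglongrightarrow> l"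
  proof (rule LIMSEQ_I)
    fix e :: real assume e: "e > 0"
    have "\<exists>x\<in>(\<lambda>n. a n / real n) ` {1..}. x < l + e/2"
      using e unfolding l_def by (intro cInf_lessD) auto
    then obtain N where N: "N \<ge> 1" "a N / real N < l + e/2" by auto
    \<comment> \<open>Write \<open>n = k * N + j\<close>; then \<open>K\<close> bounds the contribution of the remainder \<open>j < N\<close>.\<close>
    define K where "K = (\<Sum>j<N. \<bar>a j\<bar>) + N * \<bar>l + e/2\<bar>"
      obtain M :: nat where M: "real M > 2 * K / e" using reals_Archimedean2 by blast
    have "norm (a n / real n - l) < e" if n: "n \<ge> max M 1" for n
    proof -
      have j: "n mod N < N" using N by simp
      have split: "real n = real (n div N) * real N + real (n mod N)"
        by (metis div_mult_mod_eq of_nat_add of_nat_mult)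
      have "a n \<le> real (n div N) * a N + a (n mod N)" using mult[of "n div N" N "n mod N"] by simp
      also have "\<dots> \<le> real (n div N) * (real N * (l + e/2)) + (\<Sum>j<N. \<bar>a j\<bar>)"
      proof (intro add_mono mult_left_mono)
        show "a N \<le> real N * (l + e/2)" using N by (simp add: field_simps)
        show "a (n mod N) \<le> (\<Sum>j<N. \<bar>a j\<bar>)"
          using j member_le_sum[of "n mod N" "{..<N}" "\<lambda>j. \<bar>a j\<bar>"] by auto
      qed auto
      also have "\<dots> = real n * (l + e/2) - real (n mod N) * (l + e/2) + (\<Sum>j<N. \<bar>a j\<bar>)"
        using split by (simp add: algebra_simps)
      also have "\<dots> \<le> real n * (l + e/2) + K"
      proof -
        have "- (real (n mod N) * (l + e/2)) \<le> real (n mod N) * \<bar>l + e/2\<bar>"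
          by (metis abs_ge_minus_self abs_mult abs_of_nat)
        also have "\<dots> \<le> real N * \<bar>l + e/2\<bar>" using j by (intro mult_right_mono) auto
        finally show ?thesis by (simp add: K_def)
      qed
      finally have "a n / real n \<le> l + e/2 + K / real n" using n by (simp add: field_simps)
      moreover have "K / real n < e/2"
      proof -
        have "2 * K / e < real n" using M n by linarith
        then show ?thesis using e n by (simp add: field_simps)
      qed
      moreover have "l \<le> a n / real n" using l_le n by simp
      ultimately show ?thesis by (simp only: real_norm_def abs_less_iff) linarith
    qed
    then show "\<exists>no. \<forall>n\<ge>no. norm (a n / real n - l) < e" by blast
  qed
  then show ?thesis by blast
qed

lemma limit_of_quasi_subadditive:
  fixes u :: "nat \<Rightarrow> real"
  assumes sub: "\<And>m n. u (m + n) \<le> u m + u n + C" and lb: "\<And>n. - B * real n - D \<le> u n"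
  shows "\<exists>l. (\<lambda>n. u n / real n) \<longlonglongrightarrow> l"
proof -
  define C' where "C' = max C (max D 0)"
  have "\<exists>l. (\<lambda>n. (u n + C') / real n) \<longlonglongrightarrow> l"
  proof (rule subadditive_limit)
    show "u (m + n) + C' \<le> u m + C' + (u n + C')" for m n using sub[of m n] by (simp add: C'_def)
    show "- B * real n \<le> u n + C'" for n using lb[of n] by (simp add: C'_def)
  qed
  then obtain l where "(\<lambda>n. (u n + C') / real n) \<longlonglongrightarrow> l" by blast
  moreover have "(\<lambda>n. C' / real n) \<longlonglongrightarrow> 0" by (rule lim_const_over_n)
  ultimately have "(\<lambda>n. (u n + C') / real n - C' / real n) \<longlonglongrightarrow> l - 0" by (intro tendsto_diff)
  then show ?thesis by (auto simp: diff_divide_distrib[symmetric])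
qed

lemma limit_of_quasi_superadditive:
  fixes u :: "nat \<Rightarrow> real"
  assumes sub: "\<And>m n. u (m + n) \<ge> u m + u n - C" and ub: "\<And>n. u n \<le> B * real n + D"
  shows "\<exists>l. (\<lambda>n. u n / real n) \<longlonglongrightarrow> l"
proof -
  have "\<exists>l. (\<lambda>n. - u n / real n) \<longlonglongrightarrow> l"
    using sub ub by (intro limit_of_quasi_subadditive[where C=C and B=B and D=D]) (auto simp: algebra_simps)
  then obtain l where "(\<lambda>n. - u n / real n) \<longlonglongrightarrow> l" by blast
  then have "(\<lambda>n. - (- u n / real n)) \<longlonglongrightarrow> - l" by (rule tendsto_minus)
  then show ?thesis by auto
qed

text \<open>
  Turns the rate of growth of a logarithm into two-sided bounds valid for all \<open>n\<close>, with the
  finitely many small \<open>n\<close> absorbed in the additive constant.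
\<close>

lemma linear_bound_of_limit:
  fixes u :: "nat \<Rightarrow> real"
  assumes lim: "(\<lambda>n. u n / real n) \<longlonglongrightarrow> l" and e: "e > 0"
  shows "\<exists>K. \<forall>n. \<bar>u n - l * real n\<bar> \<le> e * real n + K"
proof -
  obtain N where N: "\<And>n. n \<ge> N \<Longrightarrow> \<bar>u n / real n - l\<bar> < e"
    using LIMSEQ_D[OF lim e] by auto
  define K where "K = (\<Sum>n\<le>N. \<bar>u n - l * real n\<bar>)"
  have K0: "K \<ge> 0" by (simp add: K_def sum_nonneg)
  have "\<bar>u n - l * real n\<bar> \<le> e * real n + K" for n
  proof (cases "n \<le> N")
    case True
    then have "\<bar>u n - l * real n\<bar> \<le> K" unfolding K_def
      using member_le_sum[of n "{..N}" "\<lambda>n. \<bar>u n - l * real n\<bar>"] by auto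
    then show ?thesis using e by (smt (verit) mult_nonneg_nonneg of_nat_0_le_iff)
  next
    case False
    then have n: "real n > 0" by simp
    have "\<bar>u n / real n - l\<bar> * real n \<le> e * real n" using N[of n] False by (intro mult_right_mono) auto
    moreover have "\<bar>u n / real n - l\<bar> * real n = \<bar>u n - l * real n\<bar>"
    proof -
      have "\<bar>u n / real n - l\<bar> * real n = \<bar>(u n / real n - l) * real n\<bar>" by (simp add: abs_mult)
      also have "(u n / real n - l) * real n = u n - l * real n" using n by (simp add: field_simps)
      finally show ?thesis .
    qed
    ultimately show ?thesis using K0 by linarith
  qed
  then show ?thesis by blast
qed

text \<open>
  Here \<open>l\<close> is the exponent with \<open>D d \<approx> d powr (- l)\<close>.
\<close>

lemma Lq_limit_of_power_bounds:
  fixes D :: "real \<Rightarrow> real"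
  assumes lo: "\<And>e. e > 0 \<Longrightarrow> \<exists>c>0. \<forall>d\<in>{0<..<1}. c * d powr (e - l) \<le> D d"
    and up: "\<And>e. e > 0 \<Longrightarrow> \<exists>c. \<forall>d\<in>{0<..<1}. D d \<le> c * d powr (- e - l)"
  shows "((\<lambda>d. ln (D d) / (- ln d)) \<longlongrightarrow> l) (at_right 0)"
proof (rule tendstoI)
  fix e :: real assume "e > 0"
  then have e: "e/2 > 0" by simp
  obtain c1 where c1: "c1 > 0" "\<And>d. 0 < d \<Longrightarrow> d < 1 \<Longrightarrow> c1 * d powr (e/2 - l) \<le> D d" using lo[OF e] by auto
  obtain c2' where c2': "\<And>d. 0 < d \<Longrightarrow> d < 1 \<Longrightarrow> D d \<le> c2' * d powr (- (e/2) - l)"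
  proof -
    from up[OF e] obtain c where "\<forall>d\<in>{0<..<1}. D d \<le> c * d powr (- (e/2) - l)" by blast
    then show ?thesis by (intro that[of c]) auto
  qed
  define c2 where "c2 = max c2' 1"
  have c2: "D d \<le> c2 * d powr (- (e/2) - l)" if "0 < d" "d < 1" for d
    using c2'[OF that] mult_right_mono[of c2' c2 "d powr (- (e/2) - l)"] by (auto simp: c2_def)
  have c2p: "c2 > 0" by (simp add: c2_def)
  define K where "K = max \<bar>ln c1\<bar> \<bar>ln c2\<bar>"
  define d0 where "d0 = min 1 (exp (- (2 * K / e) - 1))"
  have d0: "d0 > 0" by (simp add: d0_def)
  show "eventually (\<lambda>d. dist (ln (D d) / (- ln d)) l < e) (at_right 0)"
    unfolding eventually_at_right_field
  proof (intro exI[of _ d0] conjI allI impI d0)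
    fix d :: real assume d: "0 < d" "d < d0"
    then have d1: "d < 1" by (simp add: d0_def)
    have "ln d < - (2 * K / e) - 1"
    proof -
      have "d < exp (- (2 * K / e) - 1)" using d by (simp add: d0_def)
      then have "ln d < ln (exp (- (2 * K / e) - 1))" using d by (subst ln_less_cancel_iff) auto
      then show ?thesis by simp
    qed
    then have L: "2 * K / e < - ln d" by simp
    have Lp: "- ln d > 0" using d d1 by simp
    have Dp: "D d > 0" using c1(2)[OF d(1) d1] c1(1) d by (smt (verit) powr_gt_zero mult_pos_pos)
    have "ln (c1 * d powr (e/2 - l)) \<le> ln (D d)" using c1 d d1 Dp by (subst ln_le_cancel_iff) auto
    then have a: "ln c1 + (e/2 - l) * ln d \<le> ln (D d)" using c1 d by (simp add: ln_mult ln_powr)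
    have "ln (D d) \<le> ln (c2 * d powr (- (e/2) - l))" using c2 c2p d d1 Dp by (subst ln_le_cancel_iff) auto
    then have b: "ln (D d) \<le> ln c2 + (- (e/2) - l) * ln d" using c2p d by (simp add: ln_mult ln_powr)
    have k: "K < e/2 * (- ln d)" using L \<open>e > 0\<close> by (simp add: field_simps)
    have K: "- ln c1 \<le> K" "ln c2 \<le> K" unfolding K_def by linarith+
    define L where "L = - ln d"
    have a': "ln c1 - e/2 * L + l * L \<le> ln (D d)" using a unfolding L_def by (simp add: left_diff_distrib)
    have b': "ln (D d) \<le> ln c2 + e/2 * L + l * L" using b unfolding L_def by (simp add: left_diff_distrib)
    have "K < e/2 * L" using k by (simp add: L_def)
    moreover have "e * L = e/2 * L + e/2 * L" by simp
    ultimately have "ln (D d) - l * L < e * L" "- (ln (D d) - l * L) < e * L"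
      using a' b' K by linarith+
    then have "\<bar>ln (D d) - l * (- ln d)\<bar> < e * (- ln d)" unfolding L_def by linarith
    then have "\<bar>ln (D d) - l * (- ln d)\<bar> / (- ln d) < e" using Lp by (subst pos_divide_less_eq) auto
    moreover have "\<bar>ln (D d) - l * (- ln d)\<bar> / (- ln d) = \<bar>ln (D d) / (- ln d) - l\<bar>"
    proof -
      have "\<bar>ln (D d) - l * (- ln d)\<bar> / (- ln d) = \<bar>(ln (D d) - l * (- ln d)) / (- ln d)\<bar>"
        unfolding abs_divide using abs_of_pos[OF Lp] by (rule arg_cong[OF sym])
      also have "(ln (D d) - l * (- ln d)) / (- ln d) = ln (D d) / (- ln d) - l"
        using Lp by (simp add: field_simps)
      finally show ?thesis .
    qed
    ultimately show "dist (ln (D d) / (- ln d)) l < e" by (simp add: dist_real_def)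
  qed
qed

text \<open>
  If \<open>y\<close> and \<open>\<delta>\<close> differ by at most the factor \<open>a\<close>, so do their powers up to an exponent. The absolute
  value covers both signs of \<open>x\<close>.
\<close>

lemma powr_near:
  fixes a \<delta> y x :: real
  assumes a: "0 < a" "a \<le> 1" and d: "0 < \<delta>" and y: "a * \<delta> \<le> y" "y \<le> \<delta>"
  shows "\<delta> powr x \<le> a powr (- \<bar>x\<bar>) * y powr x" "a powr \<bar>x\<bar> * y powr x \<le> \<delta> powr x"
proof -
  have ad: "0 < a * \<delta>" using a d by simp
  then have y0: "0 < y" using y by linarith
  have ax: "a powr \<bar>x\<bar> \<le> 1" using a by (simp add: powr_le1)
  have ax': "a powr (- \<bar>x\<bar>) \<ge> 1" using a ax by (simp add: powr_minus one_le_inverse_iff)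
  show "\<delta> powr x \<le> a powr (- \<bar>x\<bar>) * y powr x"
  proof (cases "x \<ge> 0")
    case True
    then have "(a * \<delta>) powr x \<le> y powr x" using ad y by (intro powr_mono2) auto
    then have "a powr (- x) * (a powr x * \<delta> powr x) \<le> a powr (- x) * y powr x"
      by (intro mult_left_mono) (auto simp: powr_mult)
    then show ?thesis using True a by (simp add: mult.assoc[symmetric] powr_add[symmetric])
  next
    case False
    then have "\<delta> powr x \<le> y powr x" using y y0 by (intro powr_mono2') auto
    also have "1 * y powr x \<le> a powr (- \<bar>x\<bar>) * y powr x" using ax' by (intro mult_right_mono) auto
    finally show ?thesis by simp
  qed
  show "a powr \<bar>x\<bar> * y powr x \<le> \<delta> powr x"
  proof (cases "x \<ge> 0")
    case True
    have "a powr \<bar>x\<bar> * y powr x \<le> 1 * y powr x" using ax by (intro mult_right_mono) auto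
    also have "1 * y powr x \<le> \<delta> powr x" using True y y0 by (simp add: powr_mono2)
    finally show ?thesis .
  next
    case False
    then have "y powr x \<le> (a * \<delta>) powr x" using y ad by (intro powr_mono2') auto
    then have "a powr (- x) * y powr x \<le> a powr (- x) * (a powr x * \<delta> powr x)"
      by (intro mult_left_mono) (auto simp: powr_mult)
    then show ?thesis using False a by (simp add: mult.assoc[symmetric] powr_add[symmetric])
  qed
qed

text \<open>
  The algebra behind the weight \<open>\<Phi>\<close>: a rectangle with sides \<open>x \<ge> y\<close>, \<open>y\<close> about \<open>\<delta>\<close>, contributes
  \<open>(\<delta> / x) powr (- u)\<close> when the projected measure along the long side has exponent \<open>u\<close>, and
  \<open>(\<delta> / x) powr (- u) = \<delta> powr (- s) * x powr u * \<delta> powr (s - u)\<close>. The bound \<open>m\<close> on \<open>\<bar>u\<bar>\<close> makes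
  the constants independent of the word.
\<close>

lemma thin_weight_bounds:
  fixes a \<delta> x y e s u m :: real
  assumes a: "0 < a" "a \<le> 1" and d: "0 < \<delta>" and x: "0 < x" "x \<le> 1" and y: "a * \<delta> \<le> y" "y \<le> \<delta>"
    and u: "\<bar>u\<bar> \<le> m" and e: "e \<ge> 0"
  shows "(a * \<delta> / x) powr (- e - u) \<le> a powr (- (e + m) - (\<bar>s\<bar> + m)) * \<delta> powr (- e - s) * (x powr u * y powr (s - u))"
    and "a powr ((e + m) + (\<bar>s\<bar> + m)) * \<delta> powr (e - s) * (x powr u * y powr (s - u)) \<le> (a * \<delta> / x) powr (e - u)"
proof -
  note near = powr_near[OF a d y, of "s - u"]
  have su: "\<bar>s - u\<bar> \<le> \<bar>s\<bar> + m" using u by linarith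
  have "\<delta> powr (s - u) \<le> a powr (- (\<bar>s\<bar> + m)) * y powr (s - u)"
  proof -
    have "a powr (- \<bar>s - u\<bar>) \<le> a powr (- (\<bar>s\<bar> + m))" using a su by (intro powr_mono') auto
    then have "a powr (- \<bar>s - u\<bar>) * y powr (s - u) \<le> a powr (- (\<bar>s\<bar> + m)) * y powr (s - u)"
      by (intro mult_right_mono) auto
    then show ?thesis using near(1) by linarith
  qed
  moreover have "a powr (- e - u) \<le> a powr (- (e + m))" using a u by (intro powr_mono') auto
  moreover have "x powr (e + u) \<le> x powr u" using x e by (intro powr_mono') auto
  ultimately have "a powr (- e - u) * (\<delta> powr (- e - s) * \<delta> powr (s - u)) * x powr (e + u) \<le>
    a powr (- (e + m)) * (\<delta> powr (- e - s) * (a powr (- (\<bar>s\<bar> + m)) * y powr (s - u))) * x powr u"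
    by (intro mult_mono) auto
  moreover have "(a * \<delta> / x) powr (- e - u) = a powr (- e - u) * (\<delta> powr (- e - s) * \<delta> powr (s - u)) * x powr (e + u)"
  proof -
    have "x powr (e + u) = inverse (x powr (- e - u))"
      by (simp only: powr_minus[symmetric]) (simp add: add.commute)
    moreover have "\<delta> powr (- e - s) * \<delta> powr (s - u) = \<delta> powr (- e - u)" by (simp add: powr_add[symmetric])
    ultimately show ?thesis by (simp only: powr_divide powr_mult) (simp only: divide_inverse)
  qed
  moreover have "a powr (- (e + m) - (\<bar>s\<bar> + m)) = a powr (- (e + m)) * a powr (- (\<bar>s\<bar> + m))"
    by (simp only: powr_add[symmetric]) simp
  ultimately show "(a * \<delta> / x) powr (- e - u) \<le> a powr (- (e + m) - (\<bar>s\<bar> + m)) * \<delta> powr (- e - s) * (x powr u * y powr (s - u))"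
    by (simp only: mult_ac)
  have "a powr (\<bar>s\<bar> + m) * y powr (s - u) \<le> \<delta> powr (s - u)"
  proof -
    have "a powr (\<bar>s\<bar> + m) \<le> a powr \<bar>s - u\<bar>" using a su by (intro powr_mono') auto
    then have "a powr (\<bar>s\<bar> + m) * y powr (s - u) \<le> a powr \<bar>s - u\<bar> * y powr (s - u)"
      by (intro mult_right_mono) auto
    then show ?thesis using near(2) by linarith
  qed
  moreover have "a powr (e + m) \<le> a powr (e - u)" using a u by (intro powr_mono') auto
  moreover have "x powr u \<le> x powr (u - e)" using x e by (intro powr_mono') auto
  ultimately have "a powr (e + m) * (\<delta> powr (e - s) * (a powr (\<bar>s\<bar> + m) * y powr (s - u))) * x powr u \<le>
    a powr (e - u) * (\<delta> powr (e - s) * \<delta> powr (s - u)) * x powr (u - e)"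
    by (intro mult_mono) auto
  moreover have "(a * \<delta> / x) powr (e - u) = a powr (e - u) * (\<delta> powr (e - s) * \<delta> powr (s - u)) * x powr (u - e)"
  proof -
    have "- (e - u) = u - e" by simp
    then have "x powr (u - e) = inverse (x powr (e - u))" using powr_minus[of x "e - u"] by simp
    moreover have "\<delta> powr (e - s) * \<delta> powr (s - u) = \<delta> powr (e - u)" by (simp add: powr_add[symmetric])
    ultimately show ?thesis by (simp only: powr_divide powr_mult) (simp only: divide_inverse)
  qed
  moreover have "a powr ((e + m) + (\<bar>s\<bar> + m)) = a powr (e + m) * a powr (\<bar>s\<bar> + m)"
    by (rule powr_add)
  ultimately show "a powr ((e + m) + (\<bar>s\<bar> + m)) * \<delta> powr (e - s) * (x powr u * y powr (s - u)) \<le> (a * \<delta> / x) powr (e - u)"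
    by (simp only: mult_ac)
qed

section \<open>Matrices that permute the coordinate axes\<close>

text \<open>
  Axes are encoded by booleans, \<open>True\<close> for the first axis. Then a matrix that permutes the axes
  sends axis \<open>b\<close> to \<open>b = is_diagonal M\<close>, and composition of these permutations is equality of
  booleans.
\<close>

definition coord :: "bool \<Rightarrow> real^2 \<Rightarrow> real" where
  "coord b \<xi> = (if b then \<xi> $ 1 else \<xi> $ 2)"

text \<open>
  In each row of a diagonal or anti-diagonal matrix one entry vanishes, so the row sum is the signed
  scaling factor of that row in both cases.
\<close>

definition rowsum :: "real^2^2 \<Rightarrow> bool \<Rightarrow> real" where
  "rowsum M b = (if b then M $ 1 $ 1 + M $ 1 $ 2 else M $ 2 $ 1 + M $ 2 $ 2)"

definition axis_matrix :: "real^2^2 \<Rightarrow> bool" where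
  "axis_matrix M \<longleftrightarrow> (is_diagonal M \<and> M $ 1 $ 1 \<noteq> 0 \<and> M $ 2 $ 2 \<noteq> 0) \<or>
     (is_antidiagonal M \<and> M $ 1 $ 2 \<noteq> 0 \<and> M $ 2 $ 1 \<noteq> 0)"

lemma coord_add: "coord b (x + y) = coord b x + coord b y"
  by (simp add: coord_def)

lemma coord_zero [simp]: "coord b 0 = 0"
  by (simp add: coord_def)

lemma coord_ext:
  assumes "\<And>b. coord b x = coord b y"
  shows "x = y"
  using assms[of True] assms[of False] by (simp add: vec_eq_iff forall_2 coord_def)

lemma coord_True: "coord True = (\<lambda>\<xi>. \<xi> $ 1)" and coord_False: "coord False = (\<lambda>\<xi>. \<xi> $ 2)"
  by (simp_all add: fun_eq_iff coord_def)

lemma mem_cbox_coord: "x \<in> cbox 0 1 \<longleftrightarrow> (\<forall>b. 0 \<le> coord b x \<and> coord b x \<le> 1)"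
  by (simp add: mem_box_cart forall_2 coord_def all_bool_eq)

lemma mem_box_coord: "x \<in> box 0 1 \<longleftrightarrow> (\<forall>b. 0 < coord b x \<and> coord b x < 1)"
  by (simp add: mem_box_cart forall_2 coord_def all_bool_eq)

lemma borel_measurable_coord [measurable]: "coord b \<in> borel_measurable borel"
  unfolding coord_def by measurable

lemma axis_matrix_antidiagonal: "axis_matrix M \<Longrightarrow> is_antidiagonal M \<longleftrightarrow> \<not> is_diagonal M"
  by (auto simp: axis_matrix_def is_diagonal_def is_antidiagonal_def)

lemma rowsum_nonzero: "axis_matrix M \<Longrightarrow> rowsum M b \<noteq> 0"
  by (auto simp: axis_matrix_def is_diagonal_def is_antidiagonal_def rowsum_def)

text \<open>
  The cocycle identity: the scaling factors of a product multiply, but the second factor is taken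
  at the axis to which the first matrix sends \<open>b\<close>.
\<close>

lemma axis_matrix_mult:
  assumes "axis_matrix A" "axis_matrix B"
  shows "axis_matrix (A ** B)"
    and "is_diagonal (A ** B) \<longleftrightarrow> (is_diagonal A = is_diagonal B)"
    and "rowsum (A ** B) b = rowsum A b * rowsum B (b = is_diagonal A)"
  using assms
  by (auto simp: axis_matrix_def is_diagonal_def is_antidiagonal_def rowsum_def
        matrix_matrix_mult_def sum_2 algebra_simps)

lemma axis_matrix_one: "axis_matrix (mat 1)" "is_diagonal (mat 1)" "rowsum (mat 1) b = 1"
  by (auto simp: axis_matrix_def is_diagonal_def rowsum_def mat_def)

lemma coord_axis_matrix:
  assumes "axis_matrix M"
  shows "coord b (M *v \<xi>) = rowsum M b * coord (b = is_diagonal M) \<xi>"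
  using assms
  by (auto simp: axis_matrix_def is_diagonal_def is_antidiagonal_def rowsum_def coord_def
        matrix_vector_mult_def sum_2 algebra_simps)

lemma box_like_axis: "box_like M \<Longrightarrow> axis_matrix M"
  and box_like_rowsum: "box_like M \<Longrightarrow> \<bar>rowsum M b\<bar> < 1"
  by (auto simp: box_like_def axis_matrix_def is_diagonal_def is_antidiagonal_def rowsum_def)

lemma singular_values_axis:
  assumes "axis_matrix M"
  shows "singular_values M = {\<bar>rowsum M True\<bar>, \<bar>rowsum M False\<bar>}"
proof -
  \<comment> \<open>The product \<open>transpose M ** M\<close> is diagonal with entries \<open>d1\<close> and \<open>d2\<close>.\<close>
  define d1 d2 where "d1 = (M$1$1)\<^sup>2 + (M$2$1)\<^sup>2" and "d2 = (M$1$2)\<^sup>2 + (M$2$2)\<^sup>2"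
  have act: "(transpose M ** M) *v x = vector [d1 * x$1, d2 * x$2]" for x
  proof -
    have "M$1$1 * M$1$2 = 0" "M$2$1 * M$2$2 = 0"
      using assms by (auto simp: axis_matrix_def is_diagonal_def is_antidiagonal_def)
    then have "transpose M ** M = (\<chi> i j. if i = j then (if i = 1 then d1 else d2) else 0)"
      unfolding d1_def d2_def
      by (auto simp: vec_eq_iff forall_2 matrix_matrix_mult_def transpose_def sum_2 power2_eq_square mult.commute)
    then show ?thesis by (simp add: vec_eq_iff forall_2 matrix_vector_mult_def sum_2 vector_2)
  qed
  have sq: "{d1, d2} = {(rowsum M True)\<^sup>2, (rowsum M False)\<^sup>2}"
  proof (cases "is_diagonal M")
    case True
    then show ?thesis unfolding d1_def d2_def by (simp add: is_diagonal_def rowsum_def)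
  next
    case False
    then have "is_antidiagonal M" using assms axis_matrix_antidiagonal by blast
    then show ?thesis unfolding d1_def d2_def
      by (simp add: is_antidiagonal_def rowsum_def insert_commute)
  qed
  have "\<sigma> \<in> singular_values M \<longleftrightarrow> \<sigma> \<ge> 0 \<and> \<sigma>\<^sup>2 \<in> {d1, d2}" for \<sigma>
  proof
    assume "\<sigma> \<in> singular_values M"
    then obtain x :: "real^2" where x: "\<sigma> \<ge> 0" "x \<noteq> 0" "vector [d1 * x$1, d2 * x$2] = \<sigma>\<^sup>2 *\<^sub>R x"
      unfolding singular_values_def act by blast
    have "d1 * x$1 = \<sigma>\<^sup>2 * x$1" "d2 * x$2 = \<sigma>\<^sup>2 * x$2"
      using arg_cong[OF x(3), of "\<lambda>y. y$1"] arg_cong[OF x(3), of "\<lambda>y. y$2"] by (simp_all add: vector_2)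
    moreover have "x$1 \<noteq> 0 \<or> x$2 \<noteq> 0" using x(2) by (auto simp: vec_eq_iff forall_2)
    ultimately show "\<sigma> \<ge> 0 \<and> \<sigma>\<^sup>2 \<in> {d1, d2}" using x(1) by auto
  next
    assume a: "\<sigma> \<ge> 0 \<and> \<sigma>\<^sup>2 \<in> {d1, d2}"
    define x :: "real^2" where "x = (if \<sigma>\<^sup>2 = d1 then vector [1, 0] else vector [0, 1])"
    have "x \<noteq> 0" by (auto simp: x_def vec_eq_iff forall_2 vector_2)
    moreover have "vector [d1 * x$1, d2 * x$2] = \<sigma>\<^sup>2 *\<^sub>R x"
      using a by (auto simp: x_def vec_eq_iff forall_2 vector_2)
    ultimately show "\<sigma> \<in> singular_values M"
      unfolding singular_values_def act using a by blast
  qed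
  then have "\<sigma> \<in> singular_values M \<longleftrightarrow> \<sigma> \<ge> 0 \<and> (\<sigma>\<^sup>2 = (rowsum M True)\<^sup>2 \<or> \<sigma>\<^sup>2 = (rowsum M False)\<^sup>2)" for \<sigma>
    unfolding sq by auto
  moreover have "\<sigma> \<ge> 0 \<and> \<sigma>\<^sup>2 = y\<^sup>2 \<longleftrightarrow> \<sigma> = \<bar>y\<bar>" for \<sigma> y :: real
    by (auto simp: power2_eq_iff)
  ultimately show ?thesis by blast
qed

text \<open>
  Used backwards, to find points of a grid in the image of the open square; the order of the
  inequalities is independent of the signs of the row sums.
\<close>

lemma mem_affine_box:
  assumes "axis_matrix M"
  shows "x \<in> (\<lambda>\<xi>. M *v \<xi> + c) ` box 0 1 \<longleftrightarrow>
    (\<forall>b. 0 < (coord b x - coord b c) / rowsum M b \<and> (coord b x - coord b c) / rowsum M b < 1)" (is "?L \<longleftrightarrow> ?R")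
proof
  assume ?L
  then obtain \<xi> where x: "x = M *v \<xi> + c" "\<xi> \<in> box 0 1" by auto
  then show ?R using rowsum_nonzero[OF assms] by (simp add: coord_add coord_axis_matrix[OF assms] mem_box_coord)
next
  assume R: ?R
  define h where "h b = (coord b x - coord b c) / rowsum M b" for b
  define \<xi> :: "real^2" where "\<xi> = vector [h (True = is_diagonal M), h (False = is_diagonal M)]"
  have coord: "coord b \<xi> = h (b = is_diagonal M)" for b
    by (cases b) (simp_all add: \<xi>_def coord_def vector_2)
  have "x = M *v \<xi> + c"
  proof (rule coord_ext)
    fix b
    show "coord b x = coord b (M *v \<xi> + c)"
      using rowsum_nonzero[OF assms, of b]
      by (cases b; cases "is_diagonal M") (simp_all add: coord_add coord_axis_matrix[OF assms] coord h_def)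
  qed
  moreover have "\<xi> \<in> box 0 1" unfolding mem_box_coord coord using R by (auto simp: h_def)
  ultimately show ?L by blast
qed

lemma inj_affine_axis:
  assumes "axis_matrix M"
  shows "inj (\<lambda>\<xi>. M *v \<xi> + c)"
proof (rule injI)
  fix x y assume "M *v x + c = M *v y + c"
  then have "coord b (M *v x) = coord b (M *v y)" for b by simp
  then have e: "coord (b = is_diagonal M) x = coord (b = is_diagonal M) y" for b
    using rowsum_nonzero[OF assms] by (simp add: coord_axis_matrix[OF assms])
  show "x = y"
  proof (rule coord_ext)
    fix b show "coord b x = coord b y" using e[of "b = is_diagonal M"] by (cases b; cases "is_diagonal M") auto
  qed
qed

lemma norm_coord: "(norm x)\<^sup>2 = (coord True x)\<^sup>2 + (coord False x)\<^sup>2"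
  by (simp add: norm_vec_def L2_set_def sum_2 coord_def)

lemma norm_axis_matrix_le:
  assumes "axis_matrix M" "\<And>b. \<bar>rowsum M b\<bar> \<le> c" 
  shows "norm (M *v x) \<le> c * norm x"
proof (rule power2_le_imp_le)
  have c: "c \<ge> 0" using assms(2)[of True] by linarith
  have "(rowsum M b * y)\<^sup>2 \<le> c\<^sup>2 * y\<^sup>2" for b y
  proof -
    have "\<bar>rowsum M b\<bar>\<^sup>2 \<le> c\<^sup>2" using assms(2)[of b] by (intro power_mono) auto
    then show ?thesis unfolding power_mult_distrib by (intro mult_right_mono) auto
  qed
  then have "(norm (M *v x))\<^sup>2 \<le> c\<^sup>2 * (coord (True = is_diagonal M) x)\<^sup>2 + c\<^sup>2 * (coord (False = is_diagonal M) x)\<^sup>2"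
    unfolding norm_coord coord_axis_matrix[OF assms(1)] by (intro add_mono)
  also have "\<dots> = (c * norm x)\<^sup>2"
    by (cases "is_diagonal M") (simp_all add: power_mult_distrib norm_coord algebra_simps)
  finally show "(norm (M *v x))\<^sup>2 \<le> (c * norm x)\<^sup>2" .
  show "0 \<le> c * norm x" using c by simp
qed

lemma word_mat_simps [simp]:
  "word_mat T [] = mat 1" "word_mat T (e # w) = T e ** word_mat T w"
  by (simp_all add: word_mat_def)

lemma word_map_simps [simp]:
  "word_map T t [] = id" "word_map T t (e # w) = edge_map T t e \<circ> word_map T t w"
  by (simp_all add: word_map_def)

lemma word_prob_simps [simp]:
  "word_prob p [] = 1" "word_prob p (e # w) = p e * word_prob p w"
  "word_prob p (u @ w) = word_prob p u * word_prob p w"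
  by (simp_all add: word_prob_def)

lemma word_mat_append: "word_mat T (u @ w) = word_mat T u ** word_mat T w"
  by (induction u) (auto simp: matrix_mul_assoc)

lemma word_map_affine: "word_map T t w \<xi> = word_mat T w *v \<xi> + word_map T t w 0"
proof (induction w)
  case (Cons e w)
  have "word_map T t (e # w) \<xi> = T e *v (word_mat T w *v \<xi> + word_map T t w 0) + t e"
    by (simp add: edge_map_def Cons[symmetric])
  also have "\<dots> = word_mat T (e # w) *v \<xi> + word_map T t (e # w) 0"
    by (simp add: edge_map_def matrix_vector_right_distrib matrix_vector_mul_assoc)
  finally show ?case .
qed (auto simp: matrix_vector_mul_lid)

lemma coord_word_map:
  assumes "axis_matrix (word_mat T w)"
  shows "coord b (word_map T t w \<xi>) =
    rowsum (word_mat T w) b * coord (b = is_diagonal (word_mat T w)) \<xi> + coord b (word_map T t w 0)"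
  by (subst word_map_affine) (simp add: coord_add coord_axis_matrix[OF assms])

lemma diameter_affine_unit_interval:
  fixes r c :: real
  assumes "r \<noteq> 0"
  shows "diameter ((\<lambda>y. r * y + c) ` {0..1}) = \<bar>r\<bar>"
proof (cases "r > 0")
  case True
  then have "(\<lambda>y. r * y + c) ` {0..1} = {c..r + c}" by (simp add: image_affinity_atLeastAtMost)
  then show ?thesis using True by (simp add: diameter_closed_interval)
next
  case False
  then have "(\<lambda>y. r * y + c) ` {0..1} = {r + c..c}" using assms by (simp add: image_affinity_atLeastAtMost)
  then show ?thesis using False by (simp add: diameter_closed_interval)
qed

lemma coord_image_cbox: "coord b ` cbox 0 1 = {0..1}"
proof
  show "coord b ` cbox 0 1 \<subseteq> {0..1}" by (auto simp: mem_cbox_coord)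
  show "{0..1} \<subseteq> coord b ` cbox 0 1"
  proof
    fix y :: real assume y: "y \<in> {0..1}"
    have "coord b (vector [y, y]) = y" "vector [y,y] \<in> cbox (0::real^2) 1"
      using y unfolding mem_cbox_coord by (auto simp: coord_def vector_2)
    then show "y \<in> coord b ` cbox 0 1" by (metis imageI)
  qed
qed

lemma diameter_coord_rect:
  assumes "axis_matrix (word_mat T w)"
  shows "diameter (coord b ` word_map T t w ` cbox 0 1) = \<bar>rowsum (word_mat T w) b\<bar>"
proof -
  have "coord b ` word_map T t w ` cbox 0 1 =
    (\<lambda>y. rowsum (word_mat T w) b * y + coord b (word_map T t w 0)) ` {0..1}"
    unfolding coord_image_cbox[of "b = is_diagonal (word_mat T w)", symmetric] image_image
    by (rule image_cong[OF refl coord_word_map[OF assms]])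
  then show ?thesis by (simp add: diameter_affine_unit_interval rowsum_nonzero assms)
qed

lemma rect_width_eq: "axis_matrix (word_mat T w) \<Longrightarrow> rect_width T t w = \<bar>rowsum (word_mat T w) True\<bar>"
  and rect_height_eq: "axis_matrix (word_mat T w) \<Longrightarrow> rect_height T t w = \<bar>rowsum (word_mat T w) False\<bar>"
  using diameter_coord_rect[of T w True t] diameter_coord_rect[of T w False t]
  unfolding rect_width_def rect_height_def coord_True coord_False by simp_all

section \<open>Labels, moments and mesh cubes\<close>

lemma card_floor_image:
  fixes F :: "'a \<Rightarrow> real"
  assumes "\<And>x y. x \<in> A \<Longrightarrow> y \<in> A \<Longrightarrow> \<bar>F x - F y\<bar> \<le> real L"
  shows "finite ((\<lambda>x. \<lfloor>F x\<rfloor>) ` A) \<and> card ((\<lambda>x. \<lfloor>F x\<rfloor>) ` A) \<le> 2 * L + 1"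
proof (cases "A = {}")
  case False
  then obtain x0 where x0: "x0 \<in> A" by blast
  have sub: "(\<lambda>x. \<lfloor>F x\<rfloor>) ` A \<subseteq> {\<lfloor>F x0\<rfloor> - int L..\<lfloor>F x0\<rfloor> + int L}"
  proof
    fix z assume "z \<in> (\<lambda>x. \<lfloor>F x\<rfloor>) ` A"
    then obtain x where x: "x \<in> A" "z = \<lfloor>F x\<rfloor>" by blast
    have "\<bar>F x - F x0\<bar> \<le> real L" using assms x x0 by blast
    then show "z \<in> {\<lfloor>F x0\<rfloor> - int L..\<lfloor>F x0\<rfloor> + int L}" unfolding x(2) atLeastAtMost_iff by linarith
  qed
  have "card ((\<lambda>x. \<lfloor>F x\<rfloor>) ` A) \<le> card {\<lfloor>F x0\<rfloor> - int L..\<lfloor>F x0\<rfloor> + int L}"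
    by (intro card_mono sub) simp
  then show ?thesis using finite_subset[OF sub] by simp
qed simp

lemma card_floor_image_pair:
  fixes F F' :: "'a \<Rightarrow> real"
  assumes "\<And>x y. x \<in> A \<Longrightarrow> y \<in> A \<Longrightarrow> \<bar>F x - F y\<bar> \<le> real L"
    and "\<And>x y. x \<in> A \<Longrightarrow> y \<in> A \<Longrightarrow> \<bar>F' x - F' y\<bar> \<le> real L'"
  shows "card ((\<lambda>x. (\<lfloor>F x\<rfloor>, \<lfloor>F' x\<rfloor>)) ` A) \<le> (2 * L + 1) * (2 * L' + 1)"
proof -
  note 1 = card_floor_image[of A F L, OF assms(1)] and 2 = card_floor_image[of A F' L', OF assms(2)]
  have "card ((\<lambda>x. (\<lfloor>F x\<rfloor>, \<lfloor>F' x\<rfloor>)) ` A) \<le> card (((\<lambda>x. \<lfloor>F x\<rfloor>) ` A) \<times> ((\<lambda>x. \<lfloor>F' x\<rfloor>) ` A))"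
    using 1 2 by (intro card_mono) auto
  also have "\<dots> \<le> (2 * L + 1) * (2 * L' + 1)"
    unfolding card_cartesian_product using 1 2 by (intro mult_le_mono) blast+
  finally show ?thesis .
qed

lemma abs_diff_le_one_of_floor_eq:
  fixes x y :: real
  shows "\<lfloor>x\<rfloor> = \<lfloor>y\<rfloor> \<Longrightarrow> \<bar>x - y\<bar> \<le> 1"
  by linarith

lemma scaled_diff_le:
  fixes x y :: real
  assumes "\<bar>x - y\<bar> \<le> c" "c \<le> L * d" "d > 0"
  shows "\<bar>x / d - y / d\<bar> \<le> L"
proof -
  have "\<bar>x / d - y / d\<bar> = \<bar>x - y\<bar> / d" using assms(3) by (simp add: diff_divide_distrib[symmetric])
  also have "\<dots> \<le> L" using assms by (simp add: divide_le_eq)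
  finally show ?thesis .
qed

lemma card_ints_near_le_3: "card {k \<in> K. \<bar>k - y\<bar> \<le> (1::int)} \<le> 3"
proof -
  have "card {k \<in> K. \<bar>k - y\<bar> \<le> (1::int)} \<le> card {y-1..y+1}" by (intro card_mono) auto
  then show ?thesis by simp
qed

lemma grid_point_in_interval:
  fixes lo hi \<epsilon> y :: real
  assumes "\<epsilon> > 0" "lo + 3 * \<epsilon> \<le> hi" "lo \<le> y" "y \<le> hi"
  obtains i :: int where "lo < i * \<epsilon>" "i * \<epsilon> < hi" "\<bar>i * \<epsilon> - y\<bar> \<le> \<epsilon>"
proof (cases "y + \<epsilon> < hi")
  case True
  define i where "i = \<lfloor>y / \<epsilon>\<rfloor> + 1"
  have "of_int i > y / \<epsilon>" "of_int i \<le> y / \<epsilon> + 1" unfolding i_def by linarith+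
  then have "i * \<epsilon> > y" "i * \<epsilon> \<le> y + \<epsilon>" using assms(1) by (simp_all add: field_simps)
  then show ?thesis using that[of i] True assms by auto
next
  case False
  define i where "i = \<lceil>y / \<epsilon>\<rceil> - 1"
  have "of_int i < y / \<epsilon>" "of_int i \<ge> y / \<epsilon> - 1" unfolding i_def by linarith+
  then have "i * \<epsilon> < y" "i * \<epsilon> \<ge> y - \<epsilon>" using assms(1) by (simp_all add: field_simps)
  then show ?thesis using that[of i] False assms by auto
qed

text \<open>
  A label partitions the square into finitely many Borel classes; mesh cubes are one example,
  preimages of mesh cubes under word maps another.
\<close>

definition label :: "(real^2 \<Rightarrow> 'l) \<Rightarrow> bool" where
  "label f \<longleftrightarrow> finite (f ` cbox 0 1) \<and> (\<forall>z. f -` {z} \<in> sets borel)"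

text \<open>
  Classes that do not meet the square carry no mass of the measures below, so that the finite sum
  is the full sum over all labels.
\<close>

definition moment :: "(real^2) measure \<Rightarrow> real \<Rightarrow> (real^2 \<Rightarrow> 'l) \<Rightarrow> real" where
  "moment \<nu> q f = (\<Sum>z\<in>f ` cbox 0 1. measure \<nu> (f -` {z}) powr q)"

lemma moment_nonneg: "moment \<nu> q f \<ge> 0"
  by (simp add: moment_def sum_nonneg)

definition grid :: "bool \<Rightarrow> real \<Rightarrow> real^2 \<Rightarrow> int" where
  "grid b \<delta> \<xi> = \<lfloor>coord b \<xi> / \<delta>\<rfloor>"

definition grid2 :: "real \<Rightarrow> real^2 \<Rightarrow> int \<times> int" where
  "grid2 \<delta> \<xi> = (\<lfloor>coord True \<xi> / \<delta>\<rfloor>, \<lfloor>coord False \<xi> / \<delta>\<rfloor>)"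

lemma measurable_grid [measurable]: "grid b \<delta> \<in> measurable borel (count_space UNIV)"
  unfolding grid_def by measurable

lemma grid_image: "\<delta> > 0 \<Longrightarrow> grid b \<delta> ` cbox 0 1 \<subseteq> {0..\<lfloor>1 / \<delta>\<rfloor>}"
  by (auto simp: grid_def mem_cbox_coord intro!: floor_mono divide_right_mono)

lemma label_grid:
  assumes "\<delta> > 0"
  shows "label (grid b \<delta>)"
  unfolding label_def
proof (intro conjI allI)
  show "finite (grid b \<delta> ` cbox 0 1)" using finite_subset[OF grid_image[OF assms]] by simp
  fix z
  have "grid b \<delta> -` {z} \<inter> space borel \<in> sets borel" by measurable
  then show "grid b \<delta> -` {z} \<in> sets borel" by simp
qed

lemma label_grid2:
  assumes "\<delta> > 0"
  shows "label (grid2 \<delta>)"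
  unfolding label_def
proof (intro conjI allI)
  have "grid2 \<delta> ` cbox 0 1 \<subseteq> (grid True \<delta> ` cbox 0 1) \<times> (grid False \<delta> ` cbox 0 1)"
    by (auto simp: grid2_def grid_def)
  then show "finite (grid2 \<delta> ` cbox 0 1)"
    by (rule finite_subset) (use label_grid[OF assms] in \<open>auto simp: label_def\<close>)
  fix z :: "int \<times> int"
  have "grid2 \<delta> -` {z} = grid True \<delta> -` {fst z} \<inter> grid False \<delta> -` {snd z}"
    by (auto simp: grid2_def grid_def)
  then show "grid2 \<delta> -` {z} \<in> sets borel" using label_grid[OF assms] by (auto simp: label_def)
qed

lemma grid_abs: "grid b \<delta> = (\<lambda>\<xi>. \<lfloor>coord b \<xi> / \<delta>\<rfloor>)"
  by (simp add: fun_eq_iff grid_def)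

lemma grid_diff:
  assumes "grid b \<delta> x = grid b \<delta> y" "\<delta> > 0"
  shows "\<bar>coord b x - coord b y\<bar> \<le> \<delta>"
proof -
  have "\<bar>coord b x / \<delta> - coord b y / \<delta>\<bar> \<le> 1"
    using assms(1) unfolding grid_def by (rule abs_diff_le_one_of_floor_eq)
  then have "\<bar>coord b x - coord b y\<bar> / \<delta> \<le> 1"
    using assms(2) by (simp add: diff_divide_distrib[symmetric])
  then show ?thesis using assms(2) by simp
qed

lemma grid2_eq_iff: "grid2 \<delta> x = grid2 \<delta> y \<longleftrightarrow> (\<forall>b. grid b \<delta> x = grid b \<delta> y)"
  by (auto simp: grid2_def grid_def all_bool_eq)

lemma label_comp:
  fixes f :: "real^2 \<Rightarrow> 'l::countable"
  assumes "label f"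
  shows "label (F \<circ> f)"
  unfolding label_def
proof (intro conjI allI)
  show "finite ((F \<circ> f) ` cbox 0 1)" unfolding image_comp[symmetric] using assms by (simp add: label_def)
  fix z
  have "(F \<circ> f) -` {z} = (\<Union>y\<in>F -` {z}. f -` {y})" by auto
  also have "\<dots> \<in> sets borel" using assms by (intro sets.countable_UN') (auto simp: label_def)
  finally show "(F \<circ> f) -` {z} \<in> sets borel" .
qed

lemma moment_inj:
  assumes "inj F"
  shows "moment \<nu> q (F \<circ> f) = moment \<nu> q f"
proof -
  have "(F \<circ> f) -` {F y} = f -` {y}" for y using assms by (auto simp: inj_def)
  then show ?thesis
    unfolding moment_def image_comp[symmetric]
    using assms by (subst sum.reindex) (auto simp: inj_on_def inj_def)
qed

text \<open>
  The corner of the half-open mesh cube containing \<open>x\<close>, as an integer point of the space itself,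
  so that it can index the closed cubes of \<open>moment_sum\<close>.
\<close>

definition cell :: "real \<Rightarrow> 'a::euclidean_space \<Rightarrow> 'a" where
  "cell \<delta> x = (\<Sum>b\<in>Basis. real_of_int \<lfloor>x \<bullet> b / \<delta>\<rfloor> *\<^sub>R b)"

lemma cell_inner: "b \<in> Basis \<Longrightarrow> cell \<delta> x \<bullet> b = real_of_int \<lfloor>x \<bullet> b / \<delta>\<rfloor>"
  by (simp add: cell_def)

lemma cell_integer: "cell \<delta> x \<in> integer_points"
  by (simp add: integer_points_def cell_inner)

lemma mem_mesh_cube:
  fixes x :: "'a::euclidean_space"
  assumes "\<delta> > 0"
  shows "x \<in> mesh_cube \<delta> z \<longleftrightarrow> (\<forall>b\<in>Basis. z \<bullet> b \<le> x \<bullet> b / \<delta> \<and> x \<bullet> b / \<delta> \<le> z \<bullet> b + 1)"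
  using assms by (auto simp: mesh_cube_def mem_box inner_add_left field_simps)

lemma cell_mesh_cube: "\<delta> > 0 \<Longrightarrow> x \<in> mesh_cube \<delta> (cell \<delta> x)"
  by (simp add: mem_mesh_cube cell_inner)

text \<open>
  A point of a closed cube lies in one of the \<open>2 ^ DIM\<close> half-open cubes at its upper faces.
\<close>

lemma cell_offset:
  fixes x z :: "'a::euclidean_space"
  assumes z: "z \<in> integer_points" and x: "x \<in> mesh_cube \<delta> z" and d: "\<delta> > 0"
  shows "\<exists>B\<in>Pow Basis. cell \<delta> x = z + \<Sum>B"
proof
  define B where "B = {b \<in> Basis. cell \<delta> x \<bullet> b = z \<bullet> b + 1}"
  have B: "B \<subseteq> Basis" by (auto simp: B_def)
  show "B \<in> Pow Basis" using B by simp
  show "cell \<delta> x = z + \<Sum>B"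
  proof (rule euclidean_eqI)
    fix b :: 'a assume b: "b \<in> Basis"
    have "(\<Sum>B) \<bullet> b = (\<Sum>c\<in>B. if c = b then 1 else 0)"
      unfolding inner_sum_left using B b by (intro sum.cong) (auto simp: inner_Basis)
    also have "\<dots> = (if b \<in> B then 1 else 0)" using finite_subset[OF B] by simp
    finally have sB: "(\<Sum>B) \<bullet> b = (if b \<in> B then 1 else 0)" .
    obtain k :: int where k: "z \<bullet> b = of_int k" using z b by (auto simp: integer_points_def Ints_def)
    have "of_int k \<le> x \<bullet> b / \<delta>" "x \<bullet> b / \<delta> \<le> of_int k + 1" using x b unfolding mem_mesh_cube[OF d] k[symmetric] by auto
    then have "\<lfloor>x \<bullet> b / \<delta>\<rfloor> = k \<or> \<lfloor>x \<bullet> b / \<delta>\<rfloor> = k + 1" by linarith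
    then have "cell \<delta> x \<bullet> b = z \<bullet> b \<or> cell \<delta> x \<bullet> b = z \<bullet> b + 1" using b k by (auto simp: cell_inner)
    then show "cell \<delta> x \<bullet> b = (z + \<Sum>B) \<bullet> b" unfolding inner_add_left sB using b by (auto simp: B_def)
  qed
qed

lemma cell_coord: "cell \<delta> \<circ> coord b = real_of_int \<circ> grid b \<delta>"
  by (simp add: fun_eq_iff cell_def grid_def)

definition int_pair_vec :: "int \<times> int \<Rightarrow> real^2" where
  "int_pair_vec z = vector [of_int (fst z), of_int (snd z)]"

lemma inj_int_pair_vec: "inj int_pair_vec"
proof (rule injI)
  fix x y assume "int_pair_vec x = int_pair_vec y"
  then have "int_pair_vec x $ 1 = int_pair_vec y $ 1" "int_pair_vec x $ 2 = int_pair_vec y $ 2" by simp_all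
  then show "x = y" by (simp add: int_pair_vec_def vector_2 prod_eq_iff)
qed

lemma cell_vec: "cell \<delta> = int_pair_vec \<circ> grid2 \<delta>"
proof
  fix x :: "real^2"
  have c: "cell \<delta> x $ i = of_int \<lfloor>x $ i / \<delta>\<rfloor>" for i
    using cell_inner[of "axis i 1" \<delta> x] by (simp add: inner_axis axis_in_Basis_iff)
  show "cell \<delta> x = (int_pair_vec \<circ> grid2 \<delta>) x"
    by (simp add: vec_eq_iff forall_2 c int_pair_vec_def vector_2 grid2_def coord_def)
qed

definition axis_proj :: "bool \<Rightarrow> (real^2) measure \<Rightarrow> real measure" where
  "axis_proj b = (if b then proj_x else proj_y)"

section \<open>Walks and cuts\<close>

text \<open>
  A vertex is assumed so that constants can be chosen as minima over vertices.
\<close>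

locale box_like_system =
  fixes G :: "('v, 'e) pre_digraph"
    and T :: "'e \<Rightarrow> real^2^2" and t :: "'e \<Rightarrow> real^2"
    and p :: "'e \<Rightarrow> real"
    and X :: "'v \<Rightarrow> (real^2) set" and \<mu> :: "'v \<Rightarrow> (real^2) measure"
    and q :: real
  assumes gifs: "box_like_GIFS G T"
    and connected: "strongly_connected_graph G"
    and rosc: "ROSC G T t"
    and vector: "associated_positive_vector G p"
    and attractor: "attractor_family G T t X"
    and measures: "associated_measure_family G T t p X \<mu>"
    and q_nonneg: "q \<ge> 0"
    and verts_nonempty: "verts G \<noteq> {}"
begin

sublocale fin_digraph G
  using gifs by (simp add: box_like_GIFS_def)

declare in_out_arcs_conv [simp del]

abbreviation out :: "'v \<Rightarrow> 'e set" where "out v \<equiv> out_arcs G v"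
abbreviation hd_of :: "'e \<Rightarrow> 'v" where "hd_of e \<equiv> head G e"
abbreviation \<psi> :: "'e list \<Rightarrow> real^2 \<Rightarrow> real^2" where "\<psi> \<equiv> word_map T t"
abbreviation pr :: "'e list \<Rightarrow> real" where "pr \<equiv> word_prob p"
abbreviation diag :: "'e list \<Rightarrow> bool" where "diag w \<equiv> is_diagonal (word_mat T w)"
abbreviation square :: "(real^2) set" where "square \<equiv> cbox 0 1"

lemma arc_facts:
  assumes "e \<in> out v"
  shows "e \<in> arcs G" "tail G e = v" "v \<in> verts G" "hd_of e \<in> verts G"
    "box_like (T e)" "axis_matrix (T e)" "p e > 0"
  using assms gifs vector
  by (auto simp: in_out_arcs_conv box_like_GIFS_def associated_positive_vector_def intro: box_like_axis)

lemma arc_in_out: "e \<in> arcs G \<Longrightarrow> e \<in> out (tail G e)"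
  by (simp add: in_out_arcs_conv)

lemma out_nonempty: "v \<in> verts G \<Longrightarrow> out v \<noteq> {}"
  using gifs by (auto simp: box_like_GIFS_def)

lemma finite_out: "finite (out v)" by auto

text \<open>
  The terminal vertex; the vertex \<open>v\<close> matters for the empty word only.
\<close>

definition endp :: "'v \<Rightarrow> 'e list \<Rightarrow> 'v" where
  "endp v w = (if w = [] then v else hd_of (last w))"

definition walk :: "'v \<Rightarrow> 'e list \<Rightarrow> bool" where
  "walk v w \<longleftrightarrow> awalk v w (endp v w)"

lemma endp_simps [simp]: "endp v [] = v" "endp v (e # w) = endp (hd_of e) w"
  by (auto simp: endp_def)

lemma endp_append [simp]: "endp v (u @ w) = endp (endp v u) w"
  by (induction u arbitrary: v) auto

lemma walk_Nil [simp]: "walk v [] \<longleftrightarrow> v \<in> verts G"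
  by (simp add: walk_def awalk_Nil_iff)

lemma walk_Cons [simp]: "walk v (e # w) \<longleftrightarrow> e \<in> out v \<and> walk (hd_of e) w"
  by (auto simp: walk_def awalk_Cons_iff in_out_arcs_conv)

lemma walk_append [simp]: "walk v (u @ w) \<longleftrightarrow> walk v u \<and> walk (endp v u) w"
proof (induction u arbitrary: v)
  case Nil
  then show ?case by (cases w) (auto dest: arc_facts)
qed auto

lemma walk_verts: "walk v w \<Longrightarrow> v \<in> verts G" "walk v w \<Longrightarrow> endp v w \<in> verts G"
proof (induction w arbitrary: v)
  case (Cons e w)
  { case 1 then show ?case by (auto dest: arc_facts) }
  { case 2 then show ?case using Cons by auto }
qed auto

lemma awalk_iff_walk: "awalk v w v' \<longleftrightarrow> walk v w \<and> endp v w = v'"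
proof
  assume "awalk v w v'"
  then show "walk v w \<and> endp v w = v'"
  proof (induction w arbitrary: v)
    case (Cons e w)
    then show ?case by (auto simp: awalk_Cons_iff walk_def)
  qed (auto simp: awalk_Nil_iff)
qed (auto simp: walk_def)

lemma connecting_walk:
  assumes "v \<in> verts G" "v' \<in> verts G"
  obtains w where "walk v w" "endp v w = v'"
  using assms connected by (auto simp: strongly_connected_graph_def words_def awalk_iff_walk)

definition paths :: "nat \<Rightarrow> 'v \<Rightarrow> 'e list set" where
  "paths n v = {w. walk v w \<and> length w = n}"

lemma paths_0: "v \<in> verts G \<Longrightarrow> paths 0 v = {[]}"
  by (auto simp: paths_def)

lemma paths_Suc: "paths (Suc n) v = (\<Union>e\<in>out v. (#) e ` paths n (hd_of e))"
  by (auto simp: paths_def length_Suc_conv)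

text \<open>
  The sets of words at which the tree of all walks from \<open>v\<close> can be cut: every infinite walk has
  exactly one prefix in the set. Defining cuts by recursion on the tree turns all statements about
  them into inductions.
\<close>

inductive cut :: "'v \<Rightarrow> 'e list set \<Rightarrow> bool" where
  cut_Nil: "v \<in> verts G \<Longrightarrow> cut v {[]}"
| cut_Cons: "v \<in> verts G \<Longrightarrow> (\<And>e. e \<in> out v \<Longrightarrow> cut (hd_of e) (C e)) \<Longrightarrow>
    cut v (\<Union>e\<in>out v. (#) e ` C e)"

lemma cut_finite: "cut v C \<Longrightarrow> finite C"
  by (induction rule: cut.induct) auto

lemma cut_walk: "cut v C \<Longrightarrow> w \<in> C \<Longrightarrow> walk v w"
  by (induction arbitrary: w rule: cut.induct) auto

lemma cut_verts: "cut v C \<Longrightarrow> v \<in> verts G"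
  by (induction rule: cut.induct) auto

lemma sum_Cons_family:
  assumes "\<And>e. e \<in> out v \<Longrightarrow> finite (C e)"
  shows "(\<Sum>w\<in>(\<Union>e\<in>out v. (#) e ` C e). f w) = (\<Sum>e\<in>out v. \<Sum>w\<in>C e. f (e # w))"
proof -
  have "(\<Sum>w\<in>(\<Union>e\<in>out v. (#) e ` C e). f w) = (\<Sum>e\<in>out v. \<Sum>w\<in>(#) e ` C e. f w)"
    using assms by (intro sum.UNION_disjoint) auto
  also have "\<dots> = (\<Sum>e\<in>out v. \<Sum>w\<in>C e. f (e # w))"
    by (rule sum.cong[OF refl]) (simp add: sum.reindex)
  finally show ?thesis .
qed

text \<open>
  Distinct words of a cut are never prefixes of each other, so the sets of extensions are disjoint
  and the sum over the refined cut splits.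
\<close>

lemma cut_append:
  assumes "cut v C" "\<And>w. w \<in> C \<Longrightarrow> cut (endp v w) (D w)"
  shows "cut v (\<Union>w\<in>C. (@) w ` D w)"
    and "(\<Sum>u\<in>(\<Union>w\<in>C. (@) w ` D w). (f u :: real)) = (\<Sum>w\<in>C. \<Sum>u\<in>D w. f (w @ u))"
  using assms
proof (induction arbitrary: D f rule: cut.induct)
  case (cut_Nil v)
  { case 1 then show ?case by simp }
  { case 2 then show ?case by simp }
next
  case (cut_Cons v C)
  have eq: "(\<Union>w\<in>(\<Union>e\<in>out v. (#) e ` C e). (@) w ` D w) =
      (\<Union>e\<in>out v. (#) e ` (\<Union>w\<in>C e. (@) w ` D (e # w)))" for D by auto
  { case 1
    have D: "cut (endp (hd_of e) w) (D (e # w))" if "e \<in> out v" "w \<in> C e" for e w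
      using that 1[of "e # w"] by auto
    have c: "e \<in> out v \<Longrightarrow> cut (hd_of e) (\<Union>w\<in>C e. (@) w ` D (e # w))" for e
      using D by (intro cut_Cons) auto
    then show ?case unfolding eq using cut_Cons by (intro cut.cut_Cons) auto }
  { case 2
    have D: "cut (endp (hd_of e) w) (D (e # w))" if "e \<in> out v" "w \<in> C e" for e w
      using that 2[of "e # w"] by auto
    have c: "e \<in> out v \<Longrightarrow> cut (hd_of e) (\<Union>w\<in>C e. (@) w ` D (e # w))" for e
      using D by (intro cut_Cons) auto
    have fC: "finite (C e)" if "e \<in> out v" for e using cut_Cons.hyps that cut_finite by blast
    have "(\<Sum>u\<in>(\<Union>w\<in>(\<Union>e\<in>out v. (#) e ` C e). (@) w ` D w). f u) =
      (\<Sum>e\<in>out v. \<Sum>u\<in>(\<Union>w\<in>C e. (@) w ` D (e # w)). f (e # u))"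
      unfolding eq using c cut_finite by (intro sum_Cons_family) blast
    also have "\<dots> = (\<Sum>e\<in>out v. \<Sum>w\<in>C e. \<Sum>u\<in>D (e # w). f (e # w @ u))"
    proof (rule sum.cong[OF refl])
      fix e assume e: "e \<in> out v"
      show "(\<Sum>u\<in>(\<Union>w\<in>C e. (@) w ` D (e # w)). f (e # u)) =
          (\<Sum>w\<in>C e. \<Sum>u\<in>D (e # w). f (e # w @ u))"
        using D e by (intro cut_Cons.IH(2)) auto
    qed
    also have "\<dots> = (\<Sum>w\<in>(\<Union>e\<in>out v. (#) e ` C e). \<Sum>u\<in>D w. f (w @ u))"
      by (subst sum_Cons_family) (auto simp: fC)
    finally show ?case . }
qed

lemma cut_paths: "v \<in> verts G \<Longrightarrow> cut v (paths n v)"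
proof (induction n arbitrary: v)
  case (Suc n)
  then show ?case unfolding paths_Suc by (intro cut_Cons) (auto dest: arc_facts)
qed (auto simp: paths_0 intro: cut_Nil)

lemma finite_paths: "finite (paths n v)"
proof (cases "v \<in> verts G")
  case False
  then have "paths n v = {}" by (auto simp: paths_def dest: walk_verts)
  then show ?thesis by simp
qed (auto intro: cut_finite cut_paths)

text \<open>
  Every sufficiently long walk passes through the cut exactly once.
\<close>

lemma paths_factor_cut:
  assumes "cut v C" "\<And>w. w \<in> C \<Longrightarrow> length w \<le> n"
  shows "paths n v = (\<Union>w\<in>C. (@) w ` paths (n - length w) (endp v w))"
  using assms
proof (induction arbitrary: n rule: cut.induct)
  case (cut_Cons v C)
  obtain e0 where e0: "e0 \<in> out v" using out_nonempty cut_Cons.hyps by blast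
  have ne: "C e \<noteq> {}" if "e \<in> out v" for e
  proof -
    have "cut v C \<Longrightarrow> C \<noteq> {}" for v C by (induction rule: cut.induct) (use out_nonempty in fastforce)+
    then show ?thesis using cut_Cons.hyps that by blast
  qed
  obtain m where n: "n = Suc m"
  proof -
    obtain w where "w \<in> C e0" using ne[OF e0] by blast
    then have "length (e0 # w) \<le> n" using e0 by (intro cut_Cons.prems) auto
    then show ?thesis using that by (cases n) auto
  qed
  have "paths m (hd_of e) = (\<Union>w\<in>C e. (@) w ` paths (m - length w) (endp (hd_of e) w))"
    if "e \<in> out v" for e
  proof (intro cut_Cons.IH that)
    fix w assume "w \<in> C e"
    then have "length (e # w) \<le> n" using that by (intro cut_Cons.prems) auto
    then show "length w \<le> m" using n by simp
  qed
  then show ?case unfolding n paths_Suc by auto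
qed auto

lemma sum_paths_factor_cut:
  fixes f :: "'e list \<Rightarrow> real"
  assumes "cut v C" "\<And>w. w \<in> C \<Longrightarrow> length w \<le> n"
  shows "(\<Sum>u\<in>paths n v. f u) = (\<Sum>w\<in>C. \<Sum>u\<in>paths (n - length w) (endp v w). f (w @ u))"
proof -
  have eq: "paths n v = (\<Union>w\<in>C. (@) w ` paths (n - length w) (endp v w))"
    using assms by (rule paths_factor_cut)
  show ?thesis unfolding eq
    using assms(1) by (intro cut_append(2)) (auto intro: cut_paths walk_verts cut_walk)
qed

lemma sum_paths_add:
  fixes f :: "'e list \<Rightarrow> real"
  assumes "v \<in> verts G"
  shows "(\<Sum>u\<in>paths (m + n) v. f u) = (\<Sum>w\<in>paths m v. \<Sum>u\<in>paths n (endp v w). f (w @ u))"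
proof -
  have "(\<Sum>u\<in>paths (m + n) v. f u) = (\<Sum>w\<in>paths m v. \<Sum>u\<in>paths (m + n - length w) (endp v w). f (w @ u))"
    using assms by (intro sum_paths_factor_cut cut_paths) (auto simp: paths_def)
  also have "\<dots> = (\<Sum>w\<in>paths m v. \<Sum>u\<in>paths n (endp v w). f (w @ u))"
    by (intro sum.cong) (auto simp: paths_def)
  finally show ?thesis .
qed

section \<open>Rectangles of words\<close>

text \<open>
  The side length in direction \<open>b\<close> of the rectangle \<open>\<psi> w ` square\<close>.
\<close>

definition ratio :: "'e list \<Rightarrow> bool \<Rightarrow> real" where
  "ratio w b = \<bar>rowsum (word_mat T w) b\<bar>"

lemma walk_axis: "walk v w \<Longrightarrow> axis_matrix (word_mat T w)"
  by (induction w arbitrary: v) (auto simp: axis_matrix_one intro: axis_matrix_mult arc_facts)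

lemma ratio_pos: "walk v w \<Longrightarrow> ratio w b > 0"
  using rowsum_nonzero[OF walk_axis] by (simp add: ratio_def)

lemma ratio_Nil [simp]: "ratio [] b = 1"
  by (simp add: ratio_def axis_matrix_one)

lemma ratio_append:
  assumes "walk v u" "walk v' w"
  shows "ratio (u @ w) b = ratio u b * ratio w (b = diag u)"
    and "diag (u @ w) \<longleftrightarrow> diag u = diag w"
  using axis_matrix_mult[OF walk_axis[OF assms(1)] walk_axis[OF assms(2)]]
  by (simp_all add: ratio_def word_mat_append abs_mult)

lemma ratio_single_bounds:
  obtains a c :: real where "0 < a" "a < 1" "0 < c" "c < 1"
    "\<And>e b. e \<in> arcs G \<Longrightarrow> a \<le> ratio [e] b \<and> ratio [e] b \<le> c"
proof -
  define S where "S = (\<lambda>(e, b). ratio [e] b) ` (arcs G \<times> UNIV)"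
  have fin: "finite S" by (simp add: S_def)
  have S: "0 < x \<and> x < 1" if x: "x \<in> S" for x
  proof -
    obtain e b where e: "e \<in> arcs G" "x = ratio [e] b" using x by (auto simp: S_def)
    then have o: "e \<in> out (tail G e)" by (simp add: arc_in_out)
    show ?thesis using box_like_rowsum[OF arc_facts(5)[OF o]] rowsum_nonzero[OF arc_facts(6)[OF o]] e
      by (simp add: ratio_def)
  qed
  have mem: "ratio [e] b \<in> S" if "e \<in> arcs G" for e b using that by (auto simp: S_def)
  have "Min (insert (1/2) S) \<le> 1/2" "1/2 \<le> Max (insert (1/2) S)" using fin by (intro Min_le Max_ge; simp)+
  then have "Min (insert (1/2) S) < 1" "0 < Max (insert (1/2) S)" by linarith+
  moreover have "0 < Min (insert (1/2) S)" "Max (insert (1/2) S) < 1" using fin S by auto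
  moreover have "Min (insert (1/2) S) \<le> ratio [e] b \<and> ratio [e] b \<le> Max (insert (1/2) S)"
    if "e \<in> arcs G" for e b using mem[OF that] fin by auto
  ultimately show ?thesis by (intro that[of "Min (insert (1/2) S)" "Max (insert (1/2) S)"])
qed

text \<open>
  Bounds for the scaling factors of single edges, which control by how much one more
  letter can shrink a rectangle.
\<close>

definition min_ratio :: real where
  "min_ratio = (SOME a. 0 < a \<and> a < 1 \<and> (\<forall>e\<in>arcs G. \<forall>b. a \<le> ratio [e] b))"
definition max_ratio :: real where
  "max_ratio = (SOME c. 0 < c \<and> c < 1 \<and> (\<forall>e\<in>arcs G. \<forall>b. ratio [e] b \<le> c))"

lemma min_ratio: "0 < min_ratio" "min_ratio < 1" "e \<in> arcs G \<Longrightarrow> min_ratio \<le> ratio [e] b"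
proof -
  have "\<exists>a. 0 < a \<and> a < 1 \<and> (\<forall>e\<in>arcs G. \<forall>b. a \<le> ratio [e] b)" by (metis ratio_single_bounds)
  from someI_ex[OF this] show "0 < min_ratio" "min_ratio < 1" "e \<in> arcs G \<Longrightarrow> min_ratio \<le> ratio [e] b"
    unfolding min_ratio_def by auto
qed

lemma max_ratio: "0 < max_ratio" "max_ratio < 1" "e \<in> arcs G \<Longrightarrow> ratio [e] b \<le> max_ratio"
proof -
  have "\<exists>a. 0 < a \<and> a < 1 \<and> (\<forall>e\<in>arcs G. \<forall>b. ratio [e] b \<le> a)" by (metis ratio_single_bounds)
  from someI_ex[OF this] show "0 < max_ratio" "max_ratio < 1" "e \<in> arcs G \<Longrightarrow> ratio [e] b \<le> max_ratio"
    unfolding max_ratio_def by auto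
qed

lemma ratio_bounds:
  assumes "walk v w"
  shows "min_ratio ^ length w \<le> ratio w b \<and> ratio w b \<le> max_ratio ^ length w"
  using assms
proof (induction w arbitrary: v b)
  case (Cons e w)
  have e: "walk v [e]" "walk (hd_of e) w" "e \<in> arcs G" using Cons.prems by (auto dest: arc_facts)
  have "ratio (e # w) b = ratio [e] b * ratio w (b = diag [e])"
    using ratio_append(1)[OF e(1,2)] by simp
  moreover have "min_ratio * min_ratio ^ length w \<le> ratio [e] b * ratio w (b = diag [e])"
    using Cons.IH[OF e(2)] min_ratio e(3) ratio_pos[OF e(1)] by (intro mult_mono) (auto intro: less_imp_le)
  moreover have "ratio [e] b * ratio w (b = diag [e]) \<le> max_ratio * max_ratio ^ length w"
    using Cons.IH[OF e(2)] max_ratio e ratio_pos[OF e(1)] ratio_pos[OF e(2)] by (intro mult_mono) (auto intro: less_imp_le)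
  ultimately show ?case by simp
qed simp

lemma ratio_le_1: "walk v w \<Longrightarrow> ratio w b \<le> 1"
  using ratio_bounds[of v w b] max_ratio power_le_one[of max_ratio "length w"] by force

lemma coord_\<psi>:
  assumes "walk v w"
  obtains s c where "\<bar>s\<bar> = ratio w b" "\<And>\<xi>. coord b (\<psi> w \<xi>) = s * coord (b = diag w) \<xi> + c"
  by (rule that[OF ratio_def[symmetric] coord_word_map[OF walk_axis[OF assms]]])

lemma coord_\<psi>_diff:
  assumes "walk v w"
  shows "\<bar>coord b (\<psi> w x) - coord b (\<psi> w y)\<bar> = ratio w b * \<bar>coord (b = diag w) x - coord (b = diag w) y\<bar>"
proof -
  obtain s c where sc: "\<bar>s\<bar> = ratio w b" "\<And>\<xi>. coord b (\<psi> w \<xi>) = s * coord (b = diag w) \<xi> + c"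
    using coord_\<psi>[OF assms] by blast
  show ?thesis unfolding sc(2) sc(1)[symmetric] abs_mult[symmetric] by (simp add: algebra_simps)
qed

lemma measurable_\<psi> [measurable]: "\<psi> w \<in> borel_measurable borel"
proof -
  have "continuous_on UNIV (\<lambda>\<xi>. word_mat T w *v \<xi> + \<psi> w 0)"
    by (intro continuous_intros matrix_vector_mult_linear_continuous_on)
  then have "continuous_on UNIV (\<psi> w)" by (subst word_map_affine[abs_def]) 
  then show ?thesis by (rule borel_measurable_continuous_onI)
qed

lemma edge_map_eq: "edge_map T t e = \<psi> [e]"
  by (simp add: fun_eq_iff)

lemma continuous_edge_map: "continuous_on A (edge_map T t e)"
  unfolding edge_map_def[abs_def] by (intro continuous_intros matrix_vector_mult_linear_continuous_on)

lemma edge_map_square: "e \<in> out v \<Longrightarrow> edge_map T t e ` square \<subseteq> square"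
proof -
  assume e: "e \<in> out v"
  have "(\<chi> i. 1/2) \<in> box (0::real^2) 1" by (simp add: mem_box_cart)
  then have ne: "box (0::real^2) 1 \<noteq> {}" by blast
  have "edge_map T t e ` box 0 1 \<subseteq> box 0 1" using rosc e arc_facts(3)[OF e] by (auto simp: ROSC_def)
  then have "edge_map T t e ` box 0 1 \<subseteq> cbox 0 1" using box_subset_cbox by blast
  then have "edge_map T t e ` closure (box 0 1) \<subseteq> cbox 0 1"
    by (intro image_closure_subset continuous_edge_map closed_cbox)
  then show ?thesis using ne by (simp add: closure_box)
qed

lemma \<psi>_square: "walk v w \<Longrightarrow> \<psi> w ` square \<subseteq> square"
proof (induction w arbitrary: v)
  case (Cons e w)
  then show ?case using edge_map_square[of e v] by fastforce
qed auto

lemma \<psi>_open_square: "walk v w \<Longrightarrow> \<psi> w ` box 0 1 \<subseteq> box 0 1"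
proof (induction w arbitrary: v)
  case (Cons e w)
  then have e: "e \<in> out v" by simp
  have "edge_map T t e ` box 0 1 \<subseteq> box 0 1" using rosc e arc_facts(3)[OF e] by (auto simp: ROSC_def)
  then show ?case using Cons by fastforce
qed auto

text \<open>
  The rectangular open set condition is inherited by cuts: at the first letter where two words
  differ, the images are separated by the condition at that vertex.
\<close>

lemma cut_disjoint:
  assumes "cut v C" "w \<in> C" "w' \<in> C" "w \<noteq> w'"
  shows "\<psi> w ` box 0 1 \<inter> \<psi> w' ` box 0 1 = {}"
  using assms
proof (induction arbitrary: w w' rule: cut.induct)
  case (cut_Cons v C)
  obtain e u where e: "e \<in> out v" "u \<in> C e" "w = e # u" using cut_Cons.prems by auto
  obtain e' u' where e': "e' \<in> out v" "u' \<in> C e'" "w' = e' # u'" using cut_Cons.prems by auto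
  have sub: "\<psi> u ` box 0 1 \<subseteq> box 0 1" "\<psi> u' ` box 0 1 \<subseteq> box 0 1"
    by (rule \<psi>_open_square[OF cut_walk[OF cut_Cons.hyps(2)[OF e(1)] e(2)]],
        rule \<psi>_open_square[OF cut_walk[OF cut_Cons.hyps(2)[OF e'(1)] e'(2)]])
  have im: "\<psi> w ` box 0 1 = edge_map T t e ` \<psi> u ` box 0 1" "\<psi> w' ` box 0 1 = edge_map T t e' ` \<psi> u' ` box 0 1"
    by (simp_all add: e(3) e'(3) image_comp)
  show ?case
  proof (cases "e = e'")
    case True
    then have "u \<noteq> u'" "u' \<in> C e" using e(3) e'(2,3) cut_Cons.prems(3) by auto
    then have "\<psi> u ` box 0 1 \<inter> \<psi> u' ` box 0 1 = {}" by (intro cut_Cons.IH[OF e(1,2)])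
    moreover have "inj (edge_map T t e)"
      unfolding edge_map_def[abs_def] by (rule inj_affine_axis[OF arc_facts(6)[OF e(1)]])
    ultimately show ?thesis unfolding im True by (simp only: image_Int[symmetric] image_empty)
  next
    case False
    then have "edge_map T t e ` box 0 1 \<inter> edge_map T t e' ` box 0 1 = {}"
    proof -
      have "disjoint_family_on (\<lambda>e. edge_map T t e ` box 0 1) (out v)"
        using rosc cut_Cons.hyps(1) by (simp add: ROSC_def)
      then show ?thesis using e(1) e'(1) False by (rule disjoint_family_onD)
    qed
    moreover have "\<psi> w ` box 0 1 \<subseteq> edge_map T t e ` box 0 1" "\<psi> w' ` box 0 1 \<subseteq> edge_map T t e' ` box 0 1"
      unfolding im using sub by (simp_all only: image_mono)
    ultimately show ?thesis by (meson disjoint_iff subsetD)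
  qed
qed auto

section \<open>The measures\<close>

text \<open>
  A point of the attractors farthest from the square is the image of another point of the
  attractors under a contraction mapping the square into itself, hence its distance is \<open>0\<close>.
\<close>

lemma attractor_subset:
  assumes "v \<in> verts G"
  shows "X v \<subseteq> square"
proof -
  define U where "U = (\<Union>v\<in>verts G. X v)"
  have comp: "compact U" unfolding U_def using attractor
    by (intro compact_UN) (auto simp: attractor_family_def)
  have ne: "U \<noteq> {}" using attractor verts_nonempty by (auto simp: U_def attractor_family_def)
  have "continuous_on U (\<lambda>x. infdist x square)" by (intro continuous_intros)
  then obtain x where x: "x \<in> U" "\<And>y. y \<in> U \<Longrightarrow> infdist y square \<le> infdist x square"
    using continuous_attains_sup[OF comp ne] by blast
  obtain v' where v': "v' \<in> verts G" "x \<in> X v'" using x(1) by (auto simp: U_def)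
  then obtain e y where e: "e \<in> out v'" "y \<in> X (hd_of e)" "x = edge_map T t e y"
    using attractor unfolding attractor_family_def by blast
  have "square \<noteq> {}" "closed square" by (auto simp: interval_ne_empty_cart)
  then obtain y0 where y0: "y0 \<in> square" "infdist y square = dist y y0"
    using infdist_attains_inf by metis
  have "infdist x square \<le> dist x (edge_map T t e y0)"
    using edge_map_square[OF e(1)] y0(1) by (intro infdist_le) blast
  also have "\<dots> = norm (T e *v (y - y0))"
    by (simp add: e(3) edge_map_def dist_norm matrix_vector_mult_diff_distrib)
  also have "\<dots> \<le> max_ratio * norm (y - y0)"
    using max_ratio(3)[OF arc_facts(1)[OF e(1)]] by (intro norm_axis_matrix_le arc_facts(6)[OF e(1)]) (simp add: ratio_def)
  also have "\<dots> = max_ratio * infdist y square" by (simp add: y0(2) dist_norm)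
  also have "\<dots> \<le> max_ratio * infdist x square"
    using e arc_facts(4)[OF e(1)] max_ratio by (intro mult_left_mono x(2)) (auto simp: U_def)
  finally have "infdist x square * (1 - max_ratio) \<le> 0" by (simp add: algebra_simps)
  then have "infdist x square \<le> 0" using max_ratio by (simp add: mult_le_0_iff)
  then have "infdist y square = 0" if "y \<in> U" for y
    using x(2)[OF that] infdist_nonneg[of y square] by linarith
  then show ?thesis
    using assms \<open>closed square\<close> \<open>square \<noteq> {}\<close> in_closed_iff_infdist_zero unfolding U_def by blast
qed

lemma measure_facts:
  assumes "v \<in> verts G"
  shows "prob_space (\<mu> v)" "sets (\<mu> v) = sets borel" "space (\<mu> v) = UNIV" "measure (\<mu> v) (X v) = 1"
proof -
  show "prob_space (\<mu> v)" and s: "sets (\<mu> v) = sets borel" and "measure (\<mu> v) (X v) = 1"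
    using measures assms by (auto simp: associated_measure_family_def)
  show "space (\<mu> v) = UNIV" using sets_eq_imp_space_eq[OF s] by simp
qed

lemma measure_square:
  assumes "v \<in> verts G"
  shows "measure (\<mu> v) square = 1"
proof -
  interpret prob_space "\<mu> v" by (rule measure_facts[OF assms])
  have "measure (\<mu> v) (X v) \<le> measure (\<mu> v) square"
    using attractor_subset[OF assms] by (intro finite_measure_mono) (auto simp: measure_facts[OF assms])
  then show ?thesis using measure_facts(4)[OF assms] prob_le_1[of square] by simp
qed

lemma measure_outside_square:
  assumes "v \<in> verts G" "A \<in> sets borel" "A \<inter> square = {}"
  shows "measure (\<mu> v) A = 0"
proof -
  interpret prob_space "\<mu> v" by (rule measure_facts[OF assms(1)])
  have "measure (\<mu> v) (A \<union> square) = measure (\<mu> v) A + measure (\<mu> v) square"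
    using assms by (intro finite_measure_Union) (auto simp: measure_facts[OF assms(1)])
  then show ?thesis
    using measure_square[OF assms(1)] prob_le_1[of "A \<union> square"] measure_nonneg[of "\<mu> v" A] by simp
qed

text \<open>
  The self-similarity of the family, iterated along a cut.
\<close>

lemma measure_cut:
  assumes "cut v C" "A \<in> sets borel"
  shows "measure (\<mu> v) A = (\<Sum>w\<in>C. pr w * measure (\<mu> (endp v w)) (\<psi> w -` A))"
  using assms
proof (induction arbitrary: A rule: cut.induct)
  case (cut_Cons v C)
  have pre: "\<psi> w -` A \<in> sets borel" if "A \<in> sets borel" for A w
    using measurable_sets[OF measurable_\<psi> that, of w] by simp
  have "measure (\<mu> v) A = (\<Sum>e\<in>out v. p e * measure (distr (\<mu> (hd_of e)) borel (edge_map T t e)) A)"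
    using measures cut_Cons by (simp add: associated_measure_family_def)
  also have "\<dots> = (\<Sum>e\<in>out v. \<Sum>w\<in>C e. pr (e # w) * measure (\<mu> (endp v (e # w))) (\<psi> (e # w) -` A))"
  proof (rule sum.cong[OF refl])
    fix e assume e: "e \<in> out v"
    note h = arc_facts(4)[OF e]
    have "measure (distr (\<mu> (hd_of e)) borel (edge_map T t e)) A = measure (\<mu> (hd_of e)) (\<psi> [e] -` A)"
      unfolding edge_map_eq using cut_Cons.prems measurable_\<psi>[of "[e]"]
      by (subst measure_distr) (auto simp: measure_facts[OF h] cong: measurable_cong_sets)
    also have "\<dots> = (\<Sum>w\<in>C e. pr w * measure (\<mu> (endp (hd_of e) w)) (\<psi> w -` (\<psi> [e] -` A)))"
      using e cut_Cons.prems by (intro cut_Cons.IH pre)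
    finally show "p e * measure (distr (\<mu> (hd_of e)) borel (edge_map T t e)) A =
      (\<Sum>w\<in>C e. pr (e # w) * measure (\<mu> (endp v (e # w))) (\<psi> (e # w) -` A))"
      by (simp add: sum_distrib_left mult.assoc vimage_def)
  qed
  also have "\<dots> = (\<Sum>w\<in>(\<Union>e\<in>out v. (#) e ` C e). pr w * measure (\<mu> (endp v w)) (\<psi> w -` A))"
    using cut_Cons.hyps(2) cut_finite by (subst sum_Cons_family) auto
  finally show ?case .
qed simp

lemma pr_pos: "walk v w \<Longrightarrow> pr w > 0"
  by (induction w arbitrary: v) (auto dest: arc_facts)

lemma measure_ge_word:
  assumes "walk v w" "A \<in> sets borel"
  shows "pr w * measure (\<mu> (endp v w)) (\<psi> w -` A) \<le> measure (\<mu> v) A"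
proof -
  have w: "w \<in> paths (length w) v" using assms by (simp add: paths_def)
  have "measure (\<mu> v) A = (\<Sum>u\<in>paths (length w) v. pr u * measure (\<mu> (endp v u)) (\<psi> u -` A))"
    using assms walk_verts by (intro measure_cut cut_paths) auto
  also have "\<dots> \<ge> pr w * measure (\<mu> (endp v w)) (\<psi> w -` A)"
    using w finite_paths pr_pos
    by (intro member_le_sum) (auto simp: paths_def intro!: mult_nonneg_nonneg intro: less_imp_le)
  finally show ?thesis .
qed

lemma label_\<psi>:
  assumes "label f" "walk v w"
  shows "label (f \<circ> \<psi> w)" "(f \<circ> \<psi> w) ` square \<subseteq> f ` square"
proof -
  show sub: "(f \<circ> \<psi> w) ` square \<subseteq> f ` square" using \<psi>_square[OF assms(2)] by fastforce
  show "label (f \<circ> \<psi> w)" unfolding label_def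
  proof (intro conjI allI)
    show "finite ((f \<circ> \<psi> w) ` square)" using sub assms(1) finite_subset label_def by blast
    fix z
    have "\<psi> w -` (f -` {z}) \<inter> space borel \<in> sets borel"
      using assms(1) by (intro measurable_sets[OF measurable_\<psi>]) (simp add: label_def)
    then show "(f \<circ> \<psi> w) -` {z} \<in> sets borel" by (simp add: vimage_comp)
  qed
qed

lemma measure_label_outside:
  assumes "v \<in> verts G" "label f" "z \<notin> f ` square"
  shows "measure (\<mu> v) (f -` {z}) = 0"
  using assms by (intro measure_outside_square) (auto simp: label_def)

lemma moment_superset:
  assumes "v \<in> verts G" "label f" "finite S" "f ` square \<subseteq> S"
  shows "moment (\<mu> v) q f = (\<Sum>z\<in>S. measure (\<mu> v) (f -` {z}) powr q)"
  unfolding moment_def using assms measure_label_outside[OF assms(1,2)]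
  by (intro sum.mono_neutral_left) auto

text \<open>
  Reduces an inequality between measures of classes to the combinatorial question which classes
  can meet inside the square.
\<close>

lemma measure_le_labels:
  assumes v: "v \<in> verts G" and A: "A \<in> sets borel" and g: "label g"
    and S: "finite S" "g ` (A \<inter> square) \<subseteq> S"
  shows "measure (\<mu> v) A \<le> (\<Sum>y\<in>S. measure (\<mu> v) (g -` {y}))"
proof -
  interpret prob_space "\<mu> v" by (rule measure_facts[OF v])
  note s = measure_facts(2)[OF v]
  have gm: "g -` {z} \<in> sets borel" for z using g by (simp add: label_def)
  have U: "(\<Union>y\<in>S. g -` {y}) \<in> sets borel" using S gm by (intro sets.finite_UN) auto
  have "measure (\<mu> v) A \<le> measure (\<mu> v) ((A - square) \<union> (\<Union>y\<in>S. g -` {y}))"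
    using S A U by (intro finite_measure_mono) (auto simp: s)
  also have "\<dots> \<le> measure (\<mu> v) (A - square) + measure (\<mu> v) (\<Union>y\<in>S. g -` {y})"
    using A U by (intro measure_Un_le) (auto simp: s)
  also have "measure (\<mu> v) (A - square) = 0" using A v by (intro measure_outside_square) auto
  also have "measure (\<mu> v) (\<Union>y\<in>S. g -` {y}) = (\<Sum>y\<in>S. measure (\<mu> v) (g -` {y}))"
    using S gm by (intro finite_measure_finite_Union) (auto simp: s disjoint_family_on_def)
  finally show ?thesis by simp
qed

text \<open>
  The constant in \<open>sum_powr_le_by_relation\<close> when both multiplicities are at most \<open>N\<close>.
\<close>

definition relation_const :: "nat \<Rightarrow> real" where "relation_const N = real N powr q * real N"

lemma relation_const_nonneg: "relation_const N \<ge> 0" by (simp add: relation_const_def)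

lemma relation_const_pos: "N > 0 \<Longrightarrow> relation_const N > 0" by (simp add: relation_const_def)

lemma moment_compare:
  assumes v: "v \<in> verts G" and f: "label f" and g: "label g"
    and M: "\<And>x. x \<in> square \<Longrightarrow> card (g ` {y \<in> square. f y = f x}) \<le> N"
    and N: "\<And>x. x \<in> square \<Longrightarrow> card (f ` {y \<in> square. g y = g x}) \<le> N"
  shows "moment (\<mu> v) q f \<le> relation_const N * moment (\<mu> v) q g"
  unfolding moment_def relation_const_def
proof (rule sum_powr_le_by_relation[where Rel = "\<lambda>z. g ` {y \<in> square. f y = z}"])
  show "finite (f ` square)" "finite (g ` square)" using f g by (auto simp: label_def)
  fix z assume z: "z \<in> f ` square"
  then show "card (g ` {y \<in> square. f y = z}) \<le> N" using M by auto
  show "measure (\<mu> v) (f -` {z}) \<le> (\<Sum>y\<in>g ` {y \<in> square. f y = z}. measure (\<mu> v) (g -` {y}))"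
    using f g v by (intro measure_le_labels) (auto simp: label_def intro: finite_subset[of _ "g ` square"])
next
  fix y assume "y \<in> g ` square"
  then obtain x where x: "x \<in> square" "y = g x" by blast
  have "{z \<in> f ` square. y \<in> g ` {y \<in> square. f y = z}} \<subseteq> f ` {y \<in> square. g y = g x}"
  proof
    fix z assume "z \<in> {z \<in> f ` square. y \<in> g ` {y \<in> square. f y = z}}"
    then obtain u where "u \<in> square" "f u = z" "y = g u" by blast
    then show "z \<in> f ` {y \<in> square. g y = g x}" using x(2) by blast
  qed
  then have "card {z \<in> f ` square. y \<in> g ` {y \<in> square. f y = z}} \<le> card (f ` {y \<in> square. g y = g x})"
    using f by (intro card_mono) (auto simp: label_def intro: finite_subset[of _ "f ` square"])
  then show "card {z \<in> f ` square. y \<in> g ` {y \<in> square. f y = z}} \<le> N" using N[OF x(1)] by linarith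
qed (use q_nonneg in auto)

section \<open>Stopping cuts\<close>

text \<open>
  Cuts built from prescribed blocks \<open>B v\<close> instead of single edges. Single edges give the finest
  stopping; blocks of a fixed length are needed where each block has total weight at least \<open>1\<close>.
\<close>

inductive block_cut :: "('v \<Rightarrow> 'e list set) \<Rightarrow> 'v \<Rightarrow> 'e list set \<Rightarrow> bool" for B where
  block_Nil: "v \<in> verts G \<Longrightarrow> block_cut B v {[]}"
| block_step: "v \<in> verts G \<Longrightarrow> (\<And>w. w \<in> B v \<Longrightarrow> block_cut B (endp v w) (C w)) \<Longrightarrow>
    block_cut B v (\<Union>w\<in>B v. (@) w ` C w)"

lemma block_cut_cut:
  assumes "block_cut B v C" "\<And>v. v \<in> verts G \<Longrightarrow> cut v (B v)"
  shows "cut v C"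
  using assms(1)
proof (induction rule: block_cut.induct)
  case (block_step v C)
  then show ?case using assms(2) by (intro cut_append(1)) auto
qed (rule cut_Nil)

text \<open>
  Stop a walk as soon as \<open>\<rho>\<close> drops to \<open>\<delta>\<close>. Since a block shrinks \<open>\<rho>\<close> at most by the factor \<open>a\<close>,
  the value at which it stops is above \<open>a * \<delta>\<close>; since it shrinks \<open>\<rho>\<close> at least by \<open>c\<close>, every walk
  stops. The prefix \<open>u\<close> is part of the induction because \<open>\<rho>\<close> will also be the shorter side, which is not multiplicative.
\<close>

lemma stopping_block_cut:
  fixes \<rho> :: "'e list \<Rightarrow> real"
  assumes B: "\<And>v. v \<in> verts G \<Longrightarrow> cut v (B v)"
    and step: "\<And>u w. walk v u \<Longrightarrow> w \<in> B (endp v u) \<Longrightarrow> a * \<rho> u \<le> \<rho> (u @ w) \<and> \<rho> (u @ w) \<le> c * \<rho> u"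
    and pos: "\<And>u. walk v u \<Longrightarrow> \<rho> u > 0"
    and a: "a > 0" and c: "0 < c" "c < 1" and d: "\<delta> > 0"
    and start: "walk v u" "a * \<delta> < \<rho> u"
  shows "\<exists>C. block_cut B (endp v u) C \<and> (\<forall>w\<in>C. a * \<delta> < \<rho> (u @ w) \<and> \<rho> (u @ w) \<le> \<delta>)"
proof -
  have main: "\<exists>C. block_cut B (endp v u) C \<and> (\<forall>w\<in>C. a * \<delta> < \<rho> (u @ w) \<and> \<rho> (u @ w) \<le> \<delta>)"
    if "walk v u" "a * \<delta> < \<rho> u" "c ^ n * \<rho> u \<le> \<delta>" for n u
    using that
  proof (induction n arbitrary: u)
    case 0
    then show ?case by (intro exI[of _ "{[]}"]) (auto intro: block_Nil walk_verts)
  next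
    case (Suc n)
    show ?case
    proof (cases "\<rho> u \<le> \<delta>")
      case True
      then show ?thesis using Suc.prems by (intro exI[of _ "{[]}"]) (auto intro: block_Nil walk_verts)
    next
      case False
      have vu: "endp v u \<in> verts G" using Suc.prems walk_verts by blast
      have "\<exists>C. block_cut B (endp (endp v u) w) C \<and> (\<forall>w'\<in>C. a * \<delta> < \<rho> ((u @ w) @ w') \<and> \<rho> ((u @ w) @ w') \<le> \<delta>)"
        if w: "w \<in> B (endp v u)" for w
      proof -
        note s = step[OF Suc.prems(1) w]
        have "walk v (u @ w)" using Suc.prems(1) cut_walk[OF B[OF vu] w] by simp
        moreover have "a * \<delta> < \<rho> (u @ w)"
          using s False mult_strict_left_mono[of \<delta> "\<rho> u" a] a by linarith
        moreover have "c ^ n * \<rho> (u @ w) \<le> \<delta>"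
        proof -
          have "c ^ n * \<rho> (u @ w) \<le> c ^ n * (c * \<rho> u)" using s c by (intro mult_left_mono) auto
          also have "\<dots> \<le> \<delta>" using Suc.prems(3) by (simp add: mult_ac)
          finally show ?thesis .
        qed
        ultimately show ?thesis using Suc.IH[of "u @ w"] by simp
      qed
      then obtain C where C: "\<And>w. w \<in> B (endp v u) \<Longrightarrow> block_cut B (endp (endp v u) w) (C w)"
        "\<And>w w'. w \<in> B (endp v u) \<Longrightarrow> w' \<in> C w \<Longrightarrow> a * \<delta> < \<rho> ((u @ w) @ w') \<and> \<rho> ((u @ w) @ w') \<le> \<delta>"
        by metis
      have "block_cut B (endp v u) (\<Union>w\<in>B (endp v u). (@) w ` C w)"
        using vu C(1) by (rule block_step)
      then show ?thesis using C(2) by fastforce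
    qed
  qed
  obtain n where "c ^ n < \<delta> / \<rho> u" using real_arch_pow_inv[of "\<delta> / \<rho> u" c] d c pos[OF start(1)] by auto
  then have "c ^ n * \<rho> u \<le> \<delta>" using pos[OF start(1)] by (simp add: field_simps)
  then show ?thesis using main[OF start] by blast
qed

lemma paths_1: "w \<in> paths 1 v \<longleftrightarrow> (\<exists>e\<in>out v. w = [e])"
  using arc_facts(4) by (auto simp: paths_def length_Suc_conv)

lemma ratio_snoc:
  assumes "walk v u" "e \<in> out (endp v u)"
  shows "min_ratio * ratio u b \<le> ratio (u @ [e]) b \<and> ratio (u @ [e]) b \<le> max_ratio * ratio u b"
proof -
  have e: "walk (endp v u) [e]" "e \<in> arcs G" using assms by (auto dest: arc_facts)
  have "ratio (u @ [e]) b = ratio [e] (b = diag u) * ratio u b" 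
    using ratio_append(1)[OF assms(1) e(1)] by simp
  moreover have "min_ratio * ratio u b \<le> ratio [e] (b = diag u) * ratio u b" "ratio [e] (b = diag u) * ratio u b \<le> max_ratio * ratio u b"
    using min_ratio(3)[OF e(2)] max_ratio(3)[OF e(2)] ratio_pos[OF assms(1), of b] by (intro mult_right_mono; simp)+
  ultimately show ?thesis by simp
qed

lemma stopping_cut_ratio:
  assumes "v \<in> verts G" "0 < \<delta>" "\<delta> \<le> 1"
  obtains C where "cut v C" "\<And>w. w \<in> C \<Longrightarrow> min_ratio * \<delta> < ratio w b \<and> ratio w b \<le> \<delta>"
proof -
  have "min_ratio * \<delta> < 1" using mult_left_mono[OF assms(3) less_imp_le[OF min_ratio(1)]] min_ratio(2) by linarith
  then have "\<exists>C. block_cut (paths 1) (endp v []) C \<and> (\<forall>w\<in>C. min_ratio * \<delta> < ratio ([] @ w) b \<and> ratio ([] @ w) b \<le> \<delta>)"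
    using assms min_ratio max_ratio ratio_snoc
    by (intro stopping_block_cut[where c = max_ratio]) (auto simp: paths_1 intro: cut_paths ratio_pos simp del: One_nat_def)
  then show ?thesis using that block_cut_cut cut_paths by fastforce
qed

text \<open>
  A real function that varies by at most \<open>L\<close> on a class takes at most \<open>2 * L + 1\<close> floors there, two
  such functions at most the square of this number of pairs. The square is used throughout to
  have one constant for the line and for the plane.
\<close>

definition grid_const :: "nat \<Rightarrow> real" where "grid_const L = relation_const ((2 * L + 1) * (2 * L + 1))"

lemma grid_const_pos: "grid_const L > 0" by (simp add: grid_const_def relation_const_pos)

section \<open>Moments under the word maps\<close>

lemma grid_pull:
  assumes w: "walk v w" and d: "\<delta> > 0" "\<eta> > 0"
    and L: "ratio w b * \<eta> \<le> real L * \<delta>" "\<delta> \<le> real L * (ratio w b * \<eta>)"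
  shows "grid b \<delta> (\<psi> w x) = grid b \<delta> (\<psi> w y) \<Longrightarrow> \<bar>coord (b = diag w) x / \<eta> - coord (b = diag w) y / \<eta>\<bar> \<le> L"
    and "grid (b = diag w) \<eta> x = grid (b = diag w) \<eta> y \<Longrightarrow> \<bar>coord b (\<psi> w x) / \<delta> - coord b (\<psi> w y) / \<delta>\<bar> \<le> L"
proof -
  note r = ratio_pos[OF w, of b]
  assume "grid b \<delta> (\<psi> w x) = grid b \<delta> (\<psi> w y)"
  then have "ratio w b * \<bar>coord (b = diag w) x - coord (b = diag w) y\<bar> \<le> \<delta>"
    using grid_diff d(1) coord_\<psi>_diff[OF w] by metis
  then have "\<bar>coord (b = diag w) x - coord (b = diag w) y\<bar> \<le> \<delta> / ratio w b" using r by (simp add: field_simps)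
  moreover have "\<delta> / ratio w b \<le> L * \<eta>" using L r by (simp add: field_simps)
  ultimately show "\<bar>coord (b = diag w) x / \<eta> - coord (b = diag w) y / \<eta>\<bar> \<le> L" using d by (intro scaled_diff_le)
next
  note r = ratio_pos[OF w, of b]
  assume "grid (b = diag w) \<eta> x = grid (b = diag w) \<eta> y"
  then have "\<bar>coord (b = diag w) x - coord (b = diag w) y\<bar> \<le> \<eta>" using grid_diff d by blast
  then have "\<bar>coord b (\<psi> w x) - coord b (\<psi> w y)\<bar> \<le> ratio w b * \<eta>"
    unfolding coord_\<psi>_diff[OF w] using r by (intro mult_left_mono) auto
  then show "\<bar>coord b (\<psi> w x) / \<delta> - coord b (\<psi> w y) / \<delta>\<bar> \<le> L" using L d by (intro scaled_diff_le)
qed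

lemma card_le_grid_const_root: "n \<le> 2 * L + 1 \<Longrightarrow> n \<le> (2 * L + 1) * (2 * L + (1::nat))"
  by (rule order_trans) auto

text \<open>
  Seen through \<open>\<psi> w\<close>, a mesh of size \<open>\<delta>\<close> on axis \<open>b\<close> is a mesh of size \<open>\<delta> / ratio w b\<close> on the axis to
  which \<open>b\<close> is sent; \<open>\<eta>\<close> may differ from this size by the factor \<open>L\<close>.
\<close>

lemma compare_grid:
  assumes w: "walk v w" and d: "\<delta> > 0" "\<eta> > 0"
    and L: "ratio w b * \<eta> \<le> real L * \<delta>" "\<delta> \<le> real L * (ratio w b * \<eta>)"
  shows "moment (\<mu> (endp v w)) q (grid b \<delta> \<circ> \<psi> w) \<le> grid_const L * moment (\<mu> (endp v w)) q (grid (b = diag w) \<eta>)"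
    and "moment (\<mu> (endp v w)) q (grid (b = diag w) \<eta>) \<le> grid_const L * moment (\<mu> (endp v w)) q (grid b \<delta> \<circ> \<psi> w)"
proof -
  note pull = grid_pull[OF assms]
  have 1: "card (grid (b = diag w) \<eta> ` {y \<in> square. (grid b \<delta> \<circ> \<psi> w) y = (grid b \<delta> \<circ> \<psi> w) x}) \<le> (2 * L + 1) * (2 * L + 1)" for x
    unfolding grid_abs[of "b = diag w"]
    by (intro card_le_grid_const_root card_floor_image[THEN conjunct2] pull(1)) auto
  have 2: "card ((grid b \<delta> \<circ> \<psi> w) ` {y \<in> square. grid (b = diag w) \<eta> y = grid (b = diag w) \<eta> x}) \<le> (2 * L + 1) * (2 * L + 1)" for x
    unfolding grid_abs[of b] comp_def
    by (intro card_le_grid_const_root card_floor_image[THEN conjunct2] pull(2)) auto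
  show "moment (\<mu> (endp v w)) q (grid b \<delta> \<circ> \<psi> w) \<le> grid_const L * moment (\<mu> (endp v w)) q (grid (b = diag w) \<eta>)"
    unfolding grid_const_def using 1 2 w d by (intro moment_compare label_grid label_\<psi>) (auto intro: walk_verts)
  show "moment (\<mu> (endp v w)) q (grid (b = diag w) \<eta>) \<le> grid_const L * moment (\<mu> (endp v w)) q (grid b \<delta> \<circ> \<psi> w)"
    unfolding grid_const_def using 1 2 w d by (intro moment_compare label_grid label_\<psi>) (auto intro: walk_verts)
qed

text \<open>
  A rectangle thinner than the mesh is a segment at that scale: the planar labels on it are
  determined up to bounded ambiguity by the coordinate along the long side.
\<close>

lemma compare_grid2:
  assumes w: "walk v w" and d: "\<delta> > 0" "\<eta> > 0"
    and L: "ratio w b * \<eta> \<le> real L * \<delta>" "\<delta> \<le> real L * (ratio w b * \<eta>)"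
    and thin: "ratio w (\<not> b) \<le> \<delta>" and L1: "L \<ge> 1"
  shows "moment (\<mu> (endp v w)) q (grid2 \<delta> \<circ> \<psi> w) \<le> grid_const L * moment (\<mu> (endp v w)) q (grid (b = diag w) \<eta>)"
    and "moment (\<mu> (endp v w)) q (grid (b = diag w) \<eta>) \<le> grid_const L * moment (\<mu> (endp v w)) q (grid2 \<delta> \<circ> \<psi> w)"
proof -
  note pull = grid_pull[OF w d L]
  have 1: "card (grid (b = diag w) \<eta> ` {y \<in> square. (grid2 \<delta> \<circ> \<psi> w) y = (grid2 \<delta> \<circ> \<psi> w) x}) \<le> (2 * L + 1) * (2 * L + 1)" for x
    unfolding grid_abs[of "b = diag w"]
    by (intro card_le_grid_const_root card_floor_image[THEN conjunct2] pull(1)) (auto simp: grid2_eq_iff)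
  have L_b: "\<bar>coord b' (\<psi> w x) / \<delta> - coord b' (\<psi> w y) / \<delta>\<bar> \<le> real L"
    if "x \<in> square" "y \<in> square" "grid (b = diag w) \<eta> x = grid (b = diag w) \<eta> y" for x y b'
  proof (cases "b' = b")
    case True
    then show ?thesis using pull(2) that by blast
  next
    case False
    then have b': "b' = (\<not> b)" by blast
    have "\<bar>coord (b' = diag w) x - coord (b' = diag w) y\<bar> \<le> 1"
      using that(1,2) unfolding mem_cbox_coord by (smt (verit, best))
    then have "ratio w b' * \<bar>coord (b' = diag w) x - coord (b' = diag w) y\<bar> \<le> ratio w b' * 1"
      using ratio_pos[OF w, of b'] by (intro mult_left_mono) auto
    then have "\<bar>coord b' (\<psi> w x) - coord b' (\<psi> w y)\<bar> \<le> \<delta>"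
      unfolding coord_\<psi>_diff[OF w] using thin b' by simp
    then show ?thesis using L1 d by (intro scaled_diff_le) auto
  qed
  have 2: "card ((grid2 \<delta> \<circ> \<psi> w) ` {y \<in> square. grid (b = diag w) \<eta> y = grid (b = diag w) \<eta> x}) \<le> (2 * L + 1) * (2 * L + 1)" for x
    unfolding grid2_def comp_def
    by (intro card_floor_image_pair L_b) auto
  show "moment (\<mu> (endp v w)) q (grid2 \<delta> \<circ> \<psi> w) \<le> grid_const L * moment (\<mu> (endp v w)) q (grid (b = diag w) \<eta>)"
    unfolding grid_const_def using 1 2 w d by (intro moment_compare label_grid label_grid2 label_\<psi>) (auto intro: walk_verts)
  show "moment (\<mu> (endp v w)) q (grid (b = diag w) \<eta>) \<le> grid_const L * moment (\<mu> (endp v w)) q (grid2 \<delta> \<circ> \<psi> w)"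
    unfolding grid_const_def using 1 2 w d by (intro moment_compare label_grid label_grid2 label_\<psi>) (auto intro: walk_verts)
qed

lemma compare_grid2_self:
  assumes w: "walk v w" and d: "\<delta> > 0" and L: "\<And>b. 1 \<le> real L * ratio w b" and L1: "L \<ge> 1"
  shows "moment (\<mu> (endp v w)) q (grid2 \<delta>) \<le> grid_const L * moment (\<mu> (endp v w)) q (grid2 \<delta> \<circ> \<psi> w)"
proof -
  have L': "ratio w b * \<delta> \<le> real L * \<delta>" "\<delta> \<le> real L * (ratio w b * \<delta>)" for b
  proof -
    have "ratio w b \<le> real L" using ratio_le_1[OF w, of b] L1 by linarith
    then show "ratio w b * \<delta> \<le> real L * \<delta>" using d by (intro mult_right_mono) auto
    show "\<delta> \<le> real L * (ratio w b * \<delta>)" using mult_right_mono[OF L[of b], of \<delta>] d by (simp add: mult_ac)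
  qed
  note pull = grid_pull[OF w d d L']
  have 1: "card (grid2 \<delta> ` {y \<in> square. (grid2 \<delta> \<circ> \<psi> w) y = (grid2 \<delta> \<circ> \<psi> w) x}) \<le> (2 * L + 1) * (2 * L + 1)" for x
    unfolding grid2_def[abs_def]
    by (intro card_floor_image_pair; use pull(1)[of True] pull(1)[of False] in \<open>cases "diag w"; auto simp: grid_def\<close>)
  have 2: "card ((grid2 \<delta> \<circ> \<psi> w) ` {y \<in> square. grid2 \<delta> y = grid2 \<delta> x}) \<le> (2 * L + 1) * (2 * L + 1)" for x
    unfolding grid2_eq_iff unfolding grid2_def comp_def
    by (intro card_floor_image_pair pull(2)) auto
  show ?thesis
    unfolding grid_const_def using 1 2 w d by (intro moment_compare label_grid2 label_\<psi>) (auto intro: walk_verts)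
qed

definition part :: "'v \<Rightarrow> 'e list set \<Rightarrow> ('e list \<Rightarrow> 'k) \<Rightarrow> (real^2 \<Rightarrow> 'l) \<Rightarrow> 'k \<Rightarrow> 'l \<Rightarrow> real" where
  "part v C \<kappa> f k z = (\<Sum>w | w \<in> C \<and> \<kappa> w = k. pr w * measure (\<mu> (endp v w)) ((f \<circ> \<psi> w) -` {z}))"

lemma part_nonneg: "cut v C \<Longrightarrow> part v C \<kappa> f k z \<ge> 0"
  unfolding part_def by (intro sum_nonneg) (auto intro!: mult_nonneg_nonneg less_imp_le[OF pr_pos] dest: cut_walk)

lemma measure_eq_sum_part:
  assumes "cut v C" "label f"
  shows "measure (\<mu> v) (f -` {z}) = (\<Sum>k\<in>\<kappa> ` C. part v C \<kappa> f k z)"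
proof -
  have "measure (\<mu> v) (f -` {z}) = (\<Sum>w\<in>C. pr w * measure (\<mu> (endp v w)) (\<psi> w -` (f -` {z})))"
    using assms by (intro measure_cut) (auto simp: label_def)
  then show ?thesis
    unfolding part_def using cut_finite[OF assms(1)]
    by (subst sum.group) (auto simp: vimage_comp)
qed

lemma part_eq_0:
  assumes "cut v C" "label f" "\<And>w. w \<in> C \<Longrightarrow> \<kappa> w = k \<Longrightarrow> z \<notin> (f \<circ> \<psi> w) ` square"
  shows "part v C \<kappa> f k z = 0"
  unfolding part_def
proof (intro sum.neutral ballI)
  fix w assume "w \<in> {w. w \<in> C \<and> \<kappa> w = k}"
  then have w: "w \<in> C" "\<kappa> w = k" by auto
  then have "measure (\<mu> (endp v w)) ((f \<circ> \<psi> w) -` {z}) = 0"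
    using assms cut_walk[OF assms(1)] by (intro measure_label_outside label_\<psi>) (auto intro: walk_verts)
  then show "pr w * measure (\<mu> (endp v w)) ((f \<circ> \<psi> w) -` {z}) = 0" by simp
qed

text \<open>
  If only \<open>N\<close> groups of words contribute to each class, then splitting every class by groups changes the
  moment by a bounded factor only.
\<close>

lemma moment_parts:
  assumes C: "cut v C" and f: "label f"
    and N: "\<And>z. card (\<kappa> ` {w \<in> C. z \<in> (f \<circ> \<psi> w) ` square}) \<le> N"
  shows "moment (\<mu> v) q f \<le> real N powr q * (\<Sum>k\<in>\<kappa> ` C. \<Sum>z\<in>f ` square. part v C \<kappa> f k z powr q)"
    and "(\<Sum>k\<in>\<kappa> ` C. \<Sum>z\<in>f ` square. part v C \<kappa> f k z powr q) \<le> real N * moment (\<mu> v) q f"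
proof -
  define R where "R = {(k, z). k \<in> \<kappa> ` C \<and> z \<in> f ` square \<and> k \<in> \<kappa> ` {w \<in> C. z \<in> (f \<circ> \<psi> w) ` square}}"
  have finC: "finite C" using C cut_finite by blast
  have fin: "finite (f ` square)" "finite (\<kappa> ` C \<times> f ` square)" using f finC by (auto simp: label_def)
  have RS: "R \<subseteq> \<kappa> ` C \<times> f ` square" by (auto simp: R_def)
  have finR: "finite R" using finite_subset[OF RS fin(2)] .
  have zero: "part v C \<kappa> f k z = 0" if "(k, z) \<notin> R" "k \<in> \<kappa> ` C" "z \<in> f ` square" for k z
    using that by (intro part_eq_0 C f) (auto simp: R_def)
  have sumR: "(\<Sum>k\<in>\<kappa> ` C. \<Sum>z\<in>f ` square. part v C \<kappa> f k z powr q) = (\<Sum>y\<in>R. (case y of (k, z) \<Rightarrow> part v C \<kappa> f k z) powr q)"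
  proof -
    have "(\<Sum>k\<in>\<kappa> ` C. \<Sum>z\<in>f ` square. part v C \<kappa> f k z powr q) = (\<Sum>y\<in>\<kappa> ` C \<times> f ` square. (case y of (k, z) \<Rightarrow> part v C \<kappa> f k z) powr q)"
      by (simp add: sum.cartesian_product split_def)
    also have "\<dots> = (\<Sum>y\<in>R. (case y of (k, z) \<Rightarrow> part v C \<kappa> f k z) powr q)"
      using zero by (intro sum.mono_neutral_right fin RS) auto
    finally show ?thesis .
  qed
  have Nz: "card (\<kappa> ` {w \<in> C. z \<in> (f \<circ> \<psi> w) ` square}) \<le> N" "finite (\<kappa> ` {w \<in> C. z \<in> (f \<circ> \<psi> w) ` square})" for z
    using N finC by auto
  show "moment (\<mu> v) q f \<le> real N powr q * (\<Sum>k\<in>\<kappa> ` C. \<Sum>z\<in>f ` square. part v C \<kappa> f k z powr q)"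
    unfolding sumR moment_def
  proof (rule order_trans[OF sum_powr_le_by_relation[where B = "\<lambda>(k, z). part v C \<kappa> f k z" and R = R
        and Rel = "\<lambda>z. (\<lambda>k. (k, z)) ` (\<kappa> ` {w \<in> C. z \<in> (f \<circ> \<psi> w) ` square})" and M = N and N = 1]])
    fix z assume z: "z \<in> f ` square"
    show "card ((\<lambda>k. (k, z)) ` (\<kappa> ` {w \<in> C. z \<in> (f \<circ> \<psi> w) ` square})) \<le> N"
      using card_image_le[OF Nz(2)] Nz(1) order_trans by blast
    show "(\<lambda>k. (k, z)) ` (\<kappa> ` {w \<in> C. z \<in> (f \<circ> \<psi> w) ` square}) \<subseteq> R" using z by (auto simp: R_def)
    have "measure (\<mu> v) (f -` {z}) = (\<Sum>k\<in>\<kappa> ` C. part v C \<kappa> f k z)" using C f by (rule measure_eq_sum_part)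
    also have "\<dots> = (\<Sum>k\<in>\<kappa> ` {w \<in> C. z \<in> (f \<circ> \<psi> w) ` square}. part v C \<kappa> f k z)"
      using zero z finC by (intro sum.mono_neutral_right) (auto simp: R_def)
    also have "\<dots> = (\<Sum>y\<in>(\<lambda>k. (k, z)) ` (\<kappa> ` {w \<in> C. z \<in> (f \<circ> \<psi> w) ` square}). case y of (k, z) \<Rightarrow> part v C \<kappa> f k z)"
      by (subst sum.reindex) (auto simp: inj_on_def)
    finally show "measure (\<mu> v) (f -` {z}) \<le> \<dots>" by simp
  next
    fix y assume "y \<in> R"
    have "{x \<in> f ` square. y \<in> (\<lambda>k. (k, x)) ` (\<kappa> ` {w \<in> C. x \<in> (f \<circ> \<psi> w) ` square})} \<subseteq> {snd y}" by auto
    then show "card {x \<in> f ` square. y \<in> (\<lambda>k. (k, x)) ` (\<kappa> ` {w \<in> C. x \<in> (f \<circ> \<psi> w) ` square})} \<le> 1"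
      using card_mono[of "{snd y}"] by fastforce
    show "0 \<le> (case y of (k, z) \<Rightarrow> part v C \<kappa> f k z)" using part_nonneg[OF C] by (simp add: split_def)
  qed (use fin finR q_nonneg in auto)
  show "(\<Sum>k\<in>\<kappa> ` C. \<Sum>z\<in>f ` square. part v C \<kappa> f k z powr q) \<le> real N * moment (\<mu> v) q f"
    unfolding sumR moment_def
  proof (rule order_trans[OF sum_powr_le_by_relation[where B = "\<lambda>z. measure (\<mu> v) (f -` {z})" and R = "f ` square"
        and Rel = "\<lambda>y. {snd y}" and M = 1 and N = N]])
    fix y assume y: "y \<in> R"
    obtain k z where kz: "y = (k, z)" "k \<in> \<kappa> ` C" using y by (auto simp: R_def)
    have "part v C \<kappa> f k z \<le> (\<Sum>k\<in>\<kappa> ` C. part v C \<kappa> f k z)"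
      using kz finC part_nonneg[OF C] by (intro member_le_sum) auto
    also have "\<dots> = measure (\<mu> v) (f -` {z})" by (rule measure_eq_sum_part[OF C f, symmetric])
    finally show "(case y of (k, z) \<Rightarrow> part v C \<kappa> f k z) \<le> (\<Sum>y\<in>{snd y}. measure (\<mu> v) (f -` {y}))" by (simp add: kz)
    show "0 \<le> (case y of (k, z) \<Rightarrow> part v C \<kappa> f k z)" using part_nonneg[OF C] by (simp add: split_def)
    show "{snd y} \<subseteq> f ` square" using subsetD[OF RS y] by (simp add: mem_Times_iff)
  next
    fix z assume "z \<in> f ` square"
    have "{y \<in> R. z \<in> {snd y}} \<subseteq> (\<lambda>k. (k, z)) ` (\<kappa> ` {w \<in> C. z \<in> (f \<circ> \<psi> w) ` square})" by (auto simp: R_def)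
    then have "card {y \<in> R. z \<in> {snd y}} \<le> card ((\<lambda>k. (k, z)) ` (\<kappa> ` {w \<in> C. z \<in> (f \<circ> \<psi> w) ` square}))"
      using Nz(2) by (intro card_mono) auto
    also have "\<dots> \<le> N" using card_image_le[OF Nz(2)] Nz(1) order_trans by blast
    finally show "card {y \<in> R. z \<in> {snd y}} \<le> N" .
  qed (use fin finR q_nonneg in auto)
qed

text \<open>
  The case where every word is a group of its own.
\<close>

lemma moment_cut:
  assumes C: "cut v C" and f: "label f"
    and N: "\<And>z. card {w \<in> C. z \<in> (f \<circ> \<psi> w) ` square} \<le> N"
  shows "moment (\<mu> v) q f \<le> real N powr q * (\<Sum>w\<in>C. pr w powr q * moment (\<mu> (endp v w)) q (f \<circ> \<psi> w))"
    and "(\<Sum>w\<in>C. pr w powr q * moment (\<mu> (endp v w)) q (f \<circ> \<psi> w)) \<le> real N * moment (\<mu> v) q f"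
proof -
  have eq: "(\<Sum>w\<in>(\<lambda>w. w) ` C. \<Sum>z\<in>f ` square. part v C (\<lambda>w. w) f w z powr q) =
     (\<Sum>w\<in>C. pr w powr q * moment (\<mu> (endp v w)) q (f \<circ> \<psi> w))"
  proof (unfold image_ident, rule sum.cong[OF refl])
    fix w assume w: "w \<in> C"
    have "{u. u \<in> C \<and> u = w} = {w}" using w by auto
    then have "part v C (\<lambda>w. w) f w z = pr w * measure (\<mu> (endp v w)) ((f \<circ> \<psi> w) -` {z})" for z
      by (simp add: part_def)
    moreover have "moment (\<mu> (endp v w)) q (f \<circ> \<psi> w) = (\<Sum>z\<in>f ` square. measure (\<mu> (endp v w)) ((f \<circ> \<psi> w) -` {z}) powr q)"
      using f cut_walk[OF C w] label_\<psi>[OF f cut_walk[OF C w]]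
      by (intro moment_superset) (auto simp: label_def intro: walk_verts)
    ultimately show "(\<Sum>z\<in>f ` square. part v C (\<lambda>w. w) f w z powr q) = pr w powr q * moment (\<mu> (endp v w)) q (f \<circ> \<psi> w)"
      by (simp add: powr_mult sum_distrib_left)
  qed
  show "moment (\<mu> v) q f \<le> real N powr q * (\<Sum>w\<in>C. pr w powr q * moment (\<mu> (endp v w)) q (f \<circ> \<psi> w))"
    using moment_parts(1)[OF C f, where \<kappa> = "\<lambda>w. w" and N = N] N unfolding eq by simp
  show "(\<Sum>w\<in>C. pr w powr q * moment (\<mu> (endp v w)) q (f \<circ> \<psi> w)) \<le> real N * moment (\<mu> v) q f"
    using moment_parts(2)[OF C f, where \<kappa> = "\<lambda>w. w" and N = N] N unfolding eq by simp
qed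

lemma moment_ge_word:
  assumes "walk v w" "label f"
  shows "pr w powr q * moment (\<mu> (endp v w)) q (f \<circ> \<psi> w) \<le> moment (\<mu> v) q f"
proof -
  have e: "endp v w \<in> verts G" and v: "v \<in> verts G" using assms walk_verts by auto
  have "pr w powr q * moment (\<mu> (endp v w)) q (f \<circ> \<psi> w) =
    (\<Sum>z\<in>f ` square. (pr w * measure (\<mu> (endp v w)) ((f \<circ> \<psi> w) -` {z})) powr q)"
    using assms(2) label_\<psi>[OF assms(2,1)]
    by (subst moment_superset[OF e, where S = "f ` square"]) (auto simp: label_def powr_mult sum_distrib_left)
  also have "\<dots> \<le> moment (\<mu> v) q f" unfolding moment_def vimage_comp[symmetric]
    using measure_ge_word[OF assms(1)] assms(2) q_nonneg pr_pos[OF assms(1)]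
    by (intro sum_mono powr_mono2) (auto simp: label_def)
  finally show ?thesis .
qed

section \<open>Spectra of the projected measures\<close>

definition proj_moment :: "'v \<Rightarrow> bool \<Rightarrow> real \<Rightarrow> real" where
  "proj_moment v b \<delta> = moment (\<mu> v) q (grid b \<delta>)"

lemma proj_moment_nonneg: "proj_moment v b \<delta> \<ge> 0"
  by (simp add: proj_moment_def moment_nonneg)

lemma proj_moment_reach:
  assumes w: "walk v w"
  shows "\<exists>c>0. \<forall>\<delta>>0. c * proj_moment (endp v w) (b = diag w) \<delta> \<le> proj_moment v b \<delta>"
proof -
  obtain L :: nat where L: "1 / ratio w b \<le> real L" using real_arch_simple by blast
  have r: "0 < ratio w b" "ratio w b \<le> 1" using ratio_pos[OF w] ratio_le_1[OF w] by auto
  then have "1 \<le> 1 / ratio w b" by simp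
  then have L1: "1 \<le> real L" using L by linarith
  define c where "c = pr w powr q / grid_const L"
  have "c * proj_moment (endp v w) (b = diag w) \<delta> \<le> proj_moment v b \<delta>" if d: "\<delta> > 0" for \<delta>
  proof -
    have a: "ratio w b * \<delta> \<le> real L * \<delta>" using d r L1 by (intro mult_right_mono) auto
    have b: "\<delta> \<le> real L * (ratio w b * \<delta>)"
    proof -
      have "1 \<le> real L * ratio w b" using L r by (simp add: field_simps)
      from mult_right_mono[OF this, of \<delta>] show ?thesis using d by (simp add: mult_ac)
    qed
    have "proj_moment (endp v w) (b = diag w) \<delta> \<le> grid_const L * moment (\<mu> (endp v w)) q (grid b \<delta> \<circ> \<psi> w)"
      unfolding proj_moment_def using compare_grid(2)[OF w d d a b] .
    then have "c * proj_moment (endp v w) (b = diag w) \<delta> \<le> pr w powr q * moment (\<mu> (endp v w)) q (grid b \<delta> \<circ> \<psi> w)"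
      unfolding c_def using grid_const_pos[of L] pr_pos[OF w] by (simp add: field_simps)
    also have "\<dots> \<le> proj_moment v b \<delta>" unfolding proj_moment_def using w d by (intro moment_ge_word label_grid)
    finally show ?thesis .
  qed
  moreover have "c > 0" using pr_pos[OF w] grid_const_pos by (simp add: c_def)
  ultimately show ?thesis by blast
qed

text \<open>
  A walk back to \<open>v\<close> that also undoes the effect of \<open>w\<close> on the axes. If the first return walk \<open>u\<close> has
  the wrong parity, then \<open>u @ w @ u\<close> has the right one.
\<close>

lemma return_walk:
  assumes w: "walk v w"
  obtains u where "walk (endp v w) u" "endp v (w @ u) = v" "diag u = diag w"
proof -
  obtain u where u: "walk (endp v w) u" "endp (endp v w) u = v"
    using connecting_walk walk_verts[OF w] by metis
  show ?thesis
  proof (cases "diag u = diag w")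
    case True
    then show ?thesis using that u by simp
  next
    case False
    have wu: "walk v (w @ u)" using w u by simp
    have "diag (u @ (w @ u)) = (diag u = (diag w = diag u))"
      using ratio_append(2)[OF u(1) wu] ratio_append(2)[OF w u(1)] by simp
    then show ?thesis using that[of "u @ w @ u"] u w False by auto
  qed
qed

text \<open>
  One copy of the measure at the end of \<open>w\<close> sits inside \<open>\<mu> v\<close>, which gives one inequality; the walk
  back gives the other.
\<close>

lemma proj_moment_comparable:
  assumes w: "walk v w"
  shows "\<exists>c>0. \<forall>\<delta>>0. c * proj_moment (endp v w) (b = diag w) \<delta> \<le> proj_moment v b \<delta> \<and> c * proj_moment v b \<delta> \<le> proj_moment (endp v w) (b = diag w) \<delta>"
proof -
  obtain u where u: "walk (endp v w) u" "endp v (w @ u) = v" "diag u = diag w"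
    using return_walk[OF w] .
  obtain c where c: "c > 0" "\<And>\<delta>. \<delta> > 0 \<Longrightarrow> c * proj_moment (endp v w) (b = diag w) \<delta> \<le> proj_moment v b \<delta>"
    using proj_moment_reach[OF w] by blast
  obtain c' where c': "c' > 0" "\<And>\<delta>. \<delta> > 0 \<Longrightarrow> c' * proj_moment v ((b = diag w) = diag u) \<delta> \<le> proj_moment (endp v w) (b = diag w) \<delta>"
    using proj_moment_reach[OF u(1), of "b = diag w"] u(2) by auto
  have b: "((b = diag w) = diag u) = b" using u(3) by auto
  show ?thesis
  proof (intro exI[of _ "min c c'"] conjI allI impI)
    fix \<delta> :: real assume "\<delta> > 0"
    then show "min c c' * proj_moment (endp v w) (b = diag w) \<delta> \<le> proj_moment v b \<delta>"
      using c(2)[of \<delta>] mult_right_mono[OF min.cobounded1[of c c'] proj_moment_nonneg[of "endp v w" "b = diag w" \<delta>]] by linarith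
    show "min c c' * proj_moment v b \<delta> \<le> proj_moment (endp v w) (b = diag w) \<delta>"
      using c'(2)[of \<delta>] \<open>\<delta> > 0\<close> mult_right_mono[OF min.cobounded2[of c c'] proj_moment_nonneg[of v b \<delta>]] unfolding b by linarith
  qed (use c c' in auto)
qed

text \<open>
  There are finitely many pairs of vertex and axis, so that one constant serves all walks from \<open>v\<close>.
\<close>

lemma proj_moment_comparable_uniform:
  obtains c where "c > 0" "\<And>w \<delta>. walk v w \<Longrightarrow> \<delta> > 0 \<Longrightarrow>
    c * proj_moment (endp v w) (b = diag w) \<delta> \<le> proj_moment v b \<delta> \<and> c * proj_moment v b \<delta> \<le> proj_moment (endp v w) (b = diag w) \<delta>"
proof -
  define S where "S = (\<lambda>w. (endp v w, b = diag w)) ` {w. walk v w}"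
  have fin: "finite S"
    by (rule finite_subset[of _ "verts G \<times> UNIV"]) (auto simp: S_def walk_verts)
  define Q where "Q = (\<lambda>s c. \<forall>\<delta>>0. c * proj_moment (fst s) (snd s) \<delta> \<le> proj_moment v b \<delta> \<and> c * proj_moment v b \<delta> \<le> proj_moment (fst s) (snd s) \<delta>)"
  have "\<forall>s\<in>S. \<exists>c>0. Q s c" unfolding S_def Q_def using proj_moment_comparable by auto
  then obtain C where C: "\<And>s. s \<in> S \<Longrightarrow> C s > 0 \<and> Q s (C s)" by metis
  define c where "c = Min (insert 1 (C ` S))"
  have c0: "c > 0" unfolding c_def using fin C by auto
  have "Q s c" if s: "s \<in> S" for s
  proof -
    have le: "c \<le> C s" unfolding c_def using fin s by auto
    show ?thesis unfolding Q_def
    proof (intro allI impI conjI)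
      fix \<delta> :: real assume "\<delta> > 0"
      then have "C s * proj_moment (fst s) (snd s) \<delta> \<le> proj_moment v b \<delta>" "C s * proj_moment v b \<delta> \<le> proj_moment (fst s) (snd s) \<delta>"
        using C[OF s] unfolding Q_def by auto
      then show "c * proj_moment (fst s) (snd s) \<delta> \<le> proj_moment v b \<delta>" "c * proj_moment v b \<delta> \<le> proj_moment (fst s) (snd s) \<delta>"
        using mult_right_mono[OF le proj_moment_nonneg[of "fst s" "snd s" \<delta>]] mult_right_mono[OF le proj_moment_nonneg[of v b \<delta>]] by linarith+
    qed
  qed
  then show ?thesis using that[OF c0] by (auto simp: S_def Q_def)
qed

lemma proj_moment_scale:
  assumes v: "v \<in> verts G" and d: "\<delta> > 0" "\<eta> > 0" "\<eta> \<le> real L * \<delta>" "\<delta> \<le> real L * \<eta>"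
  shows "proj_moment v b \<delta> \<le> grid_const L * proj_moment v b \<eta>"
  using compare_grid(1)[of v "[]" \<delta> \<eta> b L] v d by (simp add: proj_moment_def axis_matrix_one comp_def)

text \<open>
  About \<open>1 / \<delta>\<close> intervals cover the unit interval, so one of them has mass at least \<open>\<delta> / 2\<close>.
\<close>

lemma proj_moment_bounds:
  assumes v: "v \<in> verts G" and d: "0 < \<delta>" "\<delta> \<le> 1"
  shows "(\<delta> / 2) powr q \<le> proj_moment v b \<delta>" "proj_moment v b \<delta> \<le> 2 / \<delta>"
proof -
  interpret prob_space "\<mu> v" by (rule measure_facts[OF v])
  define S where "S = grid b \<delta> ` square"
  have finS: "finite S" using label_grid[OF d(1)] by (auto simp: S_def label_def)
  have "square \<noteq> {}" by (auto simp: interval_ne_empty_cart)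
  then have neS: "S \<noteq> {}" by (simp add: S_def)
  have "card S \<le> card {0..\<lfloor>1 / \<delta>\<rfloor>}" unfolding S_def using grid_image[OF d(1)] by (intro card_mono) auto
  then have "card S \<le> nat (\<lfloor>1 / \<delta>\<rfloor> + 1)" by simp
  then have "real (card S) \<le> real (nat (\<lfloor>1 / \<delta>\<rfloor> + 1))" by simp
  also have "\<dots> = of_int \<lfloor>1 / \<delta>\<rfloor> + 1" using d by simp
  also have "\<dots> \<le> 1 / \<delta> + 1" by simp
  finally have "real (card S) \<le> 1 / \<delta> + 1" .
  moreover have "1 \<le> 1 / \<delta>" using d by simp
  ultimately have card: "real (card S) \<le> 2 / \<delta>" by simp
  have le1: "measure (\<mu> v) A powr q \<le> 1" for A using q_nonneg by (simp add: powr_le1)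
  show "proj_moment v b \<delta> \<le> 2 / \<delta>"
  proof -
    have "proj_moment v b \<delta> \<le> (\<Sum>z\<in>S. 1)" unfolding proj_moment_def moment_def S_def by (intro sum_mono le1)
    then show ?thesis using card by simp
  qed
  define m where "m = Max ((\<lambda>z. measure (\<mu> v) (grid b \<delta> -` {z})) ` S)"
  have "m \<in> (\<lambda>z. measure (\<mu> v) (grid b \<delta> -` {z})) ` S" unfolding m_def using finS neS by (intro Max_in) auto
  then obtain z where z: "z \<in> S" "m = measure (\<mu> v) (grid b \<delta> -` {z})" by auto
  have "1 \<le> (\<Sum>z\<in>S. measure (\<mu> v) (grid b \<delta> -` {z}))"
    using measure_le_labels[OF v _ label_grid[OF d(1)] finS, of square b] measure_square[OF v] by (auto simp: S_def)
  also have "\<dots> \<le> (\<Sum>z\<in>S. m)" unfolding m_def using finS by (intro sum_mono Max_ge) auto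
  also have "\<dots> = real (card S) * m" by simp
  also have "\<dots> \<le> 2 / \<delta> * m" using card z(2) by (intro mult_right_mono) auto
  finally have "\<delta> / 2 \<le> m" using d by (simp add: field_simps)
  then have "(\<delta> / 2) powr q \<le> m powr q" using d q_nonneg by (intro powr_mono2) auto
  also have "\<dots> \<le> proj_moment v b \<delta>" unfolding proj_moment_def moment_def z(2)
    using z(1) finS unfolding S_def by (intro member_le_sum) auto
  finally show "(\<delta> / 2) powr q \<le> proj_moment v b \<delta>" .
qed

lemma proj_moment_pos: "v \<in> verts G \<Longrightarrow> 0 < \<delta> \<Longrightarrow> \<delta> \<le> 1 \<Longrightarrow> proj_moment v b \<delta> > 0"
  using proj_moment_bounds(1)[of v \<delta> b] by (smt (verit) powr_gt_zero divide_pos_pos)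

text \<open>
  The position of a word at scale \<open>\<delta>\<close>, measured at the image of the origin.
\<close>

definition base_label :: "bool \<Rightarrow> real \<Rightarrow> 'e list \<Rightarrow> int" where
  "base_label b \<delta> w = grid b \<delta> (\<psi> w 0)"

lemma near_base:
  assumes "walk v w" "ratio w b \<le> \<delta>" "x \<in> square"
  shows "\<bar>coord b (\<psi> w x) - coord b (\<psi> w 0)\<bar> \<le> \<delta>"
proof -
  have "\<bar>coord (b = diag w) x - coord (b = diag w) 0\<bar> \<le> 1" 
    using assms(3) unfolding mem_cbox_coord by (simp add: coord_zero)
  then have "ratio w b * \<bar>coord (b = diag w) x - coord (b = diag w) 0\<bar> \<le> ratio w b * 1"
    using ratio_pos[OF assms(1), of b] by (intro mult_left_mono) auto
  then show ?thesis unfolding coord_\<psi>_diff[OF assms(1)] using assms(2) by simp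
qed

lemma near_base_label:
  assumes "walk v w" "ratio w b \<le> \<delta>" "x \<in> square" "\<delta> > 0"
  shows "\<bar>grid b \<delta> (\<psi> w x) - base_label b \<delta> w\<bar> \<le> 1"
proof -
  have "\<bar>coord b (\<psi> w x) / \<delta> - coord b (\<psi> w 0) / \<delta>\<bar> \<le> 1"
    using near_base[OF assms(1-3)] assms(4) by (intro scaled_diff_le) auto
  then show ?thesis unfolding grid_def base_label_def by linarith
qed

definition block_weight :: "'e list set \<Rightarrow> bool \<Rightarrow> real \<Rightarrow> int \<Rightarrow> real" where
  "block_weight C b \<delta> k = (\<Sum>w | w \<in> C \<and> base_label b \<delta> w = k. pr w)"

lemma block_weight_pos:
  assumes "cut v C" "k \<in> base_label b \<delta> ` C"
  shows "block_weight C b \<delta> k > 0"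
  unfolding block_weight_def using assms cut_finite[OF assms(1)] cut_walk[OF assms(1)]
  by (intro sum_pos) (auto intro: pr_pos)

text \<open>
  The words at one position of scale \<open>\<delta>\<close> carry the mass of about one interval of this length, up to the
  neighbouring intervals into which their images may extend.
\<close>

lemma block_weight_moment:
  assumes C: "cut v C" and r: "\<And>w. w \<in> C \<Longrightarrow> ratio w b \<le> \<delta>" and d: "\<delta> > 0"
  shows "(\<Sum>k\<in>base_label b \<delta> ` C. block_weight C b \<delta> k powr q) \<le> relation_const 3 * proj_moment v b \<delta>"
    and "proj_moment v b \<delta> \<le> relation_const 3 * (\<Sum>k\<in>base_label b \<delta> ` C. block_weight C b \<delta> k powr q)"
proof -
  have v: "v \<in> verts G" using C cut_verts by blast
  interpret prob_space "\<mu> v" by (rule measure_facts[OF v])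
  have finC: "finite C" using C cut_finite by blast
  define g where "g = grid b \<delta>"
  have g: "label g" using label_grid[OF d] by (simp add: g_def)
  have near: "\<bar>g (\<psi> w x) - base_label b \<delta> w\<bar> \<le> 1" if "w \<in> C" "x \<in> square" for w x
    unfolding g_def using that cut_walk[OF C] r d by (intro near_base_label) auto
  define R where "R = (\<Union>k\<in>base_label b \<delta> ` C. {j. \<bar>j - k\<bar> \<le> 1}) \<union> g ` square"
  \<comment> \<open>An image of the square under a word at position \<open>k\<close> lies over the intervals \<open>k - 1\<close>, \<open>k\<close>, \<open>k + 1\<close>.\<close>
  have int3: "{j. \<bar>j - k\<bar> \<le> 1} = {k-1..k+1}" for k :: int by auto
  have finR: "finite R" unfolding R_def int3 using finC g by (auto simp: label_def)
  have M1R: "proj_moment v b \<delta> = (\<Sum>y\<in>R. measure (\<mu> v) (g -` {y}) powr q)"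
    unfolding proj_moment_def g_def[symmetric] using finR g v by (intro moment_superset) (auto simp: R_def)
  show "(\<Sum>k\<in>base_label b \<delta> ` C. block_weight C b \<delta> k powr q) \<le> relation_const 3 * proj_moment v b \<delta>"
    unfolding M1R relation_const_def
  proof (rule sum_powr_le_by_relation[where Rel = "\<lambda>k. {j. \<bar>j - k\<bar> \<le> 1}"])
    fix k assume k: "k \<in> base_label b \<delta> ` C"
    show "0 \<le> block_weight C b \<delta> k" using block_weight_pos[OF C k] by simp
    show "{j. \<bar>j - k\<bar> \<le> 1} \<subseteq> R" using k by (auto simp: R_def)
    show "card {j. \<bar>j - k\<bar> \<le> 1} \<le> 3" unfolding int3 by simp
    have A: "g -` {k-1..k+1} \<in> sets borel"
    proof -
      have "g -` {k-1..k+1} = (\<Union>y\<in>{k-1..k+1}. g -` {y})" by auto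
      also have "\<dots> \<in> sets borel" using g by (intro sets.finite_UN) (auto simp: label_def)
      finally show ?thesis .
    qed
    have "block_weight C b \<delta> k \<le> (\<Sum>w\<in>C. pr w * measure (\<mu> (endp v w)) (\<psi> w -` (g -` {k-1..k+1})))"
      unfolding block_weight_def
    proof (rule sum_le_included[where i = "\<lambda>w. w"])
      show "\<forall>w\<in>C. 0 \<le> pr w * measure (\<mu> (endp v w)) (\<psi> w -` (g -` {k-1..k+1}))"
        using cut_walk[OF C] by (auto intro!: mult_nonneg_nonneg less_imp_le[OF pr_pos])
      show "\<forall>w\<in>{w. w \<in> C \<and> base_label b \<delta> w = k}. \<exists>u\<in>C. u = w \<and>
          pr w \<le> pr u * measure (\<mu> (endp v u)) (\<psi> u -` (g -` {k-1..k+1}))"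
      proof safe
        fix w assume w: "w \<in> C" "k = base_label b \<delta> w"
        have e: "endp v w \<in> verts G" using cut_walk[OF C w(1)] walk_verts by blast
        interpret e: prob_space "\<mu> (endp v w)" by (rule measure_facts[OF e])
        have "square \<subseteq> \<psi> w -` (g -` {k-1..k+1})" using near[OF w(1)] w(2) by force
        moreover have "\<psi> w -` (g -` {k-1..k+1}) \<in> sets borel" using measurable_sets[OF measurable_\<psi> A, of w] by simp
        ultimately have "1 \<le> measure (\<mu> (endp v w)) (\<psi> w -` (g -` {k-1..k+1}))"
          unfolding measure_square[OF e, symmetric] by (intro e.finite_measure_mono) (auto simp: measure_facts[OF e])
        then have "pr w * 1 \<le> pr w * measure (\<mu> (endp v w)) (\<psi> w -` (g -` {k-1..k+1}))"
          using pr_pos[OF cut_walk[OF C w(1)]] by (intro mult_left_mono) auto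
        then show "\<exists>u\<in>C. u = w \<and> pr w \<le> pr u * measure (\<mu> (endp v u)) (\<psi> u -` (g -` {base_label b \<delta> w-1..base_label b \<delta> w+1}))"
          using w by auto
      qed
    qed (use finC in auto)
    also have "\<dots> = measure (\<mu> v) (g -` {k-1..k+1})" using measure_cut[OF C A] by simp
    also have "\<dots> \<le> (\<Sum>y\<in>{k-1..k+1}. measure (\<mu> v) (g -` {y}))"
      using v A g by (intro measure_le_labels) auto
    finally show "block_weight C b \<delta> k \<le> (\<Sum>y\<in>{j. \<bar>j - k\<bar> \<le> 1}. measure (\<mu> v) (g -` {y}))" unfolding int3 .
  next
    fix y assume "y \<in> R"
    show "card {k \<in> base_label b \<delta> ` C. y \<in> {j. \<bar>j - k\<bar> \<le> 1}} \<le> 3"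
      using card_ints_near_le_3[of "base_label b \<delta> ` C" y] by (simp add: abs_minus_commute)
  qed (use finC finR q_nonneg in auto)
  show "proj_moment v b \<delta> \<le> relation_const 3 * (\<Sum>k\<in>base_label b \<delta> ` C. block_weight C b \<delta> k powr q)"
    unfolding M1R relation_const_def
  proof (rule sum_powr_le_by_relation[where Rel = "\<lambda>y. {k \<in> base_label b \<delta> ` C. \<bar>k - y\<bar> \<le> 1}"])
    fix y assume y: "y \<in> R"
    show "card {k \<in> base_label b \<delta> ` C. \<bar>k - y\<bar> \<le> 1} \<le> 3" by (rule card_ints_near_le_3)
    have "measure (\<mu> v) (g -` {y}) = (\<Sum>k\<in>base_label b \<delta> ` C. part v C (base_label b \<delta>) g k y)"
      using C g by (rule measure_eq_sum_part)
    also have "\<dots> = (\<Sum>k\<in>{k \<in> base_label b \<delta> ` C. \<bar>k - y\<bar> \<le> 1}. part v C (base_label b \<delta>) g k y)"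
    proof (intro sum.mono_neutral_right ballI)
      fix k assume k: "k \<in> base_label b \<delta> ` C - {k \<in> base_label b \<delta> ` C. \<bar>k - y\<bar> \<le> 1}"
      show "part v C (base_label b \<delta>) g k y = 0"
        using k near by (intro part_eq_0 C g) (force simp: abs_minus_commute)
    qed (use finC in auto)
    also have "\<dots> \<le> (\<Sum>k\<in>{k \<in> base_label b \<delta> ` C. \<bar>k - y\<bar> \<le> 1}. block_weight C b \<delta> k)"
      unfolding part_def block_weight_def
    proof (intro sum_mono)
      fix k w assume "w \<in> {w. w \<in> C \<and> base_label b \<delta> w = k}"
      then have w: "walk v w" using cut_walk[OF C] by blast
      then interpret e: prob_space "\<mu> (endp v w)" by (intro measure_facts walk_verts)
      show "pr w * measure (\<mu> (endp v w)) ((g \<circ> \<psi> w) -` {y}) \<le> pr w"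
        using pr_pos[OF w] by (simp add: mult_left_le)
    qed
    finally show "measure (\<mu> v) (g -` {y}) \<le> \<dots>" .
  next
    fix k assume k: "k \<in> base_label b \<delta> ` C"
    show "0 \<le> block_weight C b \<delta> k" using block_weight_pos[OF C k] by simp
    have "card {y \<in> R. k \<in> {k \<in> base_label b \<delta> ` C. \<bar>k - y\<bar> \<le> 1}} \<le> card {y \<in> R. \<bar>y - k\<bar> \<le> 1}"
      using finR by (intro card_mono) auto
    then show "card {y \<in> R. k \<in> {k \<in> base_label b \<delta> ` C. \<bar>k - y\<bar> \<le> 1}} \<le> 3"
      using card_ints_near_le_3[of R k] by linarith
  qed (use finC finR q_nonneg in auto)
qed

lemma seven_base_labels:
  assumes C: "cut v C" and r: "\<And>w. w \<in> C \<Longrightarrow> ratio w b \<le> \<delta>" and d: "\<delta> > 0" "\<eta> > 0" "\<eta> \<le> 1"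
  shows "card (base_label b \<delta> ` {w \<in> C. z \<in> (grid b (\<delta> * \<eta>) \<circ> \<psi> w) ` square}) \<le> 7"
proof -
  have "card ((\<lambda>w. \<lfloor>coord b (\<psi> w 0) / \<delta>\<rfloor>) ` {w \<in> C. z \<in> (grid b (\<delta> * \<eta>) \<circ> \<psi> w) ` square}) \<le> 2 * 3 + 1"
  proof (rule card_floor_image[THEN conjunct2])
    fix w u assume "w \<in> {w \<in> C. z \<in> (grid b (\<delta> * \<eta>) \<circ> \<psi> w) ` square}" "u \<in> {w \<in> C. z \<in> (grid b (\<delta> * \<eta>) \<circ> \<psi> w) ` square}"
    then obtain x y where x: "w \<in> C" "x \<in> square" "z = grid b (\<delta> * \<eta>) (\<psi> w x)"
      and y: "u \<in> C" "y \<in> square" "z = grid b (\<delta> * \<eta>) (\<psi> u y)" unfolding comp_def by blast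
    have de: "\<delta> * \<eta> \<le> \<delta>" "\<delta> * \<eta> > 0" using d by (auto simp: mult_left_le)
    have "\<bar>coord b (\<psi> w x) - coord b (\<psi> u y)\<bar> \<le> \<delta> * \<eta>" using x(3) y(3) de by (intro grid_diff) auto
    moreover have "\<bar>coord b (\<psi> w x) - coord b (\<psi> w 0)\<bar> \<le> \<delta>" using near_base cut_walk[OF C x(1)] r[OF x(1)] x(2) by blast
    moreover have "\<bar>coord b (\<psi> u y) - coord b (\<psi> u 0)\<bar> \<le> \<delta>" using near_base cut_walk[OF C y(1)] r[OF y(1)] y(2) by blast
    ultimately have "\<bar>coord b (\<psi> w 0) - coord b (\<psi> u 0)\<bar> \<le> 3 * \<delta>" using de by linarith
    then show "\<bar>coord b (\<psi> w 0) / \<delta> - coord b (\<psi> u 0) / \<delta>\<bar> \<le> real 3" using d by (intro scaled_diff_le) auto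
  qed
  moreover have "base_label b \<delta> = (\<lambda>w. \<lfloor>coord b (\<psi> w 0) / \<delta>\<rfloor>)"
    by (simp add: fun_eq_iff base_label_def grid_def)
  ultimately show ?thesis by simp
qed

text \<open>
  Within the group of words at position \<open>k\<close>, a small interval receives the weighted mean of its
  masses under the maps of the group. Jensen's inequality exchanges the mean and the power,
  and every single map contributes a copy of the moment at scale \<open>\<eta>\<close>. The direction of the
  inequality is decided by \<open>q\<close>.
\<close>

lemma part_moment_sum:
  assumes C: "cut v C" and r: "\<And>w. w \<in> C \<Longrightarrow> min_ratio * \<delta> < ratio w b \<and> ratio w b \<le> \<delta>"
    and d: "\<delta> > 0" "\<eta> > 0" and k: "k \<in> base_label b \<delta> ` C"
    and L: "1 / min_ratio \<le> real L" and c: "c > 0"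
    and comp: "\<And>w. walk v w \<Longrightarrow>
      c * proj_moment (endp v w) (b = diag w) \<eta> \<le> proj_moment v b \<eta> \<and> c * proj_moment v b \<eta> \<le> proj_moment (endp v w) (b = diag w) \<eta>"
  defines "f \<equiv> grid b (\<delta> * \<eta>)"
  shows "q \<ge> 1 \<Longrightarrow> (\<Sum>z\<in>f ` square. part v C (base_label b \<delta>) f k z powr q) \<le>
      block_weight C b \<delta> k powr q * (grid_const L / c * proj_moment v b \<eta>)"
    and "q \<le> 1 \<Longrightarrow> block_weight C b \<delta> k powr q * (c / grid_const L * proj_moment v b \<eta>) \<le>
      (\<Sum>z\<in>f ` square. part v C (base_label b \<delta>) f k z powr q)"
proof -
  define W where "W = {w. w \<in> C \<and> base_label b \<delta> w = k}"
  define x where "x w z = measure (\<mu> (endp v w)) ((f \<circ> \<psi> w) -` {z})" for w z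
  have f: "label f" unfolding f_def using d by (intro label_grid) simp
  have finW: "finite W" using cut_finite[OF C] by (simp add: W_def)
  have walkW: "walk v w" if "w \<in> W" for w using that cut_walk[OF C] by (simp add: W_def)
  have bw: "block_weight C b \<delta> k = (\<Sum>w\<in>W. pr w)" by (simp add: block_weight_def W_def)
  have bw_pos: "(\<Sum>w\<in>W. pr w) > 0" using block_weight_pos[OF C k] bw by simp
  have part: "part v C (base_label b \<delta>) f k z = (\<Sum>w\<in>W. pr w * x w z)" for z
    by (simp add: part_def W_def x_def)
  have gp: "grid_const L > 0" by (rule grid_const_pos)
  have L1: "real L \<ge> 1" using L min_ratio(1,2) by (smt (verit) le_divide_eq_1_pos)
  have xw: "(\<Sum>z\<in>f ` square. x w z powr q) \<le> grid_const L / c * proj_moment v b \<eta>"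
    "c / grid_const L * proj_moment v b \<eta> \<le> (\<Sum>z\<in>f ` square. x w z powr q)" if w: "w \<in> W" for w
  proof -
    note ww = walkW[OF w]
    have rw: "min_ratio * \<delta> < ratio w b" "ratio w b \<le> \<delta>" using r w by (auto simp: W_def)
    have l1: "ratio w b * \<eta> \<le> real L * (\<delta> * \<eta>)"
    proof -
      have "ratio w b \<le> real L * \<delta>" using rw(2) L1 d(1) by (smt (verit) mult_le_cancel_right1)
      from mult_right_mono[OF this, of \<eta>] show ?thesis using d by (simp add: mult_ac)
    qed
    have l2: "\<delta> * \<eta> \<le> real L * (ratio w b * \<eta>)"
    proof -
      have "\<delta> \<le> ratio w b / min_ratio" using rw(1) min_ratio(1) by (simp add: field_simps)
      also have "\<dots> = 1 / min_ratio * ratio w b" by simp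
      also have "\<dots> \<le> real L * ratio w b" using L ratio_pos[OF ww, of b] by (intro mult_right_mono) auto
      finally have "\<delta> \<le> real L * ratio w b" .
      from mult_right_mono[OF this, of \<eta>] show ?thesis using d by (simp add: mult_ac)
    qed
    have sum_eq: "(\<Sum>z\<in>f ` square. x w z powr q) = moment (\<mu> (endp v w)) q (f \<circ> \<psi> w)"
      unfolding x_def using f ww label_\<psi>[OF f ww] walk_verts
      by (intro moment_superset[symmetric]) (auto simp: label_def)
    have de: "\<delta> * \<eta> > 0" using d by simp
    have u: "moment (\<mu> (endp v w)) q (f \<circ> \<psi> w) \<le> grid_const L * proj_moment (endp v w) (b = diag w) \<eta>"
      and l: "proj_moment (endp v w) (b = diag w) \<eta> \<le> grid_const L * moment (\<mu> (endp v w)) q (f \<circ> \<psi> w)"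
      unfolding f_def proj_moment_def using compare_grid[OF ww de d(2) l1 l2] by auto
    have "proj_moment (endp v w) (b = diag w) \<eta> \<le> proj_moment v b \<eta> / c" using comp[OF ww] c by (simp add: field_simps)
    then have "grid_const L * proj_moment (endp v w) (b = diag w) \<eta> \<le> grid_const L * (proj_moment v b \<eta> / c)" using gp by (intro mult_left_mono) auto
    then show "(\<Sum>z\<in>f ` square. x w z powr q) \<le> grid_const L / c * proj_moment v b \<eta>" unfolding sum_eq using u by simp
    have "c * proj_moment v b \<eta> \<le> grid_const L * moment (\<mu> (endp v w)) q (f \<circ> \<psi> w)" using comp[OF ww] l by linarith
    then show "c / grid_const L * proj_moment v b \<eta> \<le> (\<Sum>z\<in>f ` square. x w z powr q)"
      unfolding sum_eq using gp by (simp add: field_simps)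
  qed
  have swap: "(\<Sum>z\<in>f ` square. \<Sum>w\<in>W. pr w * x w z powr q) = (\<Sum>w\<in>W. pr w * (\<Sum>z\<in>f ` square. x w z powr q))"
    by (subst sum.swap) (simp add: sum_distrib_left)
  have pw: "(\<Sum>w\<in>W. pr w) powr (q - 1) * ((\<Sum>w\<in>W. pr w) * y) = (\<Sum>w\<in>W. pr w) powr q * y" for y
    using bw_pos by (simp add: powr_diff)
  have prW: "pr w \<ge> 0" if "w \<in> W" for w using pr_pos[OF walkW[OF that]] by simp
  { assume q1: "q \<ge> 1"
    have "(\<Sum>z\<in>f ` square. part v C (base_label b \<delta>) f k z powr q) \<le>
      (\<Sum>z\<in>f ` square. (\<Sum>w\<in>W. pr w) powr (q - 1) * (\<Sum>w\<in>W. pr w * x w z powr q))"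
      unfolding part using finW bw_pos q1 prW by (intro sum_mono weighted_powr_le) (auto simp: x_def)
    also have "\<dots> = (\<Sum>w\<in>W. pr w) powr (q - 1) * (\<Sum>w\<in>W. pr w * (\<Sum>z\<in>f ` square. x w z powr q))"
      by (simp add: sum_distrib_left[symmetric] swap)
    also have "\<dots> \<le> (\<Sum>w\<in>W. pr w) powr (q - 1) * (\<Sum>w\<in>W. pr w * (grid_const L / c * proj_moment v b \<eta>))"
      using prW by (intro mult_left_mono sum_mono xw(1)) auto
    also have "\<dots> = (\<Sum>w\<in>W. pr w) powr q * (grid_const L / c * proj_moment v b \<eta>)"
      by (simp only: sum_distrib_right[symmetric] pw)
    finally show "(\<Sum>z\<in>f ` square. part v C (base_label b \<delta>) f k z powr q) \<le>
      block_weight C b \<delta> k powr q * (grid_const L / c * proj_moment v b \<eta>)" unfolding bw . }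
  { assume q1: "q \<le> 1"
    have "(\<Sum>w\<in>W. pr w) powr q * (c / grid_const L * proj_moment v b \<eta>) =
      (\<Sum>w\<in>W. pr w) powr (q - 1) * (\<Sum>w\<in>W. pr w * (c / grid_const L * proj_moment v b \<eta>))"
      by (simp only: sum_distrib_right[symmetric] pw)
    also have "\<dots> \<le> (\<Sum>w\<in>W. pr w) powr (q - 1) * (\<Sum>w\<in>W. pr w * (\<Sum>z\<in>f ` square. x w z powr q))"
      using prW by (intro mult_left_mono sum_mono xw(2)) auto
    also have "\<dots> = (\<Sum>z\<in>f ` square. (\<Sum>w\<in>W. pr w) powr (q - 1) * (\<Sum>w\<in>W. pr w * x w z powr q))"
      by (simp add: sum_distrib_left[symmetric] swap)
    also have "\<dots> \<le> (\<Sum>z\<in>f ` square. part v C (base_label b \<delta>) f k z powr q)"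
      unfolding part using finW bw_pos q1 q_nonneg prW by (intro sum_mono weighted_powr_ge) (auto simp: x_def)
    finally show "block_weight C b \<delta> k powr q * (c / grid_const L * proj_moment v b \<eta>) \<le>
      (\<Sum>z\<in>f ` square. part v C (base_label b \<delta>) f k z powr q)" unfolding bw . }
qed

text \<open>
  Split the moment at scale \<open>\<delta> * \<eta>\<close> by the positions of the words of a cut at scale \<open>\<delta>\<close>. Each group
  contributes the power of its weight times the moment at scale \<open>\<eta>\<close>, and the powers of the weights
  add up to the moment at scale \<open>\<delta>\<close>. Overlaps between the images do no harm, since they are inside
  the groups.
\<close>

lemma proj_moment_quasi_multiplicative:
  assumes v: "v \<in> verts G"
  obtains K where "K > 0"
    "\<And>\<delta> \<eta>. q \<ge> 1 \<Longrightarrow> 0 < \<delta> \<Longrightarrow> \<delta> \<le> 1 \<Longrightarrow> 0 < \<eta> \<Longrightarrow> \<eta> \<le> 1 \<Longrightarrow> proj_moment v b (\<delta> * \<eta>) \<le> K * (proj_moment v b \<delta> * proj_moment v b \<eta>)"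
    "\<And>\<delta> \<eta>. q \<le> 1 \<Longrightarrow> 0 < \<delta> \<Longrightarrow> \<delta> \<le> 1 \<Longrightarrow> 0 < \<eta> \<Longrightarrow> \<eta> \<le> 1 \<Longrightarrow> proj_moment v b \<delta> * proj_moment v b \<eta> \<le> K * proj_moment v b (\<delta> * \<eta>)"
proof -
  obtain L :: nat where L: "1 / min_ratio \<le> real L" using real_arch_simple by blast
  obtain c where c: "c > 0" "\<And>w \<delta>. walk v w \<Longrightarrow> \<delta> > 0 \<Longrightarrow>
    c * proj_moment (endp v w) (b = diag w) \<delta> \<le> proj_moment v b \<delta> \<and> c * proj_moment v b \<delta> \<le> proj_moment (endp v w) (b = diag w) \<delta>"
    using proj_moment_comparable_uniform[of v b] by blast
  define K1 where "K1 = 7 powr q * (grid_const L / c) * relation_const 3"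
  define K2 where "K2 = 7 * relation_const 3 * (grid_const L / c)"
  have gp: "grid_const L > 0" "relation_const 3 > 0" using grid_const_pos relation_const_pos by auto
  have Kpos: "K1 > 0" "K2 > 0" unfolding K1_def K2_def using gp c by auto
  have up: "proj_moment v b (\<delta> * \<eta>) \<le> K1 * (proj_moment v b \<delta> * proj_moment v b \<eta>)"
    if q1: "q \<ge> 1" and d: "0 < \<delta>" "\<delta> \<le> 1" "0 < \<eta>" "\<eta> \<le> 1" for \<delta> \<eta>
  proof -
    obtain C where C: "cut v C" "\<And>w. w \<in> C \<Longrightarrow> min_ratio * \<delta> < ratio w b \<and> ratio w b \<le> \<delta>"
      using stopping_cut_ratio[OF v d(1,2)] by blast
    define f where "f = grid b (\<delta> * \<eta>)"
    have f: "label f" unfolding f_def using d by (intro label_grid) simp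
    have "proj_moment v b (\<delta> * \<eta>) \<le> real 7 powr q * (\<Sum>k\<in>base_label b \<delta> ` C. \<Sum>z\<in>f ` square. part v C (base_label b \<delta>) f k z powr q)"
      unfolding proj_moment_def f_def[symmetric]
      by (rule moment_parts(1)[OF C(1) f]) (use C d in \<open>unfold f_def, intro seven_base_labels, auto\<close>)
    also have "\<dots> \<le> real 7 powr q * (\<Sum>k\<in>base_label b \<delta> ` C. block_weight C b \<delta> k powr q * (grid_const L / c * proj_moment v b \<eta>))"
      using part_moment_sum(1)[OF C d(1,3) _ L c(1) c(2)[OF _ d(3)] q1, folded f_def] by (intro mult_left_mono sum_mono) auto
    also have "\<dots> = real 7 powr q * (grid_const L / c * proj_moment v b \<eta>) * (\<Sum>k\<in>base_label b \<delta> ` C. block_weight C b \<delta> k powr q)"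
      by (simp only: sum_distrib_right[symmetric]) (simp only: mult_ac)
    also have "\<dots> \<le> real 7 powr q * (grid_const L / c * proj_moment v b \<eta>) * (relation_const 3 * proj_moment v b \<delta>)"
      using C d gp c(1) proj_moment_nonneg by (intro mult_left_mono block_weight_moment(1)) (auto intro!: mult_nonneg_nonneg)
    also have "\<dots> = K1 * (proj_moment v b \<delta> * proj_moment v b \<eta>)" by (simp add: K1_def mult_ac)
    finally show ?thesis .
  qed
  have lo: "proj_moment v b \<delta> * proj_moment v b \<eta> \<le> K2 * proj_moment v b (\<delta> * \<eta>)"
    if q1: "q \<le> 1" and d: "0 < \<delta>" "\<delta> \<le> 1" "0 < \<eta>" "\<eta> \<le> 1" for \<delta> \<eta>
  proof -
    obtain C where C: "cut v C" "\<And>w. w \<in> C \<Longrightarrow> min_ratio * \<delta> < ratio w b \<and> ratio w b \<le> \<delta>"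
      using stopping_cut_ratio[OF v d(1,2)] by blast
    define f where "f = grid b (\<delta> * \<eta>)"
    have f: "label f" unfolding f_def using d by (intro label_grid) simp
    have cg: "c / grid_const L * proj_moment v b \<eta> \<ge> 0" using c gp proj_moment_nonneg by (auto intro!: mult_nonneg_nonneg)
    have "(\<Sum>k\<in>base_label b \<delta> ` C. block_weight C b \<delta> k powr q) * (c / grid_const L * proj_moment v b \<eta>) =
      (\<Sum>k\<in>base_label b \<delta> ` C. block_weight C b \<delta> k powr q * (c / grid_const L * proj_moment v b \<eta>))"
      by (rule sum_distrib_right)
    also have "\<dots> \<le> (\<Sum>k\<in>base_label b \<delta> ` C. \<Sum>z\<in>f ` square. part v C (base_label b \<delta>) f k z powr q)"
      using part_moment_sum(2)[OF C d(1,3) _ L c(1) c(2)[OF _ d(3)] q1, folded f_def] by (intro sum_mono) auto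
    also have "\<dots> \<le> real 7 * proj_moment v b (\<delta> * \<eta>)"
      unfolding proj_moment_def f_def[symmetric]
      by (rule moment_parts(2)[OF C(1) f]) (use C d in \<open>unfold f_def, intro seven_base_labels, auto\<close>)
    finally have *: "(\<Sum>k\<in>base_label b \<delta> ` C. block_weight C b \<delta> k powr q) * (c / grid_const L * proj_moment v b \<eta>) \<le> 7 * proj_moment v b (\<delta> * \<eta>)" by simp
    have "proj_moment v b \<delta> * (c / grid_const L * proj_moment v b \<eta>) \<le>
      (relation_const 3 * (\<Sum>k\<in>base_label b \<delta> ` C. block_weight C b \<delta> k powr q)) * (c / grid_const L * proj_moment v b \<eta>)"
      using C d cg by (intro mult_right_mono block_weight_moment(2)) auto
    also have "\<dots> \<le> relation_const 3 * (7 * proj_moment v b (\<delta> * \<eta>))"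
      unfolding mult.assoc using * gp by (intro mult_left_mono) auto
    finally have "proj_moment v b \<delta> * proj_moment v b \<eta> * (c / grid_const L) \<le> 7 * relation_const 3 * proj_moment v b (\<delta> * \<eta>)" by (simp add: mult_ac)
    then have "proj_moment v b \<delta> * proj_moment v b \<eta> \<le> 7 * relation_const 3 * proj_moment v b (\<delta> * \<eta>) / (c / grid_const L)"
      using c gp by (subst pos_le_divide_eq) auto
    then show ?thesis by (simp add: K2_def mult_ac)
  qed
  have nn: "proj_moment v b \<delta> * proj_moment v b \<eta> \<ge> 0" for \<delta> \<eta> using proj_moment_nonneg by simp
  show ?thesis
  proof (rule that[of "K1 + K2"])
    fix \<delta> \<eta> :: real assume d: "0 < \<delta>" "\<delta> \<le> 1" "0 < \<eta>" "\<eta> \<le> 1"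
    { assume "q \<ge> 1" from up[OF this d] show "proj_moment v b (\<delta> * \<eta>) \<le> (K1 + K2) * (proj_moment v b \<delta> * proj_moment v b \<eta>)"
        using mult_right_mono[of K1 "K1 + K2", OF _ nn[of \<delta> \<eta>]] Kpos by linarith }
    { assume "q \<le> 1" from lo[OF this d] show "proj_moment v b \<delta> * proj_moment v b \<eta> \<le> (K1 + K2) * proj_moment v b (\<delta> * \<eta>)"
        using mult_right_mono[of K2 "K1 + K2", OF _ proj_moment_nonneg[of v b "\<delta> * \<eta>"]] Kpos by linarith }
  qed (use Kpos in simp)
qed

lemma proj_moment_dyadic_limit:
  assumes v: "v \<in> verts G"
  shows "\<exists>l. (\<lambda>n. ln (proj_moment v b ((1/2) ^ n)) / real n) \<longlonglongrightarrow> l"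
proof -
  obtain K where K: "K > 0"
    "\<And>\<delta> \<eta>. q \<ge> 1 \<Longrightarrow> 0 < \<delta> \<Longrightarrow> \<delta> \<le> 1 \<Longrightarrow> 0 < \<eta> \<Longrightarrow> \<eta> \<le> 1 \<Longrightarrow> proj_moment v b (\<delta> * \<eta>) \<le> K * (proj_moment v b \<delta> * proj_moment v b \<eta>)"
    "\<And>\<delta> \<eta>. q \<le> 1 \<Longrightarrow> 0 < \<delta> \<Longrightarrow> \<delta> \<le> 1 \<Longrightarrow> 0 < \<eta> \<Longrightarrow> \<eta> \<le> 1 \<Longrightarrow> proj_moment v b \<delta> * proj_moment v b \<eta> \<le> K * proj_moment v b (\<delta> * \<eta>)"
    using proj_moment_quasi_multiplicative[OF v] by blast
  have d: "0 < (1/2 :: real) ^ n" "(1/2) ^ n \<le> (1::real)" for n by (auto simp: power_le_one)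
  have pos: "proj_moment v b ((1/2) ^ n) > 0" for n by (rule proj_moment_pos[OF v d])
  show ?thesis
  proof (cases "q \<ge> 1")
    case True
    show ?thesis
    proof (rule limit_of_quasi_subadditive)
      fix m n
      have "ln (proj_moment v b ((1/2) ^ (m + n))) \<le> ln (K * (proj_moment v b ((1/2) ^ m) * proj_moment v b ((1/2) ^ n)))"
        using K(2)[OF True d d, of m n] pos[of m] pos[of n] pos[of "m + n"] K(1)
        by (subst ln_le_cancel_iff) (simp_all add: power_add)
      also have "\<dots> = ln (proj_moment v b ((1/2) ^ m)) + ln (proj_moment v b ((1/2) ^ n)) + ln K"
        using pos[of m] pos[of n] K(1) by (simp add: ln_mult)
      finally show "ln (proj_moment v b ((1/2) ^ (m + n))) \<le> ln (proj_moment v b ((1/2) ^ m)) + ln (proj_moment v b ((1/2) ^ n)) + ln K" .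
    next
      fix n
      have "ln (((1/2) ^ n / 2) powr q) \<le> ln (proj_moment v b ((1/2) ^ n))"
        using proj_moment_bounds(1)[OF v d] pos by (subst ln_le_cancel_iff) auto
      moreover have "ln (((1/2) ^ n / 2) powr q) = - (q * ln 2) * real n - q * ln (2::real)"
        by (simp add: ln_powr ln_div ln_mult ln_realpow power_one_over algebra_simps)
      ultimately show "- (q * ln 2) * real n - q * ln 2 \<le> ln (proj_moment v b ((1/2) ^ n))" by simp
    qed
  next
    case False
    then have q1: "q \<le> 1" by simp
    show ?thesis
    proof (rule limit_of_quasi_superadditive)
      fix m n
      have "ln (proj_moment v b ((1/2) ^ m) * proj_moment v b ((1/2) ^ n)) \<le> ln (K * proj_moment v b ((1/2) ^ (m + n)))"
        using K(3)[OF q1 d d, of m n] pos[of m] pos[of n] pos[of "m + n"] K(1)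
        by (subst ln_le_cancel_iff) (simp_all add: power_add)
      also have "\<dots> = ln (proj_moment v b ((1/2) ^ (m + n))) + ln K"
        using pos[of "m + n"] K(1) by (simp add: ln_mult)
      finally show "ln (proj_moment v b ((1/2) ^ (m + n))) \<ge> ln (proj_moment v b ((1/2) ^ m)) + ln (proj_moment v b ((1/2) ^ n)) - ln K"
        using pos[of m] pos[of n] by (simp add: ln_mult)
    next
      fix n
      have "ln (proj_moment v b ((1/2) ^ n)) \<le> ln (2 / (1/2) ^ n)"
        using proj_moment_bounds(2)[OF v d] pos by (subst ln_le_cancel_iff) auto
      also have "\<dots> = ln 2 * real n + ln (2::real)"
        by (simp add: ln_div ln_mult ln_realpow power_one_over algebra_simps)
      finally show "ln (proj_moment v b ((1/2) ^ n)) \<le> ln 2 * real n + ln 2" .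
    qed
  qed
qed

text \<open>
  The exponent along dyadic scales, divided by \<open>ln 2\<close> to make it an exponent in \<open>\<delta>\<close>.
\<close>

definition \<tau> :: "'v \<Rightarrow> bool \<Rightarrow> real" where
  "\<tau> v b = lim (\<lambda>n. ln (proj_moment v b ((1/2) ^ n)) / real n) / ln 2"

lemma proj_moment_power_bounds:
  assumes v: "v \<in> verts G" and e: "e > 0"
  obtains c C where "c > 0" "C > 0" "\<And>\<delta>. 0 < \<delta> \<Longrightarrow> \<delta> < 1 \<Longrightarrow>
    c * \<delta> powr (e - \<tau> v b) \<le> proj_moment v b \<delta> \<and> proj_moment v b \<delta> \<le> C * \<delta> powr (- e - \<tau> v b)"
proof -
  obtain l where l: "(\<lambda>n. ln (proj_moment v b ((1/2) ^ n)) / real n) \<longlonglongrightarrow> l" using proj_moment_dyadic_limit[OF v] by blast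
  have t: "\<tau> v b = l / ln 2" unfolding \<tau>_def using limI[OF l] by simp
  have "e * ln 2 > 0" using e by simp
  then obtain K where K: "\<And>n. \<bar>ln (proj_moment v b ((1/2) ^ n)) - l * real n\<bar> \<le> e * ln 2 * real n + K"
    using linear_bound_of_limit[OF l] by blast
  have g: "grid_const 2 > 0" by (rule grid_const_pos)
  define A where "A = ln (grid_const 2) + K + \<bar>l\<bar>"
  have main: "\<tau> v b * (- ln \<delta>) - e * (- ln \<delta>) - A \<le> ln (proj_moment v b \<delta>) \<and>
      ln (proj_moment v b \<delta>) \<le> \<tau> v b * (- ln \<delta>) + e * (- ln \<delta>) + A" if d: "0 < \<delta>" "\<delta> < 1" for \<delta>
  proof -
    \<comment> \<open>Interpolate between the dyadic scales: \<open>\<eta> = (1/2) ^ n\<close> is the one with \<open>\<delta> \<le> \<eta> \<le> 2 * \<delta>\<close>.\<close>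
    define x where "x = - ln \<delta> / ln 2"
    have x0: "x \<ge> 0" using d by (simp add: x_def divide_nonpos_pos less_imp_le)
    define n where "n = nat \<lfloor>x\<rfloor>"
    have n: "real n \<le> x" "x < real n + 1" using x0 unfolding n_def by linarith+
    define \<eta> :: real where "\<eta> = (1/2) ^ n"
    have eta: "0 < \<eta>" "\<eta> \<le> 1" by (auto simp: \<eta>_def power_le_one)
    have ln_eta: "ln \<eta> = - real n * ln 2" by (simp add: \<eta>_def ln_realpow ln_div)
    have lnd: "ln \<delta> = - x * ln 2" by (simp add: x_def)
    have "real n * ln 2 \<le> x * ln 2" "x * ln 2 \<le> (real n + 1) * ln 2" using n by (intro mult_right_mono; simp)+
    then have "ln \<delta> \<le> ln \<eta>" "ln \<eta> \<le> ln (2 * \<delta>)"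
      using d by (simp_all add: ln_eta lnd ln_mult distrib_right)
    then have "\<delta> \<le> \<eta>" "\<eta> \<le> 2 * \<delta>" using d eta by (simp_all only: ln_le_cancel_iff mult_pos_pos zero_less_numeral)
    then have r: "\<eta> \<le> real 2 * \<delta>" "\<delta> \<le> real 2 * \<eta>" using eta by simp_all
    have pd: "proj_moment v b \<delta> > 0" "proj_moment v b \<eta> > 0" using proj_moment_pos v d eta by auto
    have "ln (proj_moment v b \<delta>) \<le> ln (grid_const 2 * proj_moment v b \<eta>)" "ln (proj_moment v b \<eta>) \<le> ln (grid_const 2 * proj_moment v b \<delta>)"
      using proj_moment_scale[OF v d(1) eta(1) r] proj_moment_scale[OF v eta(1) d(1) r(2,1)] pd g by (subst ln_le_cancel_iff; simp)+
    then have a: "ln (proj_moment v b \<delta>) \<le> ln (grid_const 2) + ln (proj_moment v b \<eta>)" "ln (proj_moment v b \<eta>) \<le> ln (grid_const 2) + ln (proj_moment v b \<delta>)"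
      using pd g by (simp_all add: ln_mult)
    have k: "\<bar>ln (proj_moment v b \<eta>) - l * real n\<bar> \<le> e * ln 2 * real n + K" using K[of n] by (simp add: \<eta>_def)
    have "\<bar>l * x - l * real n\<bar> \<le> \<bar>l\<bar> * 1"
    proof -
      have "\<bar>l * x - l * real n\<bar> = \<bar>l\<bar> * \<bar>x - real n\<bar>" by (simp only: abs_mult[symmetric] right_diff_distrib)
      also have "\<dots> \<le> \<bar>l\<bar> * 1" using n by (intro mult_left_mono) auto
      finally show ?thesis .
    qed
    moreover have "e * ln 2 * real n \<le> e * ln 2 * x" using n e by (intro mult_left_mono) auto
    moreover have "\<tau> v b * (- ln \<delta>) = l * x" "e * (- ln \<delta>) = e * ln 2 * x" by (simp_all add: t lnd)
    ultimately show ?thesis using a k unfolding A_def by linarith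
  qed
  have pw: "exp c * \<delta> powr x = exp (c + x * ln \<delta>)" if "\<delta> > 0" for c x \<delta> :: real
    using that by (simp only: powr_def exp_add) simp
  show ?thesis
  proof (rule that[of "exp (- A)" "exp A"])
    fix \<delta> :: real assume d: "0 < \<delta>" "\<delta> < 1"
    have M: "exp (ln (proj_moment v b \<delta>)) = proj_moment v b \<delta>" using proj_moment_pos v d by simp
    have E: "exp (- A + (e - \<tau> v b) * ln \<delta>) \<le> exp (ln (proj_moment v b \<delta>))"
      "exp (ln (proj_moment v b \<delta>)) \<le> exp (A + (- e - \<tau> v b) * ln \<delta>)"
      unfolding exp_le_cancel_iff using main[OF d] by (simp_all add: left_diff_distrib)
    show "exp (- A) * \<delta> powr (e - \<tau> v b) \<le> proj_moment v b \<delta> \<and> proj_moment v b \<delta> \<le> exp A * \<delta> powr (- e - \<tau> v b)"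
      using E unfolding pw[OF d(1)] M by blast
  qed auto
qed

section \<open>Closed mesh cubes\<close>

text \<open>
  Passes between closed and half-open cubes, simultaneously for the plane (\<open>h = id\<close>) and for the
  projections (\<open>h = coord b\<close>).
\<close>

lemma moment_sum_compare:
  fixes \<nu> :: "'a::euclidean_space measure" and h :: "real^2 \<Rightarrow> 'a"
  assumes v: "v \<in> verts G" and d: "\<delta> > 0"
    and h: "h \<in> borel_measurable borel"
    and \<nu>: "\<And>A. A \<in> sets borel \<Longrightarrow> measure \<nu> A = measure (\<mu> v) (h -` A)"
    and lab: "label (cell \<delta> \<circ> h)"
  shows "moment (\<mu> v) q (cell \<delta> \<circ> h) \<le> moment_sum \<nu> q \<delta>"
    and "moment_sum \<nu> q \<delta> \<le> relation_const (2 ^ DIM('a)) * moment (\<mu> v) q (cell \<delta> \<circ> h)"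
proof -
  interpret prob_space "\<mu> v" by (rule measure_facts[OF v])
  define S where "S = (cell \<delta> \<circ> h) ` square"
  define up where "up z = (\<lambda>B. z + \<Sum>B) ` Pow (Basis :: 'a set)" for z :: 'a
  define down where "down z = (\<lambda>B. z - \<Sum>B) ` Pow (Basis :: 'a set)" for z :: 'a
  have fin_ud: "finite (up z)" "finite (down z)" for z by (auto simp: up_def down_def)
  have card_ud: "card (up z) \<le> 2 ^ DIM('a)" "card (down z) \<le> 2 ^ DIM('a)" for z
    unfolding up_def down_def using card_image_le[of "Pow (Basis :: 'a set)"] by (auto simp: card_Pow)
  have ud: "y \<in> up z \<longleftrightarrow> z \<in> down y" for y z by (auto simp: up_def down_def algebra_simps)
  have finS: "finite S" using lab by (auto simp: S_def label_def)
  have Sint: "S \<subseteq> integer_points" by (auto simp: S_def cell_integer)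
  define Z where "Z = (\<Union>y\<in>S. down y) \<inter> integer_points"
  have finZ: "finite Z" using finS fin_ud by (auto simp: Z_def)
  have self: "y \<in> down y" for y unfolding down_def by (rule image_eqI[of _ _ "{}"]) auto
  then have SZ: "S \<subseteq> Z" using Sint by (auto simp: Z_def)
  have cubeb: "mesh_cube \<delta> z \<in> sets borel" for z by (simp add: mesh_cube_def)
  have hb: "h -` A \<in> sets borel" if "A \<in> sets borel" for A using measurable_sets[OF h that] by simp
  have le: "measure \<nu> (mesh_cube \<delta> z) \<le> (\<Sum>y\<in>up z \<inter> S. measure (\<mu> v) ((cell \<delta> \<circ> h) -` {y}))"
    if z: "z \<in> integer_points" for z
    unfolding \<nu>[OF cubeb]
  proof (rule measure_le_labels[OF v hb[OF cubeb] lab])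
    show "(cell \<delta> \<circ> h) ` (h -` mesh_cube \<delta> z \<inter> square) \<subseteq> up z \<inter> S"
      using cell_offset[OF z _ d] by (auto simp: up_def S_def)
  qed (use finS in auto)
  have zero: "measure \<nu> (mesh_cube \<delta> z) = 0" if z: "z \<in> integer_points" "z \<notin> Z" for z
  proof -
    have "up z \<inter> S = {}" using z by (auto simp: Z_def ud)
    then show ?thesis using le[OF z(1)] measure_nonneg[of \<nu> "mesh_cube \<delta> z"] by simp
  qed
  have ms: "moment_sum \<nu> q \<delta> = (\<Sum>z\<in>Z. measure \<nu> (mesh_cube \<delta> z) powr q)"
  proof -
    have "moment_sum \<nu> q \<delta> = (\<Sum>\<^sub>\<infinity>z\<in>Z. measure \<nu> (mesh_cube \<delta> z) powr q)"
      unfolding moment_sum_def by (rule infsum_cong_neutral) (use zero in \<open>auto simp: Z_def\<close>)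
    then show ?thesis using finZ by simp
  qed
  have "moment (\<mu> v) q (cell \<delta> \<circ> h) \<le> (\<Sum>y\<in>S. measure \<nu> (mesh_cube \<delta> y) powr q)"
    unfolding moment_def S_def[symmetric]
  proof (intro sum_mono powr_mono2 q_nonneg measure_nonneg)
    fix y
    have "measure (\<mu> v) ((cell \<delta> \<circ> h) -` {y}) \<le> measure (\<mu> v) (h -` mesh_cube \<delta> y)"
      using cell_mesh_cube[OF d] hb[OF cubeb] by (intro finite_measure_mono) (auto simp: measure_facts[OF v])
    then show "measure (\<mu> v) ((cell \<delta> \<circ> h) -` {y}) \<le> measure \<nu> (mesh_cube \<delta> y)" unfolding \<nu>[OF cubeb] .
  qed
  also have "\<dots> \<le> moment_sum \<nu> q \<delta>" unfolding ms using finZ SZ by (intro sum_mono2) auto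
  finally show "moment (\<mu> v) q (cell \<delta> \<circ> h) \<le> moment_sum \<nu> q \<delta>" .
  have "(\<Sum>z\<in>Z. measure \<nu> (mesh_cube \<delta> z) powr q) \<le> real (2 ^ DIM('a)) powr q * real (2 ^ DIM('a)) *
     (\<Sum>y\<in>S. measure (\<mu> v) ((cell \<delta> \<circ> h) -` {y}) powr q)"
  proof (rule sum_powr_le_by_relation[where Rel = "\<lambda>z. up z \<inter> S"])
    fix z assume z: "z \<in> Z"
    show "measure \<nu> (mesh_cube \<delta> z) \<le> (\<Sum>y\<in>up z \<inter> S. measure (\<mu> v) ((cell \<delta> \<circ> h) -` {y}))"
      using z by (intro le) (auto simp: Z_def)
    have "card (up z \<inter> S) \<le> card (up z)" using fin_ud by (intro card_mono) auto
    then show "card (up z \<inter> S) \<le> 2 ^ DIM('a)" using card_ud(1)[of z] by linarith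
  next
    fix y assume "y \<in> S"
    have "card {z \<in> Z. y \<in> up z \<inter> S} \<le> card (down y)" using fin_ud by (intro card_mono) (auto simp: ud)
    then show "card {z \<in> Z. y \<in> up z \<inter> S} \<le> 2 ^ DIM('a)" using card_ud(2)[of y] by linarith
  qed (use finZ finS q_nonneg in auto)
  then show "moment_sum \<nu> q \<delta> \<le> relation_const (2 ^ DIM('a)) * moment (\<mu> v) q (cell \<delta> \<circ> h)"
    unfolding ms relation_const_def moment_def S_def[symmetric] .
qed

lemma moment_sum_proj:
  assumes v: "v \<in> verts G" and d: "\<delta> > 0"
  shows "proj_moment v b \<delta> \<le> moment_sum (axis_proj b (\<mu> v)) q \<delta>"
    and "moment_sum (axis_proj b (\<mu> v)) q \<delta> \<le> relation_const 2 * proj_moment v b \<delta>"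
proof -
  have m: "measure (axis_proj b (\<mu> v)) A = measure (\<mu> v) (coord b -` A)" if "A \<in> sets borel" for A
  proof -
    have "axis_proj b (\<mu> v) = distr (\<mu> v) borel (coord b)"
      by (cases b) (simp_all add: axis_proj_def proj_x_def proj_y_def coord_True coord_False)
    moreover have "coord b \<in> measurable (\<mu> v) borel"
      using borel_measurable_coord[of b] measurable_cong_sets[OF measure_facts(2)[OF v] refl] by blast
    ultimately show ?thesis using that by (simp add: measure_distr measure_facts[OF v])
  qed
  have l: "label (cell \<delta> \<circ> coord b)" unfolding cell_coord by (intro label_comp label_grid d)
  have e: "moment (\<mu> v) q (cell \<delta> \<circ> coord b) = proj_moment v b \<delta>"
    unfolding cell_coord proj_moment_def by (rule moment_inj) (simp add: inj_def)
  show "proj_moment v b \<delta> \<le> moment_sum (axis_proj b (\<mu> v)) q \<delta>"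
    using moment_sum_compare(1)[OF v d borel_measurable_coord m l] unfolding e .
  show "moment_sum (axis_proj b (\<mu> v)) q \<delta> \<le> relation_const 2 * proj_moment v b \<delta>"
    using moment_sum_compare(2)[OF v d borel_measurable_coord m l] unfolding e by simp
qed

definition planar_moment :: "'v \<Rightarrow> real \<Rightarrow> real" where
  "planar_moment v \<delta> = moment (\<mu> v) q (grid2 \<delta>)"

lemma moment_sum_planar:
  assumes v: "v \<in> verts G" and d: "\<delta> > 0"
  shows "planar_moment v \<delta> \<le> moment_sum (\<mu> v) q \<delta>"
    and "moment_sum (\<mu> v) q \<delta> \<le> relation_const 4 * planar_moment v \<delta>"
proof -
  have m: "measure (\<mu> v) A = measure (\<mu> v) (id -` A)" for A by simp
  have l: "label (cell \<delta> \<circ> (id :: real^2 \<Rightarrow> _))" unfolding comp_id cell_vec by (intro label_comp label_grid2 d)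
  have e: "moment (\<mu> v) q (cell \<delta> \<circ> id) = planar_moment v \<delta>"
    unfolding comp_id cell_vec planar_moment_def by (rule moment_inj) (rule inj_int_pair_vec)
  have i: "(id :: real^2 \<Rightarrow> _) \<in> borel_measurable borel" by (simp add: id_def)
  show "planar_moment v \<delta> \<le> moment_sum (\<mu> v) q \<delta>"
    using moment_sum_compare(1)[OF v d i m l] unfolding e .
  show "moment_sum (\<mu> v) q \<delta> \<le> relation_const 4 * planar_moment v \<delta>"
    using moment_sum_compare(2)[OF v d i m l] unfolding e by simp
qed

lemma Lq_limit_proj:
  assumes v: "v \<in> verts G"
  shows "(Lq_quotient (axis_proj b (\<mu> v)) q \<longlongrightarrow> \<tau> v b) (at_right 0)"
  unfolding Lq_quotient_def[abs_def]
proof (rule Lq_limit_of_power_bounds)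
  fix e :: real assume e: "e > 0"
  obtain c C where c: "c > 0" "C > 0" and cC: "\<And>\<delta>. 0 < \<delta> \<Longrightarrow> \<delta> < 1 \<Longrightarrow>
    c * \<delta> powr (e - \<tau> v b) \<le> proj_moment v b \<delta> \<and> proj_moment v b \<delta> \<le> C * \<delta> powr (- e - \<tau> v b)"
    using proj_moment_power_bounds[OF v e, of b] by blast
  show "\<exists>c>0. \<forall>d\<in>{0<..<1}. c * d powr (e - \<tau> v b) \<le> moment_sum (axis_proj b (\<mu> v)) q d"
  proof (intro exI[of _ c] conjI ballI c)
    fix d :: real assume "d \<in> {0<..<1}"
    then show "c * d powr (e - \<tau> v b) \<le> moment_sum (axis_proj b (\<mu> v)) q d"
      using cC[of d] moment_sum_proj(1)[OF v, of d b] by simp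
  qed
  show "\<exists>c. \<forall>d\<in>{0<..<1}. moment_sum (axis_proj b (\<mu> v)) q d \<le> c * d powr (- e - \<tau> v b)"
  proof (intro exI[of _ "relation_const 2 * C"] ballI)
    fix d :: real assume d: "d \<in> {0<..<1}"
    have "relation_const 2 * proj_moment v b d \<le> relation_const 2 * (C * d powr (- e - \<tau> v b))"
      using cC[of d] d relation_const_nonneg by (intro mult_left_mono) auto
    then show "moment_sum (axis_proj b (\<mu> v)) q d \<le> relation_const 2 * C * d powr (- e - \<tau> v b)"
      using moment_sum_proj(2)[OF v, of d b] d by simp
  qed
qed

lemma Lq_spectrum_proj:
  assumes "v \<in> verts G"
  shows "Lq_spectrum (axis_proj b (\<mu> v)) q = \<tau> v b"
  unfolding Lq_spectrum_def by (rule tendsto_Lim[OF _ Lq_limit_proj[OF assms]]) simp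

text \<open>
  Comparable moments have the same exponent.
\<close>

lemma \<tau>_walk:
  assumes w: "walk v w"
  shows "\<tau> (endp v w) (b = diag w) = \<tau> v b"
proof -
  have vs: "v \<in> verts G" "endp v w \<in> verts G" using walk_verts[OF w] by auto
  obtain c where c: "c > 0" "\<And>\<delta>. \<delta> > 0 \<Longrightarrow> c * proj_moment (endp v w) (b = diag w) \<delta> \<le> proj_moment v b \<delta> \<and> c * proj_moment v b \<delta> \<le> proj_moment (endp v w) (b = diag w) \<delta>"
    using proj_moment_comparable[OF w] by blast
  define f where "f n = ln (proj_moment v b ((1/2) ^ n)) / real n" for n
  define g where "g n = ln (proj_moment (endp v w) (b = diag w) ((1/2) ^ n)) / real n" for n
  obtain l where l: "f \<longlonglongrightarrow> l" using proj_moment_dyadic_limit[OF vs(1)] unfolding f_def by blast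
  obtain l' where l': "g \<longlonglongrightarrow> l'" using proj_moment_dyadic_limit[OF vs(2)] unfolding g_def by blast
  have "\<bar>f n - g n\<bar> \<le> \<bar>ln c\<bar> / real n" for n
  proof -
    have d: "0 < (1/2::real) ^ n" "(1/2::real) ^ n \<le> 1" by (auto simp: power_le_one)
    define A where "A = proj_moment v b ((1/2) ^ n)"
    define B where "B = proj_moment (endp v w) (b = diag w) ((1/2) ^ n)"
    have p: "A > 0" "B > 0" using proj_moment_pos[OF vs(1) d] proj_moment_pos[OF vs(2) d] by (auto simp: A_def B_def)
    have "c * B \<le> A" "c * A \<le> B" using c(2)[OF d(1)] by (auto simp: A_def B_def)
    then have "ln (c * B) \<le> ln A" "ln (c * A) \<le> ln B" using p c by (subst ln_le_cancel_iff; simp)+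
    then have "ln c + ln B \<le> ln A" "ln c + ln A \<le> ln B" using p c by (simp_all add: ln_mult)
    then have "\<bar>ln A - ln B\<bar> \<le> \<bar>ln c\<bar>" by linarith
    moreover have "f n - g n = (ln A - ln B) / real n" by (simp add: f_def g_def A_def B_def diff_divide_distrib)
    ultimately show ?thesis by (simp add: divide_right_mono)
  qed
  then have "(\<lambda>n. f n - g n) \<longlonglongrightarrow> 0"
    by (intro Lim_null_comparison[OF _ lim_const_over_n[of "\<bar>ln c\<bar>"]]) auto
  moreover have "(\<lambda>n. f n - g n) \<longlonglongrightarrow> l - l'" using l l' by (rule tendsto_diff)
  ultimately have "l = l'" using LIMSEQ_unique by fastforce
  then show ?thesis using limI[OF l] limI[OF l'] unfolding \<tau>_def f_def[symmetric] g_def[symmetric] by simp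
qed

definition \<theta> :: real where
  "\<theta> = (let v = (SOME v. v \<in> verts G) in \<tau> v True + \<tau> v False)"

text \<open>
  A walk to \<open>v\<close> either preserves or exchanges the axes, and the sum of the exponents is
  symmetric in them.
\<close>

lemma \<theta>_eq:
  assumes "v \<in> verts G"
  shows "\<tau> v b + \<tau> v (\<not> b) = \<theta>"
proof -
  define v0 where "v0 = (SOME v. v \<in> verts G)"
  have v0: "v0 \<in> verts G" unfolding v0_def using verts_nonempty by (simp add: some_in_eq)
  obtain w where w: "walk v0 w" "endp v0 w = v" using connecting_walk[OF v0 assms] .
  have "\<theta> = \<tau> v0 True + \<tau> v0 False" by (simp add: \<theta>_def v0_def Let_def)
  also have "\<dots> = \<tau> v (True = diag w) + \<tau> v (False = diag w)" using \<tau>_walk[OF w(1), of True] \<tau>_walk[OF w(1), of False] w(2) by simp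
  also have "\<dots> = \<tau> v b + \<tau> v (\<not> b)" by (cases b; cases "diag w") simp_all
  finally show ?thesis by simp
qed

section \<open>The singular value weight\<close>

definition wide :: "'e list \<Rightarrow> bool" where "wide w \<longleftrightarrow> ratio w True \<ge> ratio w False"
definition long_side :: "'e list \<Rightarrow> real" where "long_side w = ratio w (wide w)"
definition short_side :: "'e list \<Rightarrow> real" where "short_side w = ratio w (\<not> wide w)"

lemma short_side_le_ratio: "short_side w \<le> ratio w b"
  by (cases b; cases "wide w") (auto simp: short_side_def wide_def)

lemma short_side_le_long_side: "short_side w \<le> long_side w"
  unfolding long_side_def by (rule short_side_le_ratio)

lemma sides_pos: "walk v w \<Longrightarrow> long_side w > 0" "walk v w \<Longrightarrow> short_side w > 0"
  by (auto simp: long_side_def short_side_def ratio_pos)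

lemma long_side_le_1: "walk v w \<Longrightarrow> long_side w \<le> 1"
  by (simp add: long_side_def ratio_le_1)

lemma short_side_bounds: "walk v w \<Longrightarrow> min_ratio ^ length w \<le> short_side w \<and> short_side w \<le> max_ratio ^ length w"
  unfolding short_side_def by (rule ratio_bounds)

lemma short_side_append:
  assumes "walk v u" "walk (endp v u) w"
  shows "min_ratio ^ length w * short_side u \<le> short_side (u @ w)" "short_side (u @ w) \<le> max_ratio ^ length w * short_side u"
proof -
  have ra: "ratio (u @ w) b = ratio u b * ratio w (b = diag u)" for b by (rule ratio_append(1)[OF assms])
  have w: "min_ratio ^ length w \<le> ratio w b \<and> ratio w b \<le> max_ratio ^ length w" for b by (rule ratio_bounds[OF assms(2)])
  have u: "ratio u b \<ge> 0" for b using ratio_pos[OF assms(1), of b] by simp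
  have aw: "0 \<le> min_ratio ^ length w" using min_ratio by simp
  let ?b = "\<not> wide (u @ w)"
  have "min_ratio ^ length w * short_side u \<le> ratio w (?b = diag u) * ratio u ?b"
    using w aw short_side_le_ratio[of u ?b] sides_pos(2)[OF assms(1)] by (intro mult_mono) (auto intro: order_trans[OF aw])
  then show "min_ratio ^ length w * short_side u \<le> short_side (u @ w)" unfolding short_side_def[of "u @ w"] ra by (simp add: mult.commute)
  have "short_side (u @ w) \<le> ratio (u @ w) (\<not> wide u)" by (rule short_side_le_ratio)
  also have "\<dots> \<le> max_ratio ^ length w * short_side u"
    unfolding ra short_side_def using w[of "(\<not> wide u) = diag u"] u[of "\<not> wide u"]
    by (subst mult.commute) (intro mult_right_mono; simp)
  finally show "short_side (u @ w) \<le> max_ratio ^ length w * short_side u" .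
qed

text \<open>
  The weight of a word if axis \<open>b\<close> is treated as the direction of the long side.
\<close>

definition axis_weight :: "real \<Rightarrow> 'v \<Rightarrow> bool \<Rightarrow> 'e list \<Rightarrow> real" where
  "axis_weight s v b w = pr w powr q * ratio w b powr \<tau> v b * ratio w (\<not> b) powr (s - \<tau> v b)"

definition \<Phi> :: "real \<Rightarrow> 'v \<Rightarrow> 'e list \<Rightarrow> real" where
  "\<Phi> s v w = axis_weight s v (wide w) w"

lemma \<Phi>_alt: "\<Phi> s v w = pr w powr q * long_side w powr \<tau> v (wide w) * short_side w powr (s - \<tau> v (wide w))"
  by (simp add: \<Phi>_def axis_weight_def long_side_def short_side_def)

text \<open>
  Both the ratios and the exponents follow the axis \<open>b\<close> through \<open>u\<close>; this is where the invariance of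
  \<open>\<tau>\<close> along walks enters.
\<close>

lemma axis_weight_append:
  assumes "walk v u" "walk (endp v u) w"
  shows "axis_weight s v b (u @ w) = axis_weight s v b u * axis_weight s (endp v u) (b = diag u) w"
proof -
  have "((\<not> b) = diag u) = (\<not> (b = diag u))" by auto
  then show ?thesis
    unfolding axis_weight_def ratio_append(1)[OF assms] \<tau>_walk[OF assms(1)]
    by (simp add: powr_mult)
qed

lemma axis_weight_pos: "walk v w \<Longrightarrow> axis_weight s v b w > 0"
  unfolding axis_weight_def using pr_pos[of v w] ratio_pos[of v w b] ratio_pos[of v w "\<not> b"] by simp

lemma \<Phi>_pos: "walk v w \<Longrightarrow> \<Phi> s v w > 0"
  by (simp add: \<Phi>_def axis_weight_pos)

lemma \<Phi>_Nil [simp]: "\<Phi> s v [] = 1"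
  by (simp add: \<Phi>_def axis_weight_def)

lemma axis_weight_le_\<Phi>_aux:
  assumes w: "walk v w" and x: "x \<ge> 0"
  shows "short_side w powr x * long_side w powr (- x) \<le> 1"
proof -
  have "short_side w powr x \<le> long_side w powr x" using sides_pos[OF w] short_side_le_long_side x by (intro powr_mono2) auto
  then show ?thesis using sides_pos[OF w] by (simp add: powr_minus field_simps)
qed

text \<open>
  Exchanging the roles of the sides changes the weight by the factor
  \<open>(short_side w / long_side w) powr (\<theta> - s)\<close>, whose comparison with \<open>1\<close> depends only on the sign of
  \<open>\<theta> - s\<close>.
\<close>

lemma axis_weight_other:
  assumes w: "walk v w"
  shows "axis_weight s v (\<not> wide w) w = \<Phi> s v w * (short_side w powr (\<theta> - s) * long_side w powr (- (\<theta> - s)))"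
proof -
  have v: "v \<in> verts G" using w walk_verts by blast
  have t: "\<tau> v (\<not> wide w) = (s - \<tau> v (wide w)) + (\<theta> - s)" using \<theta>_eq[OF v, of "wide w"] by simp
  have t2: "s - \<tau> v (\<not> wide w) = \<tau> v (wide w) + (- (\<theta> - s))" using t by simp
  show ?thesis
    unfolding \<Phi>_alt axis_weight_def t2 not_not long_side_def[symmetric] short_side_def[symmetric] unfolding t powr_add by (simp add: mult_ac)
qed

lemma axis_weight_le_\<Phi>:
  assumes w: "walk v w" and s: "s \<le> \<theta>"
  shows "axis_weight s v b w \<le> \<Phi> s v w"
proof (cases "b = wide w")
  case False
  then have b: "b = (\<not> wide w)" by auto
  have "\<Phi> s v w * (short_side w powr (\<theta> - s) * long_side w powr (- (\<theta> - s))) \<le> \<Phi> s v w * 1"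
    using axis_weight_le_\<Phi>_aux[OF w, of "\<theta> - s"] s \<Phi>_pos[OF w, of s] by (intro mult_left_mono) auto
  then show ?thesis unfolding b axis_weight_other[OF w] by simp
qed (simp add: \<Phi>_def)

lemma \<Phi>_le_axis_weight:
  assumes w: "walk v w" and s: "s \<ge> \<theta>"
  shows "\<Phi> s v w \<le> axis_weight s v b w"
proof (cases "b = wide w")
  case False
  then have b: "b = (\<not> wide w)" by auto
  have p: "short_side w powr (s - \<theta>) * long_side w powr (- (s - \<theta>)) > 0" using sides_pos[OF w] by auto
  have "short_side w powr (\<theta> - s) * long_side w powr (- (\<theta> - s)) = 1 / (short_side w powr (s - \<theta>) * long_side w powr (- (s - \<theta>)))"
    using sides_pos[OF w] by (simp add: powr_minus_divide[symmetric] powr_divide powr_diff)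
  also have "\<dots> \<ge> 1" using axis_weight_le_\<Phi>_aux[OF w, of "s - \<theta>"] s p by simp
  finally have "\<Phi> s v w * 1 \<le> \<Phi> s v w * (short_side w powr (\<theta> - s) * long_side w powr (- (\<theta> - s)))"
    using \<Phi>_pos[OF w, of s] by (intro mult_left_mono) auto
  then show ?thesis unfolding b axis_weight_other[OF w] by simp
qed (simp add: \<Phi>_def)

text \<open>
  For \<open>s \<le> \<theta>\<close> the weight is the maximum of two multiplicative weights.
\<close>

lemma \<Phi>_submult:
  assumes "walk v u" "walk (endp v u) w" "s \<le> \<theta>"
  shows "\<Phi> s v (u @ w) \<le> \<Phi> s v u * \<Phi> s (endp v u) w"
  unfolding \<Phi>_def[of s v "u @ w"] axis_weight_append[OF assms(1,2)]
  using assms axis_weight_le_\<Phi> axis_weight_pos \<Phi>_pos by (intro mult_mono) (auto intro: less_imp_le)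

text \<open>
  For \<open>s \<ge> \<theta>\<close> it is the minimum.
\<close>

lemma \<Phi>_supermult:
  assumes "walk v u" "walk (endp v u) w" "s \<ge> \<theta>"
  shows "\<Phi> s v u * \<Phi> s (endp v u) w \<le> \<Phi> s v (u @ w)"
  unfolding \<Phi>_def[of s v "u @ w"] axis_weight_append[OF assms(1,2)]
  using assms \<Phi>_le_axis_weight axis_weight_pos \<Phi>_pos by (intro mult_mono) (auto intro: less_imp_le)

text \<open>
  Appending a letter changes the weight by a bounded factor, for every \<open>s\<close>: compare both words
  through the axis that is favourable for the inequality.
\<close>

lemma \<Phi>_snoc:
  obtains k K where "0 < k" "0 < K" "\<And>v u e. walk v u \<Longrightarrow> e \<in> out (endp v u) \<Longrightarrow>
    k * \<Phi> s v u \<le> \<Phi> s v (u @ [e]) \<and> \<Phi> s v (u @ [e]) \<le> K * \<Phi> s v u"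
proof -
  define vals where "vals = (\<lambda>(e, b). axis_weight s (tail G e) b [e]) ` (arcs G \<times> UNIV)"
  have fin: "finite vals" by (simp add: vals_def)
  have pos: "x > 0" if "x \<in> vals" for x
    using that arc_in_out by (auto simp: vals_def intro!: axis_weight_pos dest: arc_facts)
  define k where "k = Min (insert 1 vals)"
  define K where "K = Max (insert 1 vals)"
  have k0: "k > 0" unfolding k_def using fin pos by auto
  have "1 \<le> K" unfolding K_def using fin by (intro Max_ge) auto
  then have K0: "K > 0" by linarith
  have kK: "k \<le> axis_weight s v' b [e] \<and> axis_weight s v' b [e] \<le> K" if "e \<in> out v'" for v' b e
  proof -
    have "axis_weight s v' b [e] \<in> vals" using arc_facts(1,2)[OF that] by (force simp: vals_def)
    then show ?thesis unfolding k_def K_def using fin by auto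
  qed
  have "k * \<Phi> s v u \<le> \<Phi> s v (u @ [e]) \<and> \<Phi> s v (u @ [e]) \<le> K * \<Phi> s v u"
    if u: "walk v u" and e: "e \<in> out (endp v u)" for v u e
  proof -
    have we: "walk (endp v u) [e]" "walk v (u @ [e])" using u e by (auto dest: arc_facts)
    have lo: "k * axis_weight s v b u \<le> axis_weight s v b (u @ [e])" and hi: "axis_weight s v b (u @ [e]) \<le> K * axis_weight s v b u" for b
    proof -
      have "axis_weight s v b u * k \<le> axis_weight s v b u * axis_weight s (endp v u) (b = diag u) [e]"
        "axis_weight s v b u * axis_weight s (endp v u) (b = diag u) [e] \<le> axis_weight s v b u * K"
        using kK[OF e] axis_weight_pos[OF u] by (intro mult_left_mono; simp add: less_imp_le)+
      then show "k * axis_weight s v b u \<le> axis_weight s v b (u @ [e])" "axis_weight s v b (u @ [e]) \<le> K * axis_weight s v b u"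
        unfolding axis_weight_append[OF u we(1)] by (simp_all add: mult.commute)
    qed
    show ?thesis
    proof (cases "s \<le> \<theta>")
      case True
      have "k * \<Phi> s v u \<le> \<Phi> s v (u @ [e])"
        using lo[of "wide u"] axis_weight_le_\<Phi>[OF we(2) True, of "wide u"] unfolding \<Phi>_def[of s v u] by linarith
      moreover have "\<Phi> s v (u @ [e]) \<le> K * \<Phi> s v u"
        using hi[of "wide (u @ [e])"] mult_left_mono[OF axis_weight_le_\<Phi>[OF u True, of "wide (u @ [e])"], of K] K0
        unfolding \<Phi>_def[of s v "u @ [e]"] by linarith
      ultimately show ?thesis ..
    next
      case False
      then have s: "s \<ge> \<theta>" by simp
      have "\<Phi> s v (u @ [e]) \<le> K * \<Phi> s v u"
        using hi[of "wide u"] \<Phi>_le_axis_weight[OF we(2) s, of "wide u"] unfolding \<Phi>_def[of s v u] by linarith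
      moreover have "k * \<Phi> s v u \<le> \<Phi> s v (u @ [e])"
        using lo[of "wide (u @ [e])"] mult_left_mono[OF \<Phi>_le_axis_weight[OF u s, of "wide (u @ [e])"], of k] k0
        unfolding \<Phi>_def[of s v "u @ [e]"] by linarith
      ultimately show ?thesis by blast
    qed
  qed
  then show ?thesis using that[OF k0 K0] by blast
qed

section \<open>The pressure\<close>

definition path_sum :: "real \<Rightarrow> nat \<Rightarrow> 'v \<Rightarrow> real" where
  "path_sum s n v = (\<Sum>w\<in>paths n v. \<Phi> s v w)"

definition total_sum :: "real \<Rightarrow> nat \<Rightarrow> real" where
  "total_sum s n = (\<Sum>v\<in>verts G. path_sum s n v)"

lemma paths_nonempty: "v \<in> verts G \<Longrightarrow> paths n v \<noteq> {}"
proof (induction n arbitrary: v)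
  case (Suc n)
  then obtain e where "e \<in> out v" using out_nonempty by blast
  then show ?case using Suc.IH[of "hd_of e"] arc_facts(4) unfolding paths_Suc by blast
qed (simp add: paths_0)

lemma paths_walk: "w \<in> paths n v \<Longrightarrow> walk v w"
  by (simp add: paths_def)

lemma path_sum_pos: "v \<in> verts G \<Longrightarrow> path_sum s n v > 0"
  unfolding path_sum_def using finite_paths paths_nonempty by (intro sum_pos) (auto intro: \<Phi>_pos paths_walk)

lemma path_sum_le_total_sum: "v \<in> verts G \<Longrightarrow> path_sum s n v \<le> total_sum s n"
  unfolding total_sum_def using path_sum_pos by (intro member_le_sum) (auto intro: less_imp_le)

lemma total_sum_pos: "total_sum s n > 0"
  using verts_nonempty path_sum_pos path_sum_le_total_sum by (metis all_not_in_conv order_less_le_trans)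

lemma path_sum_Suc_bounds:
  obtains k K where "0 < k" "0 < K" "\<And>v n. v \<in> verts G \<Longrightarrow> k * path_sum s n v \<le> path_sum s (Suc n) v \<and> path_sum s (Suc n) v \<le> K * path_sum s n v"
proof -
  obtain k K where kK: "0 < k" "0 < K" "\<And>v u e. walk v u \<Longrightarrow> e \<in> out (endp v u) \<Longrightarrow>
    k * \<Phi> s v u \<le> \<Phi> s v (u @ [e]) \<and> \<Phi> s v (u @ [e]) \<le> K * \<Phi> s v u"
    using \<Phi>_snoc[of s] by blast
  define N where "N = real (card (arcs G))"
  have "arcs G \<noteq> {}" using verts_nonempty out_nonempty arc_facts(1) by blast
  then have N0: "N > 0" by (simp add: N_def card_gt_0_iff)
  have "k * path_sum s n v \<le> path_sum s (Suc n) v \<and> path_sum s (Suc n) v \<le> (K * N) * path_sum s n v" if v: "v \<in> verts G" for v n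
  proof -
    have eq: "path_sum s (Suc n) v = (\<Sum>w\<in>paths n v. \<Sum>e\<in>out (endp v w). \<Phi> s v (w @ [e]))"
    proof -
      have p1: "paths 1 v' = (\<lambda>e. [e]) ` out v'" for v' by (auto simp: paths_1 simp del: One_nat_def)
      have "path_sum s (n + 1) v = (\<Sum>w\<in>paths n v. \<Sum>u\<in>paths 1 (endp v w). \<Phi> s v (w @ u))"
        unfolding path_sum_def by (rule sum_paths_add[OF v])
      then show ?thesis unfolding p1 by (simp add: sum.reindex inj_on_def)
    qed
    have lo: "k * \<Phi> s v w \<le> (\<Sum>e\<in>out (endp v w). \<Phi> s v (w @ [e]))" if w: "w \<in> paths n v" for w
    proof -
      have ww: "walk v w" using w by (rule paths_walk)
      obtain e where e: "e \<in> out (endp v w)" using out_nonempty walk_verts(2)[OF ww] by blast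
      have "\<Phi> s v (w @ [e']) \<ge> 0" if "e' \<in> out (endp v w)" for e'
        using that ww by (intro less_imp_le \<Phi>_pos) (auto dest: arc_facts)
      then have "\<Phi> s v (w @ [e]) \<le> (\<Sum>e\<in>out (endp v w). \<Phi> s v (w @ [e]))"
        using e finite_out by (intro member_le_sum) auto
      then show ?thesis using kK(3)[OF ww e] by linarith
    qed
    have hi: "(\<Sum>e\<in>out (endp v w). \<Phi> s v (w @ [e])) \<le> K * N * \<Phi> s v w" if w: "w \<in> paths n v" for w
    proof -
      have ww: "walk v w" using w by (rule paths_walk)
      have "(\<Sum>e\<in>out (endp v w). \<Phi> s v (w @ [e])) \<le> (\<Sum>e\<in>out (endp v w). K * \<Phi> s v w)"
        using kK(3)[OF ww] by (intro sum_mono) blast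
      also have "\<dots> = real (card (out (endp v w))) * (K * \<Phi> s v w)" by simp
      also have "\<dots> \<le> N * (K * \<Phi> s v w)"
      proof (intro mult_right_mono)
        have "card (out (endp v w)) \<le> card (arcs G)" using arc_facts(1) by (intro card_mono) auto
        then show "real (card (out (endp v w))) \<le> N" by (simp add: N_def)
        show "0 \<le> K * \<Phi> s v w" using kK(2) \<Phi>_pos[OF ww, of s] by simp
      qed
      finally show ?thesis by (simp add: mult_ac)
    qed
    show ?thesis unfolding eq unfolding path_sum_def sum_distrib_left using lo hi by (auto intro!: sum_mono)
  qed
  then show ?thesis using that[OF kK(1), of "K * N"] kK(2) N0 by simp
qed

lemma total_sum_growth:
  obtains B D where "\<And>n. ln (total_sum s n) \<le> B * real n + D" "\<And>n. - B * real n - D \<le> ln (total_sum s n)"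
proof -
  obtain k K where kK: "0 < k" "0 < K" "\<And>v n. v \<in> verts G \<Longrightarrow> k * path_sum s n v \<le> path_sum s (Suc n) v \<and> path_sum s (Suc n) v \<le> K * path_sum s n v"
    using path_sum_Suc_bounds[of s] by blast
  have step: "k * total_sum s n \<le> total_sum s (Suc n)" "total_sum s (Suc n) \<le> K * total_sum s n" for n
    unfolding total_sum_def sum_distrib_left using kK(3) by (auto intro!: sum_mono)
  have ln_step: "ln k + ln (total_sum s n) \<le> ln (total_sum s (Suc n))" "ln (total_sum s (Suc n)) \<le> ln K + ln (total_sum s n)" for n
  proof -
    have "ln (k * total_sum s n) \<le> ln (total_sum s (Suc n))" "ln (total_sum s (Suc n)) \<le> ln (K * total_sum s n)"
      using step[of n] kK(1,2) total_sum_pos[of s n] total_sum_pos[of s "Suc n"] by (subst ln_le_cancel_iff; simp)+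
    then show "ln k + ln (total_sum s n) \<le> ln (total_sum s (Suc n))" "ln (total_sum s (Suc n)) \<le> ln K + ln (total_sum s n)"
      using kK(1,2) total_sum_pos[of s n] by (simp_all add: ln_mult)
  qed
  have iter: "ln k * real n + ln (total_sum s 0) \<le> ln (total_sum s n) \<and> ln (total_sum s n) \<le> ln K * real n + ln (total_sum s 0)" for n
  proof (induction n)
    case (Suc n)
    then show ?case using ln_step[of n] by (simp add: algebra_simps)
  qed simp
  define B where "B = max \<bar>ln k\<bar> \<bar>ln K\<bar>"
  show ?thesis
  proof (rule that[of B "\<bar>ln (total_sum s 0)\<bar>"])
    fix n
    have "ln K * real n \<le> B * real n" "- B * real n \<le> ln k * real n"
      by (intro mult_right_mono; auto simp: B_def)+
    then show "ln (total_sum s n) \<le> B * real n + \<bar>ln (total_sum s 0)\<bar>" "- B * real n - \<bar>ln (total_sum s 0)\<bar> \<le> ln (total_sum s n)"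
      using iter[of n] by linarith+
  qed
qed

lemma total_sum_submult:
  assumes s: "s \<le> \<theta>"
  shows "total_sum s (m + n) \<le> total_sum s m * total_sum s n"
proof -
  have "path_sum s (m + n) v \<le> path_sum s m v * total_sum s n" if v: "v \<in> verts G" for v
  proof -
    have "path_sum s (m + n) v = (\<Sum>w\<in>paths m v. \<Sum>u\<in>paths n (endp v w). \<Phi> s v (w @ u))"
      unfolding path_sum_def by (rule sum_paths_add[OF v])
    also have "\<dots> \<le> (\<Sum>w\<in>paths m v. \<Sum>u\<in>paths n (endp v w). \<Phi> s v w * \<Phi> s (endp v w) u)"
      using s by (intro sum_mono \<Phi>_submult) (auto dest: paths_walk)
    also have "\<dots> = (\<Sum>w\<in>paths m v. \<Phi> s v w * path_sum s n (endp v w))"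
      by (simp add: path_sum_def sum_distrib_left)
    also have "\<dots> \<le> (\<Sum>w\<in>paths m v. \<Phi> s v w * total_sum s n)"
      by (intro sum_mono mult_left_mono path_sum_le_total_sum less_imp_le[OF \<Phi>_pos]) (auto dest: paths_walk walk_verts)
    also have "\<dots> = path_sum s m v * total_sum s n" by (simp add: path_sum_def sum_distrib_right)
    finally show ?thesis .
  qed
  then have "total_sum s (m + n) \<le> (\<Sum>v\<in>verts G. path_sum s m v * total_sum s n)" unfolding total_sum_def[of s "m + n"] by (intro sum_mono)
  then show ?thesis by (simp add: total_sum_def[of s m] sum_distrib_right)
qed

text \<open>
  Supermultiplicativity alone bounds sums over composable words only. A connecting word makes the
  walks from any two vertices comparable, and its length is undone by the bounded effect of
  single letters.
\<close>

lemma path_sum_ge_total_sum: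
  assumes s: "s \<ge> \<theta>"
  obtains c where "c > 0" "\<And>v n. v \<in> verts G \<Longrightarrow> c * total_sum s n \<le> path_sum s n v"
proof -
  obtain k K where kK: "0 < k" "0 < K" "\<And>v n. v \<in> verts G \<Longrightarrow> k * path_sum s n v \<le> path_sum s (Suc n) v \<and> path_sum s (Suc n) v \<le> K * path_sum s n v"
    using path_sum_Suc_bounds[of s] by blast
  have iter: "path_sum s (j + n) v \<le> K ^ j * path_sum s n v" if "v \<in> verts G" for v n j
  proof (induction j)
    case (Suc j)
    have "path_sum s (Suc (j + n)) v \<le> K * path_sum s (j + n) v" using kK(3)[OF that] by blast
    also have "\<dots> \<le> K * (K ^ j * path_sum s n v)" using Suc kK(2) by (intro mult_left_mono) auto
    finally show ?case by (simp add: mult_ac)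
  qed simp
  have "\<exists>c>0. \<forall>n. c * path_sum s n (snd x) \<le> path_sum s n (fst x)" if x: "x \<in> verts G \<times> verts G" for x
  proof -
    obtain v v' where vv: "x = (v, v')" "v \<in> verts G" "v' \<in> verts G" using x by auto
    obtain u where u: "walk v u" "endp v u = v'" using connecting_walk[OF vv(2,3)] .
    define c where "c = \<Phi> s v u / K ^ length u"
    have "c * path_sum s n v' \<le> path_sum s n v" for n
    proof -
      have "\<Phi> s v u * path_sum s n v' = (\<Sum>w\<in>paths n (endp v u). \<Phi> s v u * \<Phi> s (endp v u) w)"
        by (simp add: path_sum_def u(2) sum_distrib_left)
      also have "\<dots> \<le> (\<Sum>w\<in>paths n (endp v u). \<Phi> s v (u @ w))"
        using u s by (intro sum_mono \<Phi>_supermult) (auto dest: paths_walk)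
      also have "\<dots> \<le> (\<Sum>y\<in>paths (length u) v. \<Sum>w\<in>paths n (endp v y). \<Phi> s v (y @ w))"
        using u by (intro member_le_sum[of u] finite_paths)
          (auto simp: paths_def intro!: sum_nonneg less_imp_le[OF \<Phi>_pos])
      also have "\<dots> = path_sum s (length u + n) v" unfolding path_sum_def by (rule sum_paths_add[OF vv(2), symmetric])
      also have "\<dots> \<le> K ^ length u * path_sum s n v" by (rule iter[OF vv(2)])
      finally show ?thesis using kK(2) by (simp add: c_def field_simps)
    qed
    moreover have "c > 0" using \<Phi>_pos[OF u(1)] kK(2) by (simp add: c_def)
    ultimately show ?thesis using vv by auto
  qed
  then obtain C where C: "\<And>x. x \<in> verts G \<times> verts G \<Longrightarrow> C x > 0 \<and> (\<forall>n. C x * path_sum s n (snd x) \<le> path_sum s n (fst x))"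
    by metis
  define c where "c = Min (C ` (verts G \<times> verts G))"
  have fin: "finite (C ` (verts G \<times> verts G))" "C ` (verts G \<times> verts G) \<noteq> {}" using verts_nonempty by auto
  have c0: "c > 0" unfolding c_def using fin C by (subst Min_gr_iff) auto
  define V where "V = real (card (verts G))"
  have V0: "V > 0" using verts_nonempty by (simp add: V_def card_gt_0_iff)
  have "c / V * total_sum s n \<le> path_sum s n v" if v: "v \<in> verts G" for v n
  proof -
    have "c * total_sum s n = (\<Sum>v'\<in>verts G. c * path_sum s n v')" by (simp add: total_sum_def sum_distrib_left)
    also have "\<dots> \<le> (\<Sum>v'\<in>verts G. path_sum s n v)"
    proof (rule sum_mono)
      fix v' assume v': "v' \<in> verts G"
      have "c \<le> C (v, v')" unfolding c_def using fin v v' by (intro Min_le) auto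
      then have "c * path_sum s n v' \<le> C (v, v') * path_sum s n v'" using path_sum_pos[OF v', of s n] by (intro mult_right_mono) auto
      also have "\<dots> \<le> path_sum s n v" using C[of "(v, v')"] v v' by auto
      finally show "c * path_sum s n v' \<le> path_sum s n v" .
    qed
    also have "\<dots> = V * path_sum s n v" by (simp add: V_def)
    finally show ?thesis using V0 by (simp add: field_simps)
  qed
  then show ?thesis using that[of "c / V"] c0 V0 by simp
qed

lemma total_sum_supermult:
  assumes s: "s \<ge> \<theta>"
  obtains c where "c > 0" "\<And>m n. c * total_sum s m * total_sum s n \<le> total_sum s (m + n)"
proof -
  obtain c where c: "c > 0" "\<And>v n. v \<in> verts G \<Longrightarrow> c * total_sum s n \<le> path_sum s n v" using path_sum_ge_total_sum[OF s] by blast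
  have "c * total_sum s m * total_sum s n \<le> total_sum s (m + n)" for m n
  proof -
    have "path_sum s m v * (c * total_sum s n) \<le> path_sum s (m + n) v" if v: "v \<in> verts G" for v
    proof -
      have "path_sum s m v * (c * total_sum s n) = (\<Sum>w\<in>paths m v. \<Phi> s v w * (c * total_sum s n))" by (simp add: path_sum_def sum_distrib_right)
      also have "\<dots> \<le> (\<Sum>w\<in>paths m v. \<Phi> s v w * path_sum s n (endp v w))"
        by (intro sum_mono mult_left_mono c(2) less_imp_le[OF \<Phi>_pos]) (auto dest: paths_walk walk_verts)
      also have "\<dots> = (\<Sum>w\<in>paths m v. \<Sum>u\<in>paths n (endp v w). \<Phi> s v w * \<Phi> s (endp v w) u)"
        by (simp add: path_sum_def sum_distrib_left)
      also have "\<dots> \<le> (\<Sum>w\<in>paths m v. \<Sum>u\<in>paths n (endp v w). \<Phi> s v (w @ u))"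
        using s by (intro sum_mono \<Phi>_supermult) (auto dest: paths_walk)
      also have "\<dots> = path_sum s (m + n) v" unfolding path_sum_def by (rule sum_paths_add[OF v, symmetric])
      finally show ?thesis .
    qed
    then have "(\<Sum>v\<in>verts G. path_sum s m v * (c * total_sum s n)) \<le> total_sum s (m + n)" unfolding total_sum_def[of s "m + n"] by (intro sum_mono)
    then show ?thesis unfolding sum_distrib_right[symmetric] total_sum_def[of s m, symmetric] by (simp add: mult_ac)
  qed
  then show ?thesis using that c(1) by blast
qed

lemma total_sum_limit: "\<exists>l. (\<lambda>n. ln (total_sum s n) / real n) \<longlonglongrightarrow> l"
proof -
  obtain B D where BD: "\<And>n. ln (total_sum s n) \<le> B * real n + D" "\<And>n. - B * real n - D \<le> ln (total_sum s n)"
    using total_sum_growth[of s] by blast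
  show ?thesis
  proof (cases "s \<le> \<theta>")
    case True
    show ?thesis
    proof (rule limit_of_quasi_subadditive)
      fix m n
      have "ln (total_sum s (m + n)) \<le> ln (total_sum s m * total_sum s n)"
        using total_sum_submult[OF True, of m n] total_sum_pos by (subst ln_le_cancel_iff) auto
      then show "ln (total_sum s (m + n)) \<le> ln (total_sum s m) + ln (total_sum s n) + 0" using total_sum_pos[of s m] total_sum_pos[of s n] by (simp add: ln_mult)
    qed (rule BD(2))
  next
    case False
    then have s: "s \<ge> \<theta>" by simp
    obtain c where c: "c > 0" "\<And>m n. c * total_sum s m * total_sum s n \<le> total_sum s (m + n)" using total_sum_supermult[OF s] by blast
    show ?thesis
    proof (rule limit_of_quasi_superadditive)
      fix m n
      have "ln (c * total_sum s m * total_sum s n) \<le> ln (total_sum s (m + n))"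
        using c(2)[of m n] c(1) total_sum_pos by (subst ln_le_cancel_iff) auto
      then show "ln (total_sum s (m + n)) \<ge> ln (total_sum s m) + ln (total_sum s n) - (- ln c)"
        using total_sum_pos[of s m] total_sum_pos[of s n] c(1) by (simp add: ln_mult)
    qed (rule BD(1))
  qed
qed

definition log_pressure :: "real \<Rightarrow> real" where "log_pressure s = lim (\<lambda>n. ln (total_sum s n) / real n)"

lemma log_pressure_lim: "(\<lambda>n. ln (total_sum s n) / real n) \<longlonglongrightarrow> log_pressure s"
proof -
  obtain l where l: "(\<lambda>n. ln (total_sum s n) / real n) \<longlonglongrightarrow> l" using total_sum_limit by blast
  then show ?thesis using limI[OF l] by (simp add: log_pressure_def)
qed

lemma \<Phi>_shift: "\<Phi> (s + d) v w = \<Phi> s v w * short_side w powr d"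
  by (simp add: \<Phi>_alt powr_add[symmetric] add_diff_eq algebra_simps)

text \<open>
  Raising \<open>s\<close> by \<open>d\<close> multiplies the weight of a word by \<open>short_side w powr d\<close>, which is exponentially
  small in the length of the word.
\<close>

lemma log_pressure_shift:
  assumes d: "d \<ge> 0"
  shows "log_pressure s + d * ln min_ratio \<le> log_pressure (s + d)" "log_pressure (s + d) \<le> log_pressure s + d * ln max_ratio"
proof -
  have b: "(min_ratio ^ n) powr d * total_sum s n \<le> total_sum (s + d) n \<and> total_sum (s + d) n \<le> (max_ratio ^ n) powr d * total_sum s n" for n
  proof -
    have "(min_ratio ^ n) powr d * \<Phi> s v w \<le> \<Phi> (s + d) v w \<and> \<Phi> (s + d) v w \<le> (max_ratio ^ n) powr d * \<Phi> s v w"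
      if w: "w \<in> paths n v" for v w
    proof -
      have ww: "walk v w" "length w = n" using w by (auto simp: paths_def)
      have "min_ratio ^ n \<le> short_side w" "short_side w \<le> max_ratio ^ n" using short_side_bounds[OF ww(1)] ww(2) by auto
      then have "(min_ratio ^ n) powr d \<le> short_side w powr d" "short_side w powr d \<le> (max_ratio ^ n) powr d"
        using min_ratio(1) sides_pos(2)[OF ww(1)] d by (intro powr_mono2; simp)+
      then show ?thesis unfolding \<Phi>_shift using \<Phi>_pos[OF ww(1), of s]
        by (simp add: mult.commute mult_right_mono)
    qed
    then show ?thesis unfolding total_sum_def path_sum_def sum_distrib_left by (auto intro!: sum_mono)
  qed
  have ln_b: "ln (total_sum s n) / real n + d * ln min_ratio \<le> ln (total_sum (s + d) n) / real n"
    "ln (total_sum (s + d) n) / real n \<le> ln (total_sum s n) / real n + d * ln max_ratio" if n: "n \<ge> 1" for n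
  proof -
    have p: "(min_ratio ^ n) powr d > 0" "(max_ratio ^ n) powr d > 0" using min_ratio max_ratio by auto
    have "ln ((min_ratio ^ n) powr d * total_sum s n) \<le> ln (total_sum (s + d) n)" "ln (total_sum (s + d) n) \<le> ln ((max_ratio ^ n) powr d * total_sum s n)"
      using b[of n] p total_sum_pos by (subst ln_le_cancel_iff; simp)+
    moreover have "ln ((a ^ n) powr d * total_sum s n) = d * ln a * real n + ln (total_sum s n)" if "a > 0" for a
      using that total_sum_pos[of s n] by (simp add: ln_mult ln_powr ln_realpow)
    ultimately have e: "d * ln min_ratio * real n + ln (total_sum s n) \<le> ln (total_sum (s + d) n)" "ln (total_sum (s + d) n) \<le> d * ln max_ratio * real n + ln (total_sum s n)"
      using min_ratio max_ratio by auto
    then show "ln (total_sum s n) / real n + d * ln min_ratio \<le> ln (total_sum (s + d) n) / real n"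
      "ln (total_sum (s + d) n) / real n \<le> ln (total_sum s n) / real n + d * ln max_ratio"
    proof -
      have "(d * ln a * real n + ln (total_sum s n)) / real n = ln (total_sum s n) / real n + d * ln a" for a
        using n by (simp add: add_divide_distrib)
      then show "ln (total_sum s n) / real n + d * ln min_ratio \<le> ln (total_sum (s + d) n) / real n"
        "ln (total_sum (s + d) n) / real n \<le> ln (total_sum s n) / real n + d * ln max_ratio"
        using divide_right_mono[OF e(1), of "real n"] divide_right_mono[OF e(2), of "real n"] by simp_all
    qed
  qed
  show "log_pressure s + d * ln min_ratio \<le> log_pressure (s + d)"
    using ln_b(1) by (intro LIMSEQ_le[OF tendsto_add[OF log_pressure_lim tendsto_const] log_pressure_lim]) blast
  show "log_pressure (s + d) \<le> log_pressure s + d * ln max_ratio"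
    using ln_b(2) by (intro LIMSEQ_le[OF log_pressure_lim tendsto_add[OF log_pressure_lim tendsto_const]]) blast
qed

lemma log_pressure_strict_decreasing:
  assumes "s < s'"
  shows "log_pressure s' < log_pressure s"
proof -
  have "log_pressure s' \<le> log_pressure s + (s' - s) * ln max_ratio" using log_pressure_shift(2)[of "s' - s" s] assms by simp
  moreover have "(s' - s) * ln max_ratio < 0" using assms max_ratio by (intro mult_pos_neg) auto
  ultimately show ?thesis by linarith
qed

lemma log_pressure_continuous: "isCont log_pressure s"
proof -
  have lip: "\<bar>log_pressure x - log_pressure y\<bar> \<le> (- ln min_ratio) * \<bar>x - y\<bar>" for x y
  proof -
    have "\<bar>log_pressure x - log_pressure y\<bar> \<le> (- ln min_ratio) * \<bar>x - y\<bar>" if "x \<le> y" for x y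
      using log_pressure_shift(1)[of "y - x" x] log_pressure_strict_decreasing[of x y] that
      by (cases "x = y") (auto simp: algebra_simps)
    from this[of x y] this[of y x] show ?thesis by (cases "x \<le> y") (auto simp: abs_minus_commute)
  qed
  have "((\<lambda>x. log_pressure x - log_pressure s) \<longlongrightarrow> 0) (at s)"
  proof (rule Lim_null_comparison)
    show "eventually (\<lambda>x. norm (log_pressure x - log_pressure s) \<le> (- ln min_ratio) * \<bar>x - s\<bar>) (at s)" using lip by auto
    show "((\<lambda>x. (- ln min_ratio) * \<bar>x - s\<bar>) \<longlongrightarrow> 0) (at s)" by (auto intro!: tendsto_eq_intros)
  qed
  then show ?thesis unfolding isCont_def using LIM_zero_cancel by blast
qed

text \<open>
  The shift estimate makes the function Lipschitz continuous and decreasing at a rate bounded from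
  below, so that it takes both signs.
\<close>

lemma log_pressure_zero: "\<exists>!s. log_pressure s = 0"
proof -
  have am: "ln max_ratio < 0" using max_ratio by simp
  \<comment> \<open>At distance \<open>x\<close> from \<open>0\<close> the guaranteed decrease outweighs the value at \<open>0\<close>.\<close>
  define x where "x = \<bar>log_pressure 0\<bar> / (- ln max_ratio)"
  have x0: "x \<ge> 0" using am by (simp add: x_def divide_nonneg_neg)
  have xl: "x * ln max_ratio = - \<bar>log_pressure 0\<bar>" using am by (simp add: x_def)
  have "log_pressure x \<le> 0" using log_pressure_shift(2)[OF x0, of 0] xl by simp
  moreover have "0 \<le> log_pressure (- x)" using log_pressure_shift(2)[OF x0, of "- x"] xl by simp
  ultimately obtain s where "log_pressure s = 0"
    using IVT2[of log_pressure x 0 "- x"] x0 log_pressure_continuous by auto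
  then show ?thesis using log_pressure_strict_decreasing by (metis linorder_neqE_linordered_idom less_irrefl)
qed

lemma alpha_eq: "walk v w \<Longrightarrow> alpha1 T w = long_side w" "walk v w \<Longrightarrow> alpha2 T w = short_side w"
proof -
  assume w: "walk v w"
  have sv: "singular_values (word_mat T w) = {ratio w True, ratio w False}"
    unfolding ratio_def by (rule singular_values_axis[OF walk_axis[OF w]])
  show "alpha1 T w = long_side w" "alpha2 T w = short_side w"
    unfolding alpha1_def alpha2_def sv by (cases "wide w"; simp add: long_side_def short_side_def; simp add: wide_def)+
qed

text \<open>
  The projection chosen for \<open>w\<close> at its end is the image under \<open>w\<close> of the axis of the long side, so
  invariance along walks moves the exponent to the initial vertex.
\<close>

lemma word_tau_eq:
  assumes w: "walk v w" "w \<noteq> []"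
  shows "word_tau G T t \<mu> q w = \<tau> v (wide w)"
proof -
  have ax: "axis_matrix (word_mat T w)" by (rule walk_axis[OF w(1)])
  have "word_proj T t w = axis_proj (wide w = diag w)"
    unfolding word_proj_def axis_proj_def rect_width_eq[OF ax] rect_height_eq[OF ax]
      axis_matrix_antidiagonal[OF ax] wide_def ratio_def by auto
  then have "word_tau G T t \<mu> q w = Lq_spectrum (axis_proj (wide w = diag w) (\<mu> (endp v w))) q"
    using w(2) by (simp add: word_tau_def endp_def)
  also have "\<dots> = \<tau> v (wide w)" using walk_verts(2)[OF w(1)] \<tau>_walk[OF w(1)] by (simp add: Lq_spectrum_proj)
  finally show ?thesis .
qed

lemma phi_eq: "walk v w \<Longrightarrow> w \<noteq> [] \<Longrightarrow> phi G T t p \<mu> s q w = \<Phi> s v w"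
  by (simp add: phi_def word_tau_eq alpha_eq \<Phi>_alt)

lemma words_eq: "words G n v v' = {w. w \<in> paths n v \<and> endp v w = v'}"
  by (auto simp: words_def paths_def awalk_iff_walk)

lemma matrix_norm_eq:
  assumes "n \<ge> 1"
  shows "matrix_norm (verts G) (pressure_matrix G T t p \<mu> s q n) = total_sum s n"
proof -
  have pm: "pressure_matrix G T t p \<mu> s q n v v' = (\<Sum>w | w \<in> paths n v \<and> endp v w = v'. \<Phi> s v w)" for v v'
    unfolding pressure_matrix_def words_eq using assms
    by (intro sum.cong refl phi_eq) (auto simp: paths_def)
  have nn: "(\<Sum>w | w \<in> paths n v \<and> endp v w = v'. \<Phi> s v w) \<ge> 0" for v v'
    by (intro sum_nonneg less_imp_le[OF \<Phi>_pos]) (auto dest: paths_walk)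
  have "(\<Sum>v'\<in>verts G. \<Sum>w | w \<in> paths n v \<and> endp v w = v'. \<Phi> s v w) = path_sum s n v" for v
    unfolding path_sum_def by (intro sum.group finite_paths) (auto dest: paths_walk walk_verts)
  then show ?thesis unfolding matrix_norm_def pm total_sum_def abs_of_nonneg[OF nn] by simp
qed

lemma pressure_eq: "pressure G T t p \<mu> s q = exp (log_pressure s)"
proof -
  have "(\<lambda>n. exp (ln (total_sum s n) / real n)) \<longlonglongrightarrow> exp (log_pressure s)" by (intro tendsto_exp log_pressure_lim)
  moreover have "eventually (\<lambda>n. exp (ln (total_sum s n) / real n) = root n (matrix_norm (verts G) (pressure_matrix G T t p \<mu> s q n))) sequentially"
    using eventually_ge_at_top[of 1]
  proof eventually_elim
    case (elim n)
    then show ?case using total_sum_pos[of s n] by (simp add: matrix_norm_eq root_powr_inverse powr_def)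
  qed
  ultimately have "(\<lambda>n. root n (matrix_norm (verts G) (pressure_matrix G T t p \<mu> s q n))) \<longlonglongrightarrow> exp (log_pressure s)"
    by (rule Lim_transform_eventually)
  then show ?thesis unfolding pressure_def by (rule limI)
qed

lemma pressure_unique_root: "\<exists>!s. pressure G T t p \<mu> s q = 1"
  unfolding pressure_eq using log_pressure_zero by simp

lemma log_pressure_gamma: "log_pressure (gamma G T t p \<mu> q) = 0"
  using theI'[OF pressure_unique_root] unfolding gamma_def pressure_eq by simp

section \<open>Weight sums over cuts\<close>

text \<open>
  Above the critical exponent the sum over all words converges, and a cut is a set of words.
\<close>

lemma cut_sum_bounded:
  assumes s: "log_pressure s < 0"
  obtains B where "B > 0" "\<And>v C. cut v C \<Longrightarrow> (\<Sum>w\<in>C. \<Phi> s v w) \<le> B"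
proof -
  define r where "r = exp (log_pressure s / 2)"
  have r: "0 < r" "r < 1" using s by (auto simp: r_def)
  obtain K where K: "\<And>n. \<bar>ln (total_sum s n) - log_pressure s * real n\<bar> \<le> (- log_pressure s / 2) * real n + K"
    using linear_bound_of_limit[OF log_pressure_lim, of "- log_pressure s / 2" s] s by auto
  have le_geometric: "total_sum s n \<le> exp K * r ^ n" for n
  proof -
    have "ln (total_sum s n) \<le> K + real n * (log_pressure s / 2)" 
    proof -
      have "ln (total_sum s n) - log_pressure s * real n \<le> (- log_pressure s / 2) * real n + K" using K[of n] by linarith
      then show ?thesis by (simp add: algebra_simps)
    qed
    then have "exp (ln (total_sum s n)) \<le> exp (K + real n * (log_pressure s / 2))" by simp
    also have "exp (K + real n * (log_pressure s / 2)) = exp K * r ^ n"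
      unfolding r_def by (simp only: exp_add exp_of_nat_mult)
    finally show ?thesis using total_sum_pos[of s n] by simp
  qed
  have sm: "summable (\<lambda>n. exp K * r ^ n)" using r by (intro summable_mult summable_geometric) auto
  define B where "B = (\<Sum>n. exp K * r ^ n)"
  have "(\<Sum>w\<in>C. \<Phi> s v w) \<le> B" if C: "cut v C" for v C
  proof -
    have fin: "finite C" using C cut_finite by blast
    have v: "v \<in> verts G" using C cut_verts by blast
    have "(\<Sum>w\<in>C. \<Phi> s v w) = (\<Sum>n\<in>length ` C. \<Sum>w | w \<in> C \<and> length w = n. \<Phi> s v w)"
      using fin by (intro sum.group[symmetric]) auto
    also have "\<dots> \<le> (\<Sum>n\<in>length ` C. exp K * r ^ n)"
    proof (rule sum_mono)
      fix n
      have "(\<Sum>w | w \<in> C \<and> length w = n. \<Phi> s v w) \<le> path_sum s n v"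
        unfolding path_sum_def using cut_walk[OF C] finite_paths
        by (intro sum_mono2) (auto simp: paths_def intro!: less_imp_le[OF \<Phi>_pos])
      also have "\<dots> \<le> total_sum s n" by (rule path_sum_le_total_sum[OF v])
      also have "\<dots> \<le> exp K * r ^ n" by (rule le_geometric)
      finally show "(\<Sum>w | w \<in> C \<and> length w = n. \<Phi> s v w) \<le> exp K * r ^ n" .
    qed
    also have "\<dots> \<le> B" unfolding B_def using fin r by (intro sum_le_suminf sm) auto
    finally show ?thesis .
  qed
  moreover have "B > 0" unfolding B_def using r by (intro suminf_pos sm) auto
  ultimately show ?thesis using that by blast
qed

lemma stopping_cut_short_side:
  assumes "v \<in> verts G" "0 < \<delta>" "\<delta> \<le> 1"
  obtains C where "cut v C" "\<And>w. w \<in> C \<Longrightarrow> min_ratio * \<delta> < short_side w \<and> short_side w \<le> \<delta>"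
proof -
  have "min_ratio * \<delta> < 1" using mult_left_mono[OF assms(3) less_imp_le[OF min_ratio(1)]] min_ratio(2) by linarith
  moreover have "short_side [] = 1" by (simp add: short_side_def)
  moreover have "min_ratio * short_side u \<le> short_side (u @ w) \<and> short_side (u @ w) \<le> max_ratio * short_side u" if "walk v u" "w \<in> paths 1 (endp v u)" for u w
    using short_side_append[of v u w] that by (auto simp: paths_def)
  ultimately have "\<exists>C. block_cut (paths 1) (endp v []) C \<and> (\<forall>w\<in>C. min_ratio * \<delta> < short_side ([] @ w) \<and> short_side ([] @ w) \<le> \<delta>)"
    using assms min_ratio max_ratio
    by (intro stopping_block_cut[where c = max_ratio]) (auto intro: cut_paths sides_pos simp del: One_nat_def)
  then show ?thesis using that block_cut_cut cut_paths by fastforce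
qed

text \<open>
  Suppose that at every vertex the sum over the cut is below \<open>1\<close>. Long walks factor through the cut,
  so by submultiplicativity and induction the sums over walks of length \<open>n\<close> stay bounded, and
  the pressure is at most \<open>1\<close>.
\<close>

lemma submult_cut_sum:
  assumes s: "s \<le> \<theta>" "log_pressure s > 0" and d: "0 < \<delta>" "\<delta> < 1"
  obtains v C where "cut v C" "\<And>w. w \<in> C \<Longrightarrow> min_ratio * \<delta> < short_side w \<and> short_side w \<le> \<delta>" "(\<Sum>w\<in>C. \<Phi> s v w) \<ge> 1"
proof -
  have "\<exists>C. cut v C \<and> (\<forall>w\<in>C. min_ratio * \<delta> < short_side w \<and> short_side w \<le> \<delta>)" if "v \<in> verts G" for v
    using stopping_cut_short_side[OF that, of \<delta>] d by (metis less_imp_le)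
  then obtain C where C: "\<And>v. v \<in> verts G \<Longrightarrow> cut v (C v)"
    "\<And>v w. v \<in> verts G \<Longrightarrow> w \<in> C v \<Longrightarrow> min_ratio * \<delta> < short_side w \<and> short_side w \<le> \<delta>" by metis
  have "\<exists>v\<in>verts G. (\<Sum>w\<in>C v. \<Phi> s v w) \<ge> 1"
  proof (rule ccontr)
    assume "\<not> ?thesis"
    then have lt: "(\<Sum>w\<in>C v. \<Phi> s v w) \<le> 1" if "v \<in> verts G" for v using that by force
    have "\<exists>L. \<forall>v\<in>verts G. \<forall>w\<in>C v. length w \<le> L"
    proof -
      have "finite (length ` (\<Union>v\<in>verts G. C v))" using C(1) cut_finite by (intro finite_imageI finite_UN_I) auto
      then show ?thesis by (auto simp: finite_nat_set_iff_bounded_le)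
    qed
    then obtain L where L: "\<And>v w. v \<in> verts G \<Longrightarrow> w \<in> C v \<Longrightarrow> length w \<le> L" by blast
    have ne: "w \<noteq> []" if "v \<in> verts G" "w \<in> C v" for v w using C(2)[OF that] d by (auto simp: short_side_def)
    \<comment> \<open>\<open>K\<close> covers the walks too short to pass through the cut.\<close>
    define K where "K = (\<Sum>n\<le>L. total_sum s n)"
    have K0: "K > 0" unfolding K_def using total_sum_pos by (intro sum_pos) auto
    have K: "path_sum s n v \<le> K" if "v \<in> verts G" for n v
      using that
    proof (induction n arbitrary: v rule: less_induct)
      case (less n)
      show ?case
      proof (cases "n \<le> L")
        case True
        have "path_sum s n v \<le> total_sum s n" by (rule path_sum_le_total_sum[OF less.prems])
        also have "\<dots> \<le> K" unfolding K_def using True total_sum_pos by (intro member_le_sum) (auto intro: less_imp_le)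
        finally show ?thesis .
      next
        case False
        have w: "walk v w" "endp v w \<in> verts G" if "w \<in> C v" for w
          using cut_walk[OF C(1)[OF less.prems] that] walk_verts by blast+
        have "path_sum s n v = (\<Sum>w\<in>C v. \<Sum>u\<in>paths (n - length w) (endp v w). \<Phi> s v (w @ u))"
          unfolding path_sum_def using L[OF less.prems] False by (intro sum_paths_factor_cut C less.prems) force
        also have "\<dots> \<le> (\<Sum>w\<in>C v. \<Sum>u\<in>paths (n - length w) (endp v w). \<Phi> s v w * \<Phi> s (endp v w) u)"
          using s w by (intro sum_mono \<Phi>_submult) (auto dest: paths_walk)
        also have "\<dots> = (\<Sum>w\<in>C v. \<Phi> s v w * path_sum s (n - length w) (endp v w))"
          by (simp add: path_sum_def sum_distrib_left)
        also have "\<dots> \<le> (\<Sum>w\<in>C v. \<Phi> s v w * K)"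
        proof (intro sum_mono mult_left_mono)
          fix u assume u: "u \<in> C v"
          show "path_sum s (n - length u) (endp v u) \<le> K"
            using w[OF u] ne[OF less.prems u] False by (intro less.IH) auto
          show "0 \<le> \<Phi> s v u" using \<Phi>_pos[OF w(1)[OF u]] by (rule less_imp_le)
        qed
        also have "\<dots> = (\<Sum>w\<in>C v. \<Phi> s v w) * K" by (simp add: sum_distrib_right)
        also have "\<dots> \<le> 1 * K"
          using lt[OF less.prems] K0 by (intro mult_right_mono) auto
        finally show ?thesis by simp
      qed
    qed
    define V where "V = real (card (verts G))"
    have V0: "V > 0" using verts_nonempty by (simp add: V_def card_gt_0_iff)
    have "ln (total_sum s n) \<le> ln (V * K)" for n
    proof -
      have "total_sum s n \<le> (\<Sum>v\<in>verts G. K)" unfolding total_sum_def by (intro sum_mono K)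
      then have "total_sum s n \<le> V * K" by (simp add: V_def)
      then show ?thesis using total_sum_pos V0 K0 by (subst ln_le_cancel_iff) auto
    qed
    then have "ln (total_sum s n) / real n \<le> ln (V * K) / real n" for n by (intro divide_right_mono) auto
    then have "log_pressure s \<le> 0"
      by (intro LIMSEQ_le[OF log_pressure_lim lim_const_over_n[of "ln (V * K)"]]) auto
    then show False using s by simp
  qed
  then obtain v where v: "v \<in> verts G" "(\<Sum>w\<in>C v. \<Phi> s v w) \<ge> 1" by blast
  show ?thesis using that[OF C(1)[OF v(1)] C(2)[OF v(1)] v(2)] by blast
qed

lemma block_cut_sum_ge_1:
  assumes s: "s \<ge> \<theta>" and B: "\<And>v. v \<in> verts G \<Longrightarrow> cut v (B v) \<and> (\<Sum>w\<in>B v. \<Phi> s v w) \<ge> 1"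
    and C: "block_cut B v C"
  shows "(\<Sum>w\<in>C. \<Phi> s v w) \<ge> 1"
  using C
proof (induction rule: block_cut.induct)
  case (block_step v C)
  have c: "cut (endp v w) (C w)" if "w \<in> B v" for w
    using block_cut_cut[OF block_step.hyps(2)[OF that]] B by blast
  have w: "walk v w" if "w \<in> B v" for w using cut_walk B block_step.hyps(1) that by blast
  have "1 \<le> (\<Sum>w\<in>B v. \<Phi> s v w * 1)" using B[OF block_step.hyps(1)] by simp
  also have "\<dots> \<le> (\<Sum>w\<in>B v. \<Phi> s v w * (\<Sum>u\<in>C w. \<Phi> s (endp v w) u))"
    using block_step.IH w by (intro sum_mono mult_left_mono less_imp_le[OF \<Phi>_pos]) auto
  also have "\<dots> = (\<Sum>w\<in>B v. \<Sum>u\<in>C w. \<Phi> s v w * \<Phi> s (endp v w) u)" by (simp add: sum_distrib_left)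
  also have "\<dots> \<le> (\<Sum>w\<in>B v. \<Sum>u\<in>C w. \<Phi> s v (w @ u))"
    using s w c by (intro sum_mono \<Phi>_supermult) (auto intro: cut_walk)
  also have "\<dots> = (\<Sum>u\<in>(\<Union>w\<in>B v. (@) w ` C w). \<Phi> s v u)"
    using B[OF block_step.hyps(1)] c by (intro cut_append(2)[symmetric]) auto
  finally show ?case .
qed simp

text \<open>
  Positive \<open>log_pressure\<close> yields a length \<open>n\<close> for which the weights of the walks from each vertex sum
  up to at least \<open>1\<close>. Stopping in blocks of length \<open>n\<close> keeps the sum at least \<open>1\<close> by
  supermultiplicativity. The stopping constant \<open>a\<close> then depends on \<open>n\<close>, hence on \<open>s\<close>, but not on \<open>\<delta>\<close>.
\<close>

lemma supermult_cut_sum: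
  assumes s: "s \<ge> \<theta>" "log_pressure s > 0"
  obtains a where "0 < a" "a \<le> 1" "\<And>\<delta>. 0 < \<delta> \<Longrightarrow> \<delta> < 1 \<Longrightarrow>
    \<exists>v C. cut v C \<and> (\<forall>w\<in>C. a * \<delta> < short_side w \<and> short_side w \<le> \<delta>) \<and> (\<Sum>w\<in>C. \<Phi> s v w) \<ge> 1"
proof -
  obtain c where c: "c > 0" "\<And>v n. v \<in> verts G \<Longrightarrow> c * total_sum s n \<le> path_sum s n v" using path_sum_ge_total_sum[OF s(1)] by blast
  have "\<exists>n\<ge>1. c * total_sum s n \<ge> 1"
  proof -
    obtain K where K: "\<And>n. \<bar>ln (total_sum s n) - log_pressure s * real n\<bar> \<le> (log_pressure s / 2) * real n + K"
      using linear_bound_of_limit[OF log_pressure_lim, of "log_pressure s / 2" s] s by auto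
    obtain n :: nat where n: "real n \<ge> (K - ln c) / (log_pressure s / 2)" using real_arch_simple by blast
    define m where "m = max n 1"
    have "real m \<ge> (K - ln c) / (log_pressure s / 2)" using n by (simp add: m_def)
    then have "real m * (log_pressure s / 2) \<ge> K - ln c" using s by (subst (asm) pos_divide_le_eq) auto
    moreover have "- ((log_pressure s / 2) * real m + K) \<le> ln (total_sum s m) - log_pressure s * real m" using K[of m] by linarith
    ultimately have "ln (total_sum s m) \<ge> - ln c" by (simp add: algebra_simps)
    then have "ln (c * total_sum s m) \<ge> ln 1" using c total_sum_pos[of s m] by (simp add: ln_mult)
    then have "c * total_sum s m \<ge> 1" using c total_sum_pos[of s m] by (subst (asm) ln_le_cancel_iff) auto
    then show ?thesis by (intro exI[of _ m]) (simp add: m_def)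
  qed
  then obtain n where n: "n \<ge> 1" "c * total_sum s n \<ge> 1" by blast
  have B: "cut v (paths n v) \<and> (\<Sum>w\<in>paths n v. \<Phi> s v w) \<ge> 1" if "v \<in> verts G" for v
    using cut_paths[OF that] c(2)[OF that, of n] n by (auto simp: path_sum_def)
  have an: "0 < min_ratio ^ n" "min_ratio ^ n < 1" "0 < max_ratio ^ n" "max_ratio ^ n < 1"
    using min_ratio max_ratio n by (auto simp: power_less_one_iff)
  show ?thesis
  proof (rule that[of "min_ratio ^ n"])
    fix \<delta> :: real assume d: "0 < \<delta>" "\<delta> < 1"
    obtain v where v: "v \<in> verts G" using verts_nonempty by blast
    have "min_ratio ^ n * \<delta> < 1" using mult_strict_mono[of "min_ratio ^ n" 1 \<delta> 1] an d by simp
    moreover have "short_side [] = 1" by (simp add: short_side_def)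
    moreover have "min_ratio ^ n * short_side u \<le> short_side (u @ w) \<and> short_side (u @ w) \<le> max_ratio ^ n * short_side u" if "walk v u" "w \<in> paths n (endp v u)" for u w
      using short_side_append[of v u w] that by (auto simp: paths_def)
    ultimately have "\<exists>C. block_cut (paths n) (endp v []) C \<and> (\<forall>w\<in>C. min_ratio ^ n * \<delta> < short_side ([] @ w) \<and> short_side ([] @ w) \<le> \<delta>)"
      using v d an by (intro stopping_block_cut[where c = "max_ratio ^ n"]) (auto intro: cut_paths sides_pos)
    then obtain C where C: "block_cut (paths n) v C" "\<forall>w\<in>C. min_ratio ^ n * \<delta> < short_side w \<and> short_side w \<le> \<delta>" by auto
    have "cut v C" using block_cut_cut[OF C(1)] cut_paths by blast
    moreover have "(\<Sum>w\<in>C. \<Phi> s v w) \<ge> 1" using block_cut_sum_ge_1[OF s(1) B C(1)] .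
    ultimately show "\<exists>v C. cut v C \<and> (\<forall>w\<in>C. min_ratio ^ n * \<delta> < short_side w \<and> short_side w \<le> \<delta>) \<and> (\<Sum>w\<in>C. \<Phi> s v w) \<ge> 1"
      using C(2) by blast
  qed (use an in auto)
qed

lemma cut_sum_large:
  assumes s: "log_pressure s > 0"
  obtains a where "0 < a" "a \<le> 1" "\<And>\<delta>. 0 < \<delta> \<Longrightarrow> \<delta> < 1 \<Longrightarrow>
    \<exists>v C. cut v C \<and> (\<forall>w\<in>C. a * \<delta> < short_side w \<and> short_side w \<le> \<delta>) \<and> (\<Sum>w\<in>C. \<Phi> s v w) \<ge> 1"
proof (cases "s \<le> \<theta>")
  case True
  have "\<exists>v C. cut v C \<and> (\<forall>w\<in>C. min_ratio * \<delta> < short_side w \<and> short_side w \<le> \<delta>) \<and> (\<Sum>w\<in>C. \<Phi> s v w) \<ge> 1"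
    if "0 < \<delta>" "\<delta> < 1" for \<delta>
    using submult_cut_sum[OF True s that] by metis
  then show ?thesis using that[of min_ratio] min_ratio by auto
next
  case False
  then have "s \<ge> \<theta>" by simp
  then show ?thesis using supermult_cut_sum[OF _ s] that by blast
qed

section \<open>Spectra of the planar measures\<close>

text \<open>
  The image of the open square is a product of two open intervals, and the image of the closed
  square lies in the product of the closed ones.
\<close>

lemma open_image_interval:
  assumes w: "walk v w"
  obtains lo where "\<And>x. x \<in> square \<Longrightarrow> \<forall>b. lo b \<le> coord b (\<psi> w x) \<and> coord b (\<psi> w x) \<le> lo b + ratio w b"
    "\<And>x. (\<forall>b. lo b < coord b x \<and> coord b x < lo b + ratio w b) \<Longrightarrow> x \<in> \<psi> w ` box 0 1"
proof -
  have ax: "axis_matrix (word_mat T w)" by (rule walk_axis[OF w])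
  define \<rho> where "\<rho> b = rowsum (word_mat T w) b" for b
  have rr: "ratio w b = \<bar>\<rho> b\<bar>" and r0: "\<rho> b \<noteq> 0" for b
    using rowsum_nonzero[OF ax] by (auto simp: ratio_def \<rho>_def)
  define lo where "lo b = coord b (\<psi> w 0) + min 0 (\<rho> b)" for b
  have eq: "\<psi> w = (\<lambda>\<xi>. word_mat T w *v \<xi> + \<psi> w 0)" by (rule ext) (rule word_map_affine)
  have 1: "lo b \<le> coord b (\<psi> w x) \<and> coord b (\<psi> w x) \<le> lo b + ratio w b" if x: "x \<in> square" for x b
  proof -
    have "coord b (\<psi> w x) = \<rho> b * coord (b = diag w) x + coord b (\<psi> w 0)" unfolding \<rho>_def by (rule coord_word_map[OF ax])
    moreover have y: "0 \<le> coord (b = diag w) x" "coord (b = diag w) x \<le> 1" using x by (auto simp: mem_cbox_coord)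
    moreover have "min 0 (\<rho> b) \<le> \<rho> b * coord (b = diag w) x" "\<rho> b * coord (b = diag w) x \<le> max 0 (\<rho> b)"
    proof -
      show "min 0 (\<rho> b) \<le> \<rho> b * coord (b = diag w) x"
        using y mult_left_mono_neg[of "coord (b = diag w) x" 1 "\<rho> b"] by (cases "\<rho> b \<ge> 0") auto
      show "\<rho> b * coord (b = diag w) x \<le> max 0 (\<rho> b)"
        using y mult_left_mono[of "coord (b = diag w) x" 1 "\<rho> b"] by (cases "\<rho> b \<ge> 0") (auto simp: mult_nonpos_nonneg)
    qed
    ultimately show ?thesis unfolding lo_def rr by linarith
  qed
  have 2: "x \<in> \<psi> w ` box 0 1" if x: "\<forall>b. lo b < coord b x \<and> coord b x < lo b + ratio w b" for x
  proof -
    have "0 < (coord b x - coord b (\<psi> w 0)) / \<rho> b \<and> (coord b x - coord b (\<psi> w 0)) / \<rho> b < 1" for b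
    proof (cases "\<rho> b > 0")
      case True
      then have "0 < coord b x - coord b (\<psi> w 0)" "coord b x - coord b (\<psi> w 0) < \<rho> b"
        using x[rule_format, of b] unfolding lo_def rr by auto
      then show ?thesis using True by auto
    next
      case False
      then have "\<rho> b < 0" using r0[of b] by simp
      moreover have "coord b x - coord b (\<psi> w 0) < 0" "\<rho> b < coord b x - coord b (\<psi> w 0)"
        using x[rule_format, of b] \<open>\<rho> b < 0\<close> unfolding lo_def rr by auto
      ultimately show ?thesis by (simp add: divide_less_eq zero_less_divide_iff)
    qed
    then have "x \<in> (\<lambda>\<xi>. word_mat T w *v \<xi> + \<psi> w 0) ` box 0 1"
      unfolding mem_affine_box[OF ax] \<rho>_def by blast
    then show ?thesis by (subst eq)
  qed
  show ?thesis using that[of lo] 1 2 by blast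
qed

text \<open>
  Each rectangle of the cut has sides longer than \<open>a * \<delta>\<close> and meets the same \<open>\<delta>\<close>-square, so its
  interior contains a point near that square of the grid of mesh \<open>a * \<delta> / 3\<close>. The interiors are
  disjoint, hence different rectangles get different points, and the number of available
  points depends on \<open>a\<close> only.
\<close>

lemma bounded_overlap:
  assumes a: "0 < a" "a \<le> 1"
  shows "\<exists>N>0. \<forall>v C \<delta> z. cut v C \<longrightarrow> 0 < \<delta> \<longrightarrow> (\<forall>w\<in>C. a * \<delta> < short_side w) \<longrightarrow>
    card {w \<in> C. z \<in> (grid2 \<delta> \<circ> \<psi> w) ` square} \<le> N"
proof -
  define M :: nat where "M = nat \<lceil>9 / a\<rceil> + 1"
  have M: "9 / a + 1 \<le> real M" unfolding M_def using a by (simp add: le_nat_iff)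
  have "card {w \<in> C. z \<in> (grid2 \<delta> \<circ> \<psi> w) ` square} \<le> M * M"
    if C: "cut v C" and d: "0 < \<delta>" and r: "\<And>w. w \<in> C \<Longrightarrow> a * \<delta> < short_side w" for v C \<delta> z
  proof -
    \<comment> \<open>An interval of length \<open>3 * \<epsilon>\<close> has a multiple of \<open>\<epsilon>\<close> in its interior within \<open>\<epsilon>\<close> of any of its points; \<open>I k\<close> are the possible multipliers over the mesh interval \<open>k\<close>.\<close>
    define \<epsilon> where "\<epsilon> = a * \<delta> / 3"
    have e: "\<epsilon> > 0" using a d by (simp add: \<epsilon>_def)
    define I where "I k = {\<lceil>3 * (real_of_int k - 1) / a\<rceil>..\<lfloor>3 * (real_of_int k + 2) / a\<rfloor>}" for k :: int
    have I: "i \<in> I k" if y: "\<lfloor>y / \<delta>\<rfloor> = k" "\<bar>of_int i * \<epsilon> - y\<bar> \<le> \<epsilon>" for i k y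
    proof -
      have "of_int k \<le> y / \<delta>" "y / \<delta> \<le> of_int k + 1" using y(1) by linarith+
      then have "of_int k * \<delta> \<le> y" "y \<le> (of_int k + 1) * \<delta>" using d by (simp_all add: field_simps)
      moreover have "\<epsilon> \<le> \<delta>" using mult_right_mono[OF a(2), of \<delta>] d by (simp add: \<epsilon>_def)
      ultimately have "(of_int k - 1) * \<delta> \<le> of_int i * \<epsilon>" "of_int i * \<epsilon> \<le> (of_int k + 2) * \<delta>"
        using y(2) by (auto simp: algebra_simps abs_le_iff)
      then have "\<delta> * (3 * (of_int k - 1)) \<le> \<delta> * (of_int i * a)" "\<delta> * (of_int i * a) \<le> \<delta> * (3 * (of_int k + 2))"
        by (simp_all add: \<epsilon>_def algebra_simps)
      then have "3 * (of_int k - 1) \<le> of_int i * a" "of_int i * a \<le> 3 * (of_int k + 2)"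
        using d by (simp_all only: mult_le_cancel_left_pos)
      then have "3 * (of_int k - 1) / a \<le> of_int i" "of_int i \<le> 3 * (of_int k + 2) / a"
        using a by (simp_all add: divide_le_eq le_divide_eq)
      then show ?thesis by (simp add: I_def ceiling_le_iff le_floor_iff)
    qed
    have finI: "finite (I k)" for k by (simp add: I_def)
    have cardI: "card (I k) \<le> M" for k
    proof -
      have "\<lfloor>3 * (real_of_int k + 2) / a\<rfloor> + 1 - \<lceil>3 * (real_of_int k - 1) / a\<rceil> \<le> int M"
      proof -
        have "3 * (real_of_int k + 2) / a - 3 * (real_of_int k - 1) / a = 9 / a"
          by (simp only: diff_divide_distrib[symmetric]) (simp add: algebra_simps)
        then show ?thesis using M by linarith
      qed
      then show ?thesis by (simp add: I_def)
    qed
    define W where "W = {w \<in> C. z \<in> (grid2 \<delta> \<circ> \<psi> w) ` square}"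
    have "\<exists>ij\<in>I (fst z) \<times> I (snd z). vector [of_int (fst ij) * \<epsilon>, of_int (snd ij) * \<epsilon>] \<in> \<psi> w ` box (0::real^2) 1"
      if w: "w \<in> W" for w
    proof -
      have wC: "w \<in> C" using w by (simp add: W_def)
      obtain x where x: "x \<in> square" "z = grid2 \<delta> (\<psi> w x)" using w by (auto simp: W_def)
      obtain lo where lo: "\<And>x. x \<in> square \<Longrightarrow> \<forall>b. lo b \<le> coord b (\<psi> w x) \<and> coord b (\<psi> w x) \<le> lo b + ratio w b"
        "\<And>x. (\<forall>b. lo b < coord b x \<and> coord b x < lo b + ratio w b) \<Longrightarrow> x \<in> \<psi> w ` box 0 1"
        using open_image_interval[OF cut_walk[OF C wC]] by blast
      have len: "lo b + 3 * \<epsilon> \<le> lo b + ratio w b" for b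
        using r[OF wC] short_side_le_ratio[of w b] by (simp add: \<epsilon>_def)
      have bd: "lo b \<le> coord b (\<psi> w x)" "coord b (\<psi> w x) \<le> lo b + ratio w b" for b using lo(1)[OF x(1)] by auto
      obtain i where i: "lo True < of_int i * \<epsilon>" "of_int i * \<epsilon> < lo True + ratio w True" "\<bar>of_int i * \<epsilon> - coord True (\<psi> w x)\<bar> \<le> \<epsilon>"
        using grid_point_in_interval[OF e len bd] .
      obtain j where j: "lo False < of_int j * \<epsilon>" "of_int j * \<epsilon> < lo False + ratio w False" "\<bar>of_int j * \<epsilon> - coord False (\<psi> w x)\<bar> \<le> \<epsilon>"
        using grid_point_in_interval[OF e len bd] .
      have "vector [of_int i * \<epsilon>, of_int j * \<epsilon>] \<in> \<psi> w ` box (0::real^2) 1"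
        using i j by (intro lo(2)) (auto simp: coord_def vector_2)
      moreover have "i \<in> I (fst z)" "j \<in> I (snd z)"
        using I[OF _ i(3)] I[OF _ j(3)] x(2) by (auto simp: grid2_def)
      ultimately show ?thesis by (intro bexI[of _ "(i, j)"]) auto
    qed
    then obtain \<iota> where \<iota>: "\<And>w. w \<in> W \<Longrightarrow> \<iota> w \<in> I (fst z) \<times> I (snd z)"
      "\<And>w. w \<in> W \<Longrightarrow> vector [of_int (fst (\<iota> w)) * \<epsilon>, of_int (snd (\<iota> w)) * \<epsilon>] \<in> \<psi> w ` box (0::real^2) 1"
      by metis
    have "inj_on \<iota> W"
    proof (rule inj_onI, rule ccontr)
      fix w w' assume ww: "w \<in> W" "w' \<in> W" "\<iota> w = \<iota> w'" "w \<noteq> w'"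
      have "w \<in> C" "w' \<in> C" using ww by (auto simp: W_def)
      then have "\<psi> w ` box 0 1 \<inter> \<psi> w' ` box 0 1 = {}" using cut_disjoint[OF C] ww(4) by blast
      then show False using \<iota>(2)[OF ww(1)] \<iota>(2)[OF ww(2)] ww(3) by auto
    qed
    then have "card W \<le> card (I (fst z) \<times> I (snd z))"
      using \<iota>(1) finI by (intro card_inj_on_le image_subsetI finite_cartesian_product) blast+
    also have "\<dots> \<le> M * M" unfolding card_cartesian_product using cardI by (intro mult_le_mono)
    finally show ?thesis unfolding W_def .
  qed
  moreover have "M * M > 0" by (simp add: M_def)
  ultimately show ?thesis by blast
qed

lemma proj_moment_uniform_power_bounds:
  assumes e: "e > 0"
  obtains c C where "c > 0" "C > 0" "\<And>v b \<delta>. v \<in> verts G \<Longrightarrow> 0 < \<delta> \<Longrightarrow> \<delta> < 1 \<Longrightarrow>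
    c * \<delta> powr (e - \<tau> v b) \<le> proj_moment v b \<delta> \<and> proj_moment v b \<delta> \<le> C * \<delta> powr (- e - \<tau> v b)"
proof -
  let ?I = "verts G \<times> (UNIV :: bool set)"
  have "\<exists>c C. c > 0 \<and> C > 0 \<and> (\<forall>\<delta>. 0 < \<delta> \<longrightarrow> \<delta> < 1 \<longrightarrow>
    c * \<delta> powr (e - \<tau> (fst i) (snd i)) \<le> proj_moment (fst i) (snd i) \<delta> \<and> proj_moment (fst i) (snd i) \<delta> \<le> C * \<delta> powr (- e - \<tau> (fst i) (snd i)))"
    if "i \<in> ?I" for i
  proof -
    have "fst i \<in> verts G" using that by auto
    from proj_moment_power_bounds[OF this e, of "snd i"] show ?thesis by metis
  qed
  then obtain c C where cC: "\<And>i. i \<in> ?I \<Longrightarrow> c i > 0" "\<And>i. i \<in> ?I \<Longrightarrow> C i > 0"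
    "\<And>i \<delta>. i \<in> ?I \<Longrightarrow> 0 < \<delta> \<Longrightarrow> \<delta> < 1 \<Longrightarrow>
    c i * \<delta> powr (e - \<tau> (fst i) (snd i)) \<le> proj_moment (fst i) (snd i) \<delta> \<and> proj_moment (fst i) (snd i) \<delta> \<le> C i * \<delta> powr (- e - \<tau> (fst i) (snd i))"
    by metis
  define c0 where "c0 = Min (insert 1 (c ` ?I))"
  define C0 where "C0 = Max (insert 1 (C ` ?I))"
  have fin: "finite ?I" by simp
  have c0: "c0 > 0" unfolding c0_def using fin cC(1) by (subst Min_gr_iff) auto
  have "1 \<le> C0" unfolding C0_def using fin by (intro Max_ge) auto
  then have C0: "C0 > 0" by linarith
  have "c0 * \<delta> powr (e - \<tau> v b) \<le> proj_moment v b \<delta> \<and> proj_moment v b \<delta> \<le> C0 * \<delta> powr (- e - \<tau> v b)"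
    if v: "v \<in> verts G" and d: "0 < \<delta>" "\<delta> < 1" for v b \<delta>
  proof -
    have i: "(v, b) \<in> ?I" using v by simp
    have "c0 \<le> c (v, b)" unfolding c0_def using fin i by (intro Min_le) auto
    moreover have "C (v, b) \<le> C0" unfolding C0_def using fin i by (intro Max_ge) auto
    ultimately have "c0 * \<delta> powr (e - \<tau> v b) \<le> c (v, b) * \<delta> powr (e - \<tau> v b)"
      "C (v, b) * \<delta> powr (- e - \<tau> v b) \<le> C0 * \<delta> powr (- e - \<tau> v b)" by (intro mult_right_mono; simp)+
    then show ?thesis using cC(3)[OF i d] by auto
  qed
  then show ?thesis using that[OF c0 C0] by blast
qed

lemma \<tau>_bounded: obtains m where "\<And>v b. v \<in> verts G \<Longrightarrow> \<bar>\<tau> v b\<bar> \<le> m"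
proof -
  have "\<bar>\<tau> v b\<bar> \<le> Max ((\<lambda>(v, b). \<bar>\<tau> v b\<bar>) ` (verts G \<times> UNIV))" if "v \<in> verts G" for v b
    using that by (intro Max_ge) force+
  then show ?thesis using that by blast
qed

text \<open>
  The contribution of one piece of the cut: compare the planar moment with that of the projection
  along the long side, insert the power bounds for the latter, and rewrite the result as
  \<open>\<Phi>\<close>.
\<close>

lemma word_moment_bounds:
  assumes e: "e > 0" and a: "0 < a" "a \<le> 1"
  obtains c C where "c > 0" "C > 0" "\<And>v w \<delta>. walk v w \<Longrightarrow> 0 < \<delta> \<Longrightarrow> a * \<delta> < short_side w \<Longrightarrow> short_side w \<le> \<delta> \<Longrightarrow>
    pr w powr q * moment (\<mu> (endp v w)) q (grid2 \<delta> \<circ> \<psi> w) \<le> C * \<delta> powr (- e - s) * \<Phi> s v w \<and>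
    c * \<delta> powr (e - s) * \<Phi> s v w \<le> pr w powr q * moment (\<mu> (endp v w)) q (grid2 \<delta> \<circ> \<psi> w)"
proof -
  obtain c1 C1 where c1: "c1 > 0" "C1 > 0" "\<And>v b \<delta>. v \<in> verts G \<Longrightarrow> 0 < \<delta> \<Longrightarrow> \<delta> < 1 \<Longrightarrow>
    c1 * \<delta> powr (e - \<tau> v b) \<le> proj_moment v b \<delta> \<and> proj_moment v b \<delta> \<le> C1 * \<delta> powr (- e - \<tau> v b)"
    using proj_moment_uniform_power_bounds[OF e] by blast
  obtain m where m: "\<And>v b. v \<in> verts G \<Longrightarrow> \<bar>\<tau> v b\<bar> \<le> m" using \<tau>_bounded by blast
  obtain L0 :: nat where L0: "1 / a \<le> real L0" using real_arch_simple by blast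
  define L where "L = max L0 1"
  have L: "1 / a \<le> real L" "L \<ge> 1" using L0 by (auto simp: L_def)
  then have aL: "1 \<le> real L * a" using a by (simp add: field_simps)
  have g: "grid_const L > 0" by (rule grid_const_pos)
  define \<kappa> where "\<kappa> = a powr (- (e + m) - (\<bar>s\<bar> + m))"
  define \<kappa>' where "\<kappa>' = a powr ((e + m) + (\<bar>s\<bar> + m))"
  have \<kappa>: "\<kappa> > 0" "\<kappa>' > 0" using a by (auto simp: \<kappa>_def \<kappa>'_def)
  have main: "pr w powr q * moment (\<mu> (endp v w)) q (grid2 \<delta> \<circ> \<psi> w) \<le> (grid_const L * C1 * \<kappa>) * \<delta> powr (- e - s) * \<Phi> s v w \<and>
    (c1 * \<kappa>' / grid_const L) * \<delta> powr (e - s) * \<Phi> s v w \<le> pr w powr q * moment (\<mu> (endp v w)) q (grid2 \<delta> \<circ> \<psi> w)"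
    if w: "walk v w" and d: "0 < \<delta>" and y: "a * \<delta> < short_side w" "short_side w \<le> \<delta>" for v w \<delta>
  proof -
    define b where "b = wide w"
    have vs: "v \<in> verts G" "endp v w \<in> verts G" using walk_verts[OF w] by auto
    have x: "0 < long_side w" "long_side w \<le> 1" using sides_pos[OF w] long_side_le_1[OF w] by auto
    \<comment> \<open>The natural scale is \<open>\<delta> / long_side w\<close>; the factor \<open>a\<close> keeps it below \<open>1\<close>, where the power bounds hold.\<close>
    define \<eta> where "\<eta> = a * \<delta> / long_side w"
    have eta: "0 < \<eta>" "\<eta> < 1"
    proof -
      show "0 < \<eta>" using a d x by (simp add: \<eta>_def)
      have "a * \<delta> < long_side w" using y(1) short_side_le_long_side[of w] by linarith
      then show "\<eta> < 1" using x by (simp add: \<eta>_def)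
    qed
    have r: "ratio w b * \<eta> = a * \<delta>" using x by (simp add: \<eta>_def b_def long_side_def[symmetric])
    have l1: "ratio w b * \<eta> \<le> real L * \<delta>"
    proof -
      have "a \<le> real L" using a L by linarith
      then show ?thesis unfolding r using d by (intro mult_right_mono) auto
    qed
    have l2: "\<delta> \<le> real L * (ratio w b * \<eta>)"
      unfolding r using mult_right_mono[OF aL, of \<delta>] d by (simp add: mult_ac)
    have thin: "ratio w (\<not> b) \<le> \<delta>" using y(2) by (simp add: b_def short_side_def)
    note cmp = compare_grid2[OF w d eta(1) l1 l2 thin L(2), folded proj_moment_def]
    have t: "\<tau> (endp v w) (b = diag w) = \<tau> v b" by (rule \<tau>_walk[OF w])
    note M1b = c1(3)[OF vs(2) eta, of "b = diag w", unfolded t]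
    have bm: "\<bar>\<tau> v b\<bar> \<le> m" by (rule m[OF vs(1)])
    note tw = thin_weight_bounds[OF a d x less_imp_le[OF y(1)] y(2) bm less_imp_le[OF e], of s,
        folded \<eta>_def \<kappa>_def \<kappa>'_def]
    have P: "pr w powr q > 0" using pr_pos[OF w] by simp
    have \<Phi>: "\<Phi> s v w = pr w powr q * (long_side w powr \<tau> v b * short_side w powr (s - \<tau> v b))"
      unfolding \<Phi>_alt b_def by simp
    have "moment (\<mu> (endp v w)) q (grid2 \<delta> \<circ> \<psi> w) \<le> grid_const L * (C1 * \<eta> powr (- e - \<tau> v b))"
      using cmp(1) mult_left_mono[OF conjunct2[OF M1b], of "grid_const L"] g by linarith
    also have "\<dots> \<le> grid_const L * (C1 * (\<kappa> * \<delta> powr (- e - s) * (long_side w powr \<tau> v b * short_side w powr (s - \<tau> v b))))"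
      using tw(1) g c1(2) by (intro mult_left_mono) auto
    finally have "pr w powr q * moment (\<mu> (endp v w)) q (grid2 \<delta> \<circ> \<psi> w) \<le>
      pr w powr q * (grid_const L * (C1 * (\<kappa> * \<delta> powr (- e - s) * (long_side w powr \<tau> v b * short_side w powr (s - \<tau> v b)))))"
      using P by (intro mult_left_mono) auto
    also have "\<dots> = (grid_const L * C1 * \<kappa>) * \<delta> powr (- e - s) * \<Phi> s v w" unfolding \<Phi> by (simp only: mult_ac)
    finally have up: "pr w powr q * moment (\<mu> (endp v w)) q (grid2 \<delta> \<circ> \<psi> w) \<le> \<dots>" .
    have "c1 * (\<kappa>' * \<delta> powr (e - s) * (long_side w powr \<tau> v b * short_side w powr (s - \<tau> v b))) \<le> c1 * \<eta> powr (e - \<tau> v b)"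
      using tw(2) c1(1) by (intro mult_left_mono) auto
    also have "\<dots> \<le> grid_const L * moment (\<mu> (endp v w)) q (grid2 \<delta> \<circ> \<psi> w)" using M1b cmp(2) by linarith
    finally have "pr w powr q * (c1 * (\<kappa>' * \<delta> powr (e - s) * (long_side w powr \<tau> v b * short_side w powr (s - \<tau> v b)))) \<le>
      pr w powr q * (grid_const L * moment (\<mu> (endp v w)) q (grid2 \<delta> \<circ> \<psi> w))" using P by (intro mult_left_mono) auto
    moreover have "pr w powr q * (c1 * (\<kappa>' * \<delta> powr (e - s) * (long_side w powr \<tau> v b * short_side w powr (s - \<tau> v b)))) =
      c1 * \<kappa>' * \<delta> powr (e - s) * \<Phi> s v w" unfolding \<Phi> by (simp only: mult_ac)
    moreover have "pr w powr q * (grid_const L * moment (\<mu> (endp v w)) q (grid2 \<delta> \<circ> \<psi> w)) =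
      grid_const L * (pr w powr q * moment (\<mu> (endp v w)) q (grid2 \<delta> \<circ> \<psi> w))" by (simp only: mult_ac)
    ultimately have "c1 * \<kappa>' * \<delta> powr (e - s) * \<Phi> s v w \<le>
      grid_const L * (pr w powr q * moment (\<mu> (endp v w)) q (grid2 \<delta> \<circ> \<psi> w))" by simp
    then have "(c1 * \<kappa>' * \<delta> powr (e - s) * \<Phi> s v w) / grid_const L \<le> pr w powr q * moment (\<mu> (endp v w)) q (grid2 \<delta> \<circ> \<psi> w)"
      using g by (subst pos_divide_le_eq) (auto simp: mult.commute)
    then show ?thesis using up by simp
  qed
  have "c1 * \<kappa>' / grid_const L > 0" "grid_const L * C1 * \<kappa> > 0" using c1 \<kappa> g by auto
  then show ?thesis using that main by blast
qed

lemma planar_upper_bound: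
  assumes g: "log_pressure g = 0" and e: "e > 0" and v: "v \<in> verts G"
  shows "\<exists>C. \<forall>\<delta>\<in>{0<..<1}. moment_sum (\<mu> v) q \<delta> \<le> C * \<delta> powr (- e - g)"
proof -
  define e' where "e' = e / 2"
  have e': "e' > 0" using e by (simp add: e'_def)
  \<comment> \<open>Half of \<open>e\<close> is spent on moving above the critical exponent, the other half on the power bounds of the projections.\<close>
  define s where "s = g + e'"
  have "log_pressure s < 0" using log_pressure_strict_decreasing[of g s] e' g by (simp add: s_def)
  then obtain B where B: "B > 0" "\<And>v C. cut v C \<Longrightarrow> (\<Sum>w\<in>C. \<Phi> s v w) \<le> B" using cut_sum_bounded by blast
  obtain N where N: "N > 0" "\<forall>v C \<delta> z. cut v C \<longrightarrow> 0 < \<delta> \<longrightarrow> (\<forall>w\<in>C. min_ratio * \<delta> < short_side w) \<longrightarrow>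
    card {w \<in> C. z \<in> (grid2 \<delta> \<circ> \<psi> w) ` square} \<le> N"
    using bounded_overlap[OF min_ratio(1) less_imp_le[OF min_ratio(2)]] by blast
  obtain c C where cC: "c > 0" "C > 0" "\<And>v w \<delta>. walk v w \<Longrightarrow> 0 < \<delta> \<Longrightarrow> min_ratio * \<delta> < short_side w \<Longrightarrow> short_side w \<le> \<delta> \<Longrightarrow>
    pr w powr q * moment (\<mu> (endp v w)) q (grid2 \<delta> \<circ> \<psi> w) \<le> C * \<delta> powr (- e' - s) * \<Phi> s v w \<and>
    c * \<delta> powr (e' - s) * \<Phi> s v w \<le> pr w powr q * moment (\<mu> (endp v w)) q (grid2 \<delta> \<circ> \<psi> w)"
    using word_moment_bounds[OF e' min_ratio(1) less_imp_le[OF min_ratio(2)], of s] by blast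
  have "moment_sum (\<mu> v) q \<delta> \<le> (relation_const 4 * (real N powr q * (C * B))) * \<delta> powr (- e - g)" if d: "0 < \<delta>" "\<delta> < 1" for \<delta>
  proof -
    obtain W where W: "cut v W" "\<And>w. w \<in> W \<Longrightarrow> min_ratio * \<delta> < short_side w \<and> short_side w \<le> \<delta>"
      using stopping_cut_short_side[OF v d(1) less_imp_le[OF d(2)]] by blast
    have "planar_moment v \<delta> \<le> real N powr q * (\<Sum>w\<in>W. pr w powr q * moment (\<mu> (endp v w)) q (grid2 \<delta> \<circ> \<psi> w))"
      unfolding planar_moment_def using W d by (intro moment_cut(1) label_grid2 N(2)[rule_format]) auto
    also have "\<dots> \<le> real N powr q * (\<Sum>w\<in>W. C * \<delta> powr (- e' - s) * \<Phi> s v w)"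
      using cC(3)[OF cut_walk[OF W(1)] d(1)] W(2) by (intro mult_left_mono sum_mono) auto
    also have "\<dots> = real N powr q * (C * \<delta> powr (- e' - s) * (\<Sum>w\<in>W. \<Phi> s v w))" by (simp only: sum_distrib_left)
    also have "\<dots> \<le> real N powr q * (C * \<delta> powr (- e' - s) * B)"
      using B(2)[OF W(1)] cC(2) by (intro mult_left_mono) auto
    also have "- e' - s = - e - g" by (simp add: s_def e'_def)
    finally have "relation_const 4 * planar_moment v \<delta> \<le> relation_const 4 * (real N powr q * (C * \<delta> powr (- e - g) * B))"
      using relation_const_nonneg by (intro mult_left_mono) auto
    then show ?thesis using moment_sum_planar(2)[OF v d(1)] by (simp add: mult_ac)
  qed
  then show ?thesis by (intro exI[of _ "relation_const 4 * (real N powr q * (C * B))"]) auto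
qed

text \<open>
  The measure \<open>\<mu> v\<close> contains an affine copy of \<open>\<mu> v'\<close>. This is what makes a lower bound at a single,
  scale-dependent vertex sufficient.
\<close>

lemma planar_moment_ge_other:
  assumes v: "v \<in> verts G"
  obtains c where "c > 0" "\<And>v' \<delta>. v' \<in> verts G \<Longrightarrow> \<delta> > 0 \<Longrightarrow> c * planar_moment v' \<delta> \<le> planar_moment v \<delta>"
proof -
  have "\<exists>c>0. \<forall>\<delta>>0. c * planar_moment v' \<delta> \<le> planar_moment v \<delta>" if v': "v' \<in> verts G" for v'
  proof -
    obtain w where w: "walk v w" "endp v w = v'" using connecting_walk[OF v v'] .
    obtain L0 :: nat where L0: "1 / short_side w \<le> real L0" using real_arch_simple by blast
    define L where "L = max L0 1"
    have p: "short_side w > 0" by (rule sides_pos[OF w(1)])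
    have "1 / short_side w \<le> real L" using L0 by (simp add: L_def)
    then have "1 \<le> real L * short_side w" using p by (simp add: field_simps)
    moreover have "real L * short_side w \<le> real L * ratio w b" for b using short_side_le_ratio by (intro mult_left_mono) auto
    ultimately have L: "1 \<le> real L * ratio w b" for b using order_trans by blast
    have L1: "L \<ge> 1" by (simp add: L_def)
    define c where "c = pr w powr q / grid_const L"
    have "c * planar_moment v' \<delta> \<le> planar_moment v \<delta>" if d: "\<delta> > 0" for \<delta>
    proof -
      have "planar_moment v' \<delta> \<le> grid_const L * moment (\<mu> (endp v w)) q (grid2 \<delta> \<circ> \<psi> w)"
        unfolding planar_moment_def w(2)[symmetric] by (rule compare_grid2_self[OF w(1) d L L1])
      then have "c * planar_moment v' \<delta> \<le> pr w powr q * moment (\<mu> (endp v w)) q (grid2 \<delta> \<circ> \<psi> w)"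
        unfolding c_def using grid_const_pos[of L] pr_pos[OF w(1)] by (simp add: field_simps)
      also have "\<dots> \<le> planar_moment v \<delta>" unfolding planar_moment_def using w d by (intro moment_ge_word label_grid2)
      finally show ?thesis .
    qed
    moreover have "c > 0" using pr_pos[OF w(1)] grid_const_pos by (simp add: c_def)
    ultimately show ?thesis by blast
  qed
  then obtain c where c: "\<And>v'. v' \<in> verts G \<Longrightarrow> c v' > 0 \<and> (\<forall>\<delta>>0. c v' * planar_moment v' \<delta> \<le> planar_moment v \<delta>)" by metis
  define c0 where "c0 = Min (c ` verts G)"
  have fin: "finite (c ` verts G)" "c ` verts G \<noteq> {}" using verts_nonempty by auto
  have "c0 > 0" unfolding c0_def using fin c by (subst Min_gr_iff) auto
  moreover have "c0 * planar_moment v' \<delta> \<le> planar_moment v \<delta>" if "v' \<in> verts G" "\<delta> > 0" for v' \<delta>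
  proof -
    have "c0 \<le> c v'" unfolding c0_def using fin that by (intro Min_le) auto
    then have "c0 * planar_moment v' \<delta> \<le> c v' * planar_moment v' \<delta>" by (intro mult_right_mono) (auto simp: planar_moment_def moment_nonneg)
    then show ?thesis using c[OF that(1)] that(2) by fastforce
  qed
  ultimately show ?thesis using that by blast
qed

lemma planar_lower_bound:
  assumes g: "log_pressure g = 0" and e: "e > 0" and v: "v \<in> verts G"
  shows "\<exists>c>0. \<forall>\<delta>\<in>{0<..<1}. c * \<delta> powr (e - g) \<le> moment_sum (\<mu> v) q \<delta>"
proof -
  define e' where "e' = e / 2"
  have e': "e' > 0" using e by (simp add: e'_def)
  \<comment> \<open>As in the upper bound, \<open>e\<close> is split between the exponent and the power bounds.\<close>
  define s where "s = g - e'"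
  have "log_pressure s > 0" using log_pressure_strict_decreasing[of s g] e' g by (simp add: s_def)
  then obtain a where a: "0 < a" "a \<le> 1" "\<And>\<delta>. 0 < \<delta> \<Longrightarrow> \<delta> < 1 \<Longrightarrow>
    \<exists>v C. cut v C \<and> (\<forall>w\<in>C. a * \<delta> < short_side w \<and> short_side w \<le> \<delta>) \<and> (\<Sum>w\<in>C. \<Phi> s v w) \<ge> 1"
    using cut_sum_large by blast
  obtain N where N: "N > 0" "\<forall>v C \<delta> z. cut v C \<longrightarrow> 0 < \<delta> \<longrightarrow> (\<forall>w\<in>C. a * \<delta> < short_side w) \<longrightarrow>
    card {w \<in> C. z \<in> (grid2 \<delta> \<circ> \<psi> w) ` square} \<le> N"
    using bounded_overlap[OF a(1,2)] by blast
  obtain c C where cC: "c > 0" "C > 0" "\<And>v w \<delta>. walk v w \<Longrightarrow> 0 < \<delta> \<Longrightarrow> a * \<delta> < short_side w \<Longrightarrow> short_side w \<le> \<delta> \<Longrightarrow>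
    pr w powr q * moment (\<mu> (endp v w)) q (grid2 \<delta> \<circ> \<psi> w) \<le> C * \<delta> powr (- e' - s) * \<Phi> s v w \<and>
    c * \<delta> powr (e' - s) * \<Phi> s v w \<le> pr w powr q * moment (\<mu> (endp v w)) q (grid2 \<delta> \<circ> \<psi> w)"
    using word_moment_bounds[OF e' a(1,2), of s] by blast
  obtain k where k: "k > 0" "\<And>v' \<delta>. v' \<in> verts G \<Longrightarrow> \<delta> > 0 \<Longrightarrow> k * planar_moment v' \<delta> \<le> planar_moment v \<delta>"
    using planar_moment_ge_other[OF v] by blast
  have "(k * (c / real N)) * \<delta> powr (e - g) \<le> moment_sum (\<mu> v) q \<delta>" if d: "0 < \<delta>" "\<delta> < 1" for \<delta>
  proof -
    obtain v' W where W: "cut v' W" "\<And>w. w \<in> W \<Longrightarrow> a * \<delta> < short_side w \<and> short_side w \<le> \<delta>" "(\<Sum>w\<in>W. \<Phi> s v' w) \<ge> 1"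
      using a(3)[OF d] by blast
    have "c * \<delta> powr (e' - s) * 1 \<le> c * \<delta> powr (e' - s) * (\<Sum>w\<in>W. \<Phi> s v' w)"
      using W(3) cC(1) by (intro mult_left_mono) auto
    also have "\<dots> = (\<Sum>w\<in>W. c * \<delta> powr (e' - s) * \<Phi> s v' w)" by (rule sum_distrib_left)
    also have "\<dots> \<le> (\<Sum>w\<in>W. pr w powr q * moment (\<mu> (endp v' w)) q (grid2 \<delta> \<circ> \<psi> w))"
      using cC(3)[OF cut_walk[OF W(1)] d(1)] W(2) by (intro sum_mono) auto
    also have "\<dots> \<le> real N * planar_moment v' \<delta>"
      unfolding planar_moment_def using W d by (intro moment_cut(2) label_grid2 N(2)[rule_format]) auto
    also have "e' - s = e - g" by (simp add: s_def e'_def)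
    finally have "c / real N * \<delta> powr (e - g) \<le> planar_moment v' \<delta>" using N(1) by (simp add: field_simps)
    then have "k * (c / real N * \<delta> powr (e - g)) \<le> k * planar_moment v' \<delta>" using k(1) by (intro mult_left_mono) auto
    also have "\<dots> \<le> planar_moment v \<delta>" using k(2) cut_verts[OF W(1)] d(1) by blast
    also have "\<dots> \<le> moment_sum (\<mu> v) q \<delta>" by (rule moment_sum_planar(1)[OF v d(1)])
    finally show ?thesis by (simp only: mult.assoc)
  qed
  moreover have "k * (c / real N) > 0" using k cC N by simp
  ultimately show ?thesis by (intro exI[of _ "k * (c / real N)"]) auto
qed

lemma planar_Lq_limit:
  assumes "v \<in> verts G"
  shows "(Lq_quotient (\<mu> v) q \<longlongrightarrow> gamma G T t p \<mu> q) (at_right 0)"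
  unfolding Lq_quotient_def[abs_def]
  using assms planar_lower_bound[OF log_pressure_gamma] planar_upper_bound[OF log_pressure_gamma]
  by (intro Lq_limit_of_power_bounds) auto

end

theorem theorem2p2:
  fixes G :: "('v, 'e) pre_digraph"
    and T :: "'e \<Rightarrow> real^2^2" and t :: "'e \<Rightarrow> real^2"
    and p :: "'e \<Rightarrow> real"
    and X :: "'v \<Rightarrow> (real^2) set" and \<mu> :: "'v \<Rightarrow> (real^2) measure"
    and q :: real and v :: 'v
  assumes "box_like_GIFS G T"
    and "strongly_connected_graph G"
    and "ROSC G T t"
    and "associated_positive_vector G p"
    and "attractor_family G T t X"
    and "associated_measure_family G T t p X \<mu>"
    and "q \<ge> 0"
    and "v \<in> verts G"
  shows "(\<exists>!s. pressure G T t p \<mu> s q = 1) \<and>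
         Lq_spectrum_exists (\<mu> v) q \<and>
         Lq_spectrum (\<mu> v) q = gamma G T t p \<mu> q"
proof -
  interpret box_like_system G T t p X \<mu> q
    using assms by unfold_locales auto
  note lim = planar_Lq_limit[OF assms(8)]
  have "Lq_spectrum_exists (\<mu> v) q" unfolding Lq_spectrum_exists_def using lim by blast
  moreover have "Lq_spectrum (\<mu> v) q = gamma G T t p \<mu> q"
    unfolding Lq_spectrum_def by (rule tendsto_Lim[OF _ lim]) simp
  ultimately show ?thesis using pressure_unique_root by blast
qed

end
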